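(* Let $-\infty\leq a<b\leq\infty$, and let $p,q,r,s$ be real-valued Lebesgue measurable functions on $(a,b)$ with $p>0$ and $r>0$ a.e. on $(a,b)$ and $p^{-1},q,r,s\in L^1_{loc}((a,b);dx)$. Let $\tau$ be the associated four-coefficient Sturm--Liouville differential expression, $T_{min,(a,b)}$ the associated minimal operator in $L^2((a,b);r\,dx)$, and $T_{F,(a,b)}$ its Friedrichs extension (which exists if $T_{min,(a,b)}$ is bounded from below). Let $\lambda_0\in\mathbb{R}$. Then the following statements (i)--(iv) are equivalent. (i) $T_{min,(a,b)}\geq\lambda_0 I_{L^2((a,b);r\,dx)}$. (ii) $T_{min,(a,b)}$ is bounded from below and its Friedrichs extension satisfies $T_{F,(a,b)}\geq\lambda_0 I_{L^2((a,b);r\,dx)}$. (iii) $\tau-\lambda_0$ is disconjugate on $(a,b)$. (iv) There exists a strictly positive solution $u_0(\lambda_0,\cdot)>0$ of $(\tau-\lambda_0)u=0$ on $(a,b)$.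
   Context: $AC_{loc}((a,b))$ denotes the locally absolutely continuous complex-valued functions on $(a,b)$. Given the coefficients $p,q,r,s$, set $$\mathfrak{D}_\tau((a,b))=\{g\in AC_{loc}((a,b)) : g^{[1]}:=p[g'+sg]\in AC_{loc}((a,b))\}$$ (more precisely, $p[g'+sg]$ agrees a.e. with a locally absolutely continuous function, denoted $g^{[1]}$ and called the first quasi-derivative of $g$), and $$\tau f=\frac1r\Big(-\big(f^{[1]}\big)'+s f^{[1]}+qf\Big),\quad f\in\mathfrak{D}_\tau((a,b)).$$ A solution of $(\tau-\lambda)u=0$ on $(a,b)$ is a function $u\in\mathfrak{D}_\tau((a,b))$ with $\tau u=\lambda u$ a.e. on $(a,b)$. The expression $\tau-\lambda$ ($\lambda\in\mathbb{R}$) is called disconjugate on $(a,b)$ if every nontrivial real-valued solution of $\tau u=\lambda u$ has at most one zero in $(a,b)$. The Hilbert space is $L^2((a,b);r\,dx)$ with inner product $(f,g)=\int_a^b\overline{f(x)}g(x)\,r(x)\,dx$. The maximal operator $T_{max}$ acts as $f\mapsto\tau f$ on the domain of all $g\in L^2((a,b);r\,dx)\cap\mathfrak{D}_\tau((a,b))$ with $\tau g\in L^2((a,b);r\,dx)$. The minimal operator $T_{min,(a,b)}$ is the closure of the restriction of $T_{max}$ to those functions in its domain that have compact support in $(a,b)$; it is a densely defined closed symmetric operator. For a symmetric operator $S$ in a Hilbert space $\mathcal{H}$, $S\geq\lambda_0 I_{\mathcal{H}}$ means $(u,Su)_{\mathcal{H}}\geq\lambda_0(u,u)_{\mathcal{H}}$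 for all $u\in\operatorname{dom}(S)$; $S$ is bounded from below if this holds for some real $\lambda_0$. The Friedrichs extension of a densely defined symmetric operator $S$ bounded from below is the self-adjoint operator associated with the closure of the quadratic form $u\mapsto(u,Su)_{\mathcal{H}}$, $u\in\operatorname{dom}(S)$. *)

theory Defs
  imports "HOL-Analysis.Analysis"
begin

section \<open>Local integrability and local absolute continuity\<close>

definition L1_loc :: "real set \<Rightarrow> (real \<Rightarrow> real) set" where
  "L1_loc J = {f. \<forall>c d. {c..d} \<subseteq> J \<longrightarrow> set_integrable lebesgue {c..d} f}"

text \<open>The finite set \<open>D\<close> collects the endpoint pairs of a finite family of non-overlapping
  subintervals.\<close>

definition abs_cont_on :: "real set \<Rightarrow> (real \<Rightarrow> complex) \<Rightarrow> bool" where
  "abs_cont_on A f \<longleftrightarrow>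
    (\<forall>\<epsilon>>0. \<exists>\<delta>>0. \<forall>D. finite D \<longrightarrow> (\<forall>(x, y)\<in>D. x \<le> y \<and> {x..y} \<subseteq> A) \<longrightarrow>
       disjoint_family_on (\<lambda>(x, y). {x<..<y}) D \<longrightarrow> (\<Sum>(x, y)\<in>D. y - x) < \<delta> \<longrightarrow>
       (\<Sum>(x, y)\<in>D. norm (f y - f x)) < \<epsilon>)"

definition AC_loc :: "real set \<Rightarrow> (real \<Rightarrow> complex) set" where
  "AC_loc J = {f. \<forall>c d. {c..d} \<subseteq> J \<longrightarrow> abs_cont_on {c..d} f}"


section \<open>The Hilbert space of square-integrable functions\<close>

text \<open>Elements of \<open>L\<^sup>2(M)\<close> are handled through representatives modulo equality almost everywhere.\<close>

definition L2 :: "'a measure \<Rightarrow> ('a \<Rightarrow> complex) set" where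
  "L2 M = {f \<in> borel_measurable M. integrable M (\<lambda>x. (norm (f x))\<^sup>2)}"

definition L2_inner :: "'a measure \<Rightarrow> ('a \<Rightarrow> complex) \<Rightarrow> ('a \<Rightarrow> complex) \<Rightarrow> complex" where
  "L2_inner M f g = (LINT x|M. cnj (f x) * g x)"

definition L2_tendsto :: "'a measure \<Rightarrow> (nat \<Rightarrow> 'a \<Rightarrow> complex) \<Rightarrow> ('a \<Rightarrow> complex) \<Rightarrow> bool" where
  "L2_tendsto M F f \<longleftrightarrow> (\<lambda>n. sqrt (LINT x|M. (norm (F n x - f x))\<^sup>2)) \<longlonglongrightarrow> 0"


section \<open>Operators and forms in \<open>L\<^sup>2(M)\<close>\<close>

text \<open>An operator is given by its graph, a set of pairs of representatives, which need not contain
  every representative of its elements. Closures and operators of closed forms do contain them all.\<close>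

type_synonym 'a l2_op = "(('a \<Rightarrow> complex) \<times> ('a \<Rightarrow> complex)) set"

definition op_closure :: "'a measure \<Rightarrow> 'a l2_op \<Rightarrow> 'a l2_op" where
  "op_closure M S = {(f, g). f \<in> L2 M \<and> g \<in> L2 M \<and>
     (\<exists>F G. (\<forall>n. (F n, G n) \<in> S) \<and> L2_tendsto M F f \<and> L2_tendsto M G g)}"

text \<open>Only used for symmetric \<open>S\<close>, where \<open>(u, S u)\<close> is real; taking real parts merely changes the
  type.\<close>

definition op_ge :: "'a measure \<Rightarrow> 'a l2_op \<Rightarrow> real \<Rightarrow> bool" where
  "op_ge M S c \<longleftrightarrow> (\<forall>(u, v)\<in>S. Re (L2_inner M u v) \<ge> c * Re (L2_inner M u u))"

definition bounded_from_below :: "'a measure \<Rightarrow> 'a l2_op \<Rightarrow> bool" where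
  "bounded_from_below M S \<longleftrightarrow> (\<exists>c. op_ge M S c)"

text \<open>A sesquilinear form is given by its domain and its values; the quadratic form is its
  restriction to the diagonal.\<close>

type_synonym 'a l2_form =
  "('a \<Rightarrow> complex) set \<times> (('a \<Rightarrow> complex) \<Rightarrow> ('a \<Rightarrow> complex) \<Rightarrow> complex)"

text \<open>The choice below selects a representative of \<open>S v\<close>.\<close>

definition form_of_op :: "'a measure \<Rightarrow> 'a l2_op \<Rightarrow> 'a l2_form" where
  "form_of_op M S = (Domain S, \<lambda>u v. L2_inner M u (SOME w. (v, w) \<in> S))"

text \<open>Form convergence in the sense of Kato, for forms bounded from below.\<close>

definition form_tendsto ::
  "'a measure \<Rightarrow> 'a l2_form \<Rightarrow> (nat \<Rightarrow> 'a \<Rightarrow> complex) \<Rightarrow> ('a \<Rightarrow> complex) \<Rightarrow> bool" where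
  "form_tendsto M Q U u \<longleftrightarrow> (\<forall>n. U n \<in> fst Q) \<and> L2_tendsto M U u \<and>
     (\<forall>\<epsilon>>0. \<exists>N. \<forall>m\<ge>N. \<forall>n\<ge>N.
        norm (snd Q (\<lambda>x. U m x - U n x) (\<lambda>x. U m x - U n x)) < \<epsilon>)"

definition form_closure :: "'a measure \<Rightarrow> 'a l2_form \<Rightarrow> 'a l2_form" where
  "form_closure M Q =
     ({u \<in> L2 M. \<exists>U. form_tendsto M Q U u},
      \<lambda>u v. THE z. \<forall>U V. form_tendsto M Q U u \<longrightarrow> form_tendsto M Q V v \<longrightarrow>
                      (\<lambda>n. snd Q (U n) (V n)) \<longlonglongrightarrow> z)"

text \<open>The operator associated with a form by the first representation theorem.\<close>

definition op_of_form :: "'a measure \<Rightarrow> 'a l2_form \<Rightarrow> 'a l2_op" where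
  "op_of_form M Q =
     {(u, w). u \<in> fst Q \<and> w \<in> L2 M \<and> (\<forall>v\<in>fst Q. snd Q v u = L2_inner M v w)}"

definition friedrichs_extension :: "'a measure \<Rightarrow> 'a l2_op \<Rightarrow> 'a l2_op" where
  "friedrichs_extension M S = op_of_form M (form_closure M (form_of_op M S))"


section \<open>The four-coefficient Sturm--Liouville expression\<close>

text \<open>Throughout, \<open>J\<close> is the open interval \<open>(a, b)\<close>. Functions are total on \<open>real\<close>, but only their
  values on \<open>J\<close> matter.\<close>

definition is_quasi_deriv ::
  "real set \<Rightarrow> (real \<Rightarrow> real) \<Rightarrow> (real \<Rightarrow> real) \<Rightarrow> (real \<Rightarrow> complex) \<Rightarrow> (real \<Rightarrow> complex) \<Rightarrow> bool" where
  "is_quasi_deriv J p s g h \<longleftrightarrow> h \<in> AC_loc J \<and>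
     (AE x in lebesgue_on J.
        h x = of_real (p x) * (vector_derivative g (at x) + of_real (s x) * g x))"

definition SL_domain ::
  "real set \<Rightarrow> (real \<Rightarrow> real) \<Rightarrow> (real \<Rightarrow> real) \<Rightarrow> (real \<Rightarrow> complex) set" where
  "SL_domain J p s = {g \<in> AC_loc J. \<exists>h. is_quasi_deriv J p s g h}"

text \<open>Unique on \<open>J\<close> for \<open>g\<close> in \<open>SL_domain J p s\<close>, by continuity.\<close>

definition quasi_deriv ::
  "real set \<Rightarrow> (real \<Rightarrow> real) \<Rightarrow> (real \<Rightarrow> real) \<Rightarrow> (real \<Rightarrow> complex) \<Rightarrow> real \<Rightarrow> complex" where
  "quasi_deriv J p s g = (SOME h. is_quasi_deriv J p s g h)"

definition SL_expr ::
  "real set \<Rightarrow> (real \<Rightarrow> real) \<Rightarrow> (real \<Rightarrow> real) \<Rightarrow> (real \<Rightarrow> real) \<Rightarrow> (real \<Rightarrow> real) \<Rightarrow>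
   (real \<Rightarrow> complex) \<Rightarrow> real \<Rightarrow> complex" where
  "SL_expr J p q r s f x = (1 / of_real (r x)) *
     (- vector_derivative (quasi_deriv J p s f) (at x)
      + of_real (s x) * quasi_deriv J p s f x + of_real (q x) * f x)"

definition SL_solution ::
  "real set \<Rightarrow> (real \<Rightarrow> real) \<Rightarrow> (real \<Rightarrow> real) \<Rightarrow> (real \<Rightarrow> real) \<Rightarrow> (real \<Rightarrow> real) \<Rightarrow>
   complex \<Rightarrow> (real \<Rightarrow> complex) \<Rightarrow> bool" where
  "SL_solution J p q r s l u \<longleftrightarrow> u \<in> SL_domain J p s \<and>
     (AE x in lebesgue_on J. SL_expr J p q r s u x = l * u x)"

definition disconjugate ::
  "real set \<Rightarrow> (real \<Rightarrow> real) \<Rightarrow> (real \<Rightarrow> real) \<Rightarrow> (real \<Rightarrow> real) \<Rightarrow> (real \<Rightarrow> real) \<Rightarrow> real \<Rightarrow> bool" where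
  "disconjugate J p q r s l \<longleftrightarrow>
     (\<forall>u. SL_solution J p q r s (of_real l) u \<longrightarrow> (\<forall>x\<in>J. u x \<in> \<real>) \<longrightarrow> (\<exists>x\<in>J. u x \<noteq> 0) \<longrightarrow>
        (\<forall>x\<in>J. \<forall>y\<in>J. u x = 0 \<longrightarrow> u y = 0 \<longrightarrow> x = y))"

text \<open>The measure \<open>r dx\<close> on \<open>J\<close>.\<close>

definition SL_measure :: "real set \<Rightarrow> (real \<Rightarrow> real) \<Rightarrow> real measure" where
  "SL_measure J r = density (lebesgue_on J) (\<lambda>x. ennreal (r x))"

definition SL_max ::
  "real set \<Rightarrow> (real \<Rightarrow> real) \<Rightarrow> (real \<Rightarrow> real) \<Rightarrow> (real \<Rightarrow> real) \<Rightarrow> (real \<Rightarrow> real) \<Rightarrow> real l2_op" where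
  "SL_max J p q r s = {(g, SL_expr J p q r s g) | g.
     g \<in> L2 (SL_measure J r) \<and> g \<in> SL_domain J p s \<and> SL_expr J p q r s g \<in> L2 (SL_measure J r)}"

definition SL_min ::
  "real set \<Rightarrow> (real \<Rightarrow> real) \<Rightarrow> (real \<Rightarrow> real) \<Rightarrow> (real \<Rightarrow> real) \<Rightarrow> (real \<Rightarrow> real) \<Rightarrow> real l2_op" where
  "SL_min J p q r s = op_closure (SL_measure J r)
     {(f, g) \<in> SL_max J p q r s. \<exists>K. compact K \<and> K \<subseteq> J \<and> (\<forall>x\<in>J - K. f x = 0)}"

end

theory Submission
  imports Defs
begin

text \<open>Form a fundamental system \<open>y\<^sub>1, y\<^sub>2\<close> of \<open>(\<tau> - \<lambda>\<^sub>0) u = 0\<close> with Wronskian \<open>1\<close> and let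
  \<open>k(x, t) = y\<^sub>1(t) y\<^sub>2(x) - y\<^sub>2(t) y\<^sub>1(x)\<close>. Disconjugacy means that \<open>k(x, t) > 0\<close> for \<open>t < x\<close>. In that
  case the solutions \<open>k(d, \<cdot>)\<close>, suitably normalized, are positive on \<open>(a, d)\<close>, and by compactness of the
  circle they have a limit as \<open>d\<close> tends to \<open>b\<close>, a positive solution. A positive solution \<open>u\<close> yields
  the factorization \<open>(f, (T - \<lambda>\<^sub>0) f) = \<integral> |f\<^sup>[\<^sup>1\<^sup>] - (u\<^sup>[\<^sup>1\<^sup>] / u) f|\<^sup>2 / p\<close>, hence the lower bound. Conversely,
  testing the lower bound with \<open>f\<close> for which \<open>(\<tau> - \<lambda>\<^sub>0) f\<close> is concentrated near three points
  \<open>t\<^sub>1 < t\<^sub>2 < t\<^sub>3\<close> gives \<open>k(t\<^sub>2, t\<^sub>1) k(t\<^sub>3, t\<^sub>2) k(t\<^sub>3, t\<^sub>1) \<ge> 0\<close> in the limit, which a sign change of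
  \<open>k(\<cdot>, t)\<close> would violate.

  That an absolutely continuous function is the integral of its derivative rests on the
  Radon-Nikodym theorem, applied to the Stieltjes measure of its variation function, and on Lebesgue's
  differentiation theorem.\<close>

section \<open>Absolutely continuous functions\<close>

text \<open>The expression \<tau> f and its quasi-derivative are fixed only up to null sets or by a
  choice, while zeros and signs of solutions are pointwise matters. \<open>quasi_system\<close>
  therefore replaces \<tau> by a first-order system with an explicit quasi-derivative; continuity
  recovers pointwise equality. Lower bounds are tested on \<open>pre_min\<close>, the compactly
  supported part, since closing the graph preserves them.

  The number three comes from the support: a solution of (\<tau> - l) f = \<psi> that vanishes left
  of the support of \<psi> also vanishes right of it if \<psi> has zero moments against both basis
  solutions. Two linear conditions on three coefficients are solved by the cross product of the
  moment vectors. A zero of k(., t) is always a sign change, because k(., t) is a nonzero multiple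
  of the kernel that vanishes there with quasi-derivative 1; so for suitable points a first zero
  beyond t makes exactly one of the three kernel values negative.

  For the Friedrichs extension the bound passes to the closed form by continuity, and back by
  restriction because the operator is contained in its extension.\<close>

definition nonoverlapping :: "real set \<Rightarrow> (real \<times> real) set \<Rightarrow> bool" where
  "nonoverlapping A D \<longleftrightarrow> finite D \<and> (\<forall>(x, y)\<in>D. x \<le> y \<and> {x..y} \<subseteq> A) \<and>
     disjoint_family_on (\<lambda>(x, y). {x<..<y}) D"

lemma abs_cont_on_iff:
  "abs_cont_on A f \<longleftrightarrow>
    (\<forall>\<epsilon>>0. \<exists>\<delta>>0. \<forall>D. nonoverlapping A D \<longrightarrow> (\<Sum>(x, y)\<in>D. y - x) < \<delta> \<longrightarrow>
       (\<Sum>(x, y)\<in>D. norm (f y - f x)) < \<epsilon>)"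
  unfolding abs_cont_on_def nonoverlapping_def by (simp only: imp_conjL)

lemma abs_cont_onE:
  assumes "abs_cont_on A f" "e > 0"
  obtains \<delta> where "\<delta> > 0" "\<forall>D. nonoverlapping A D \<longrightarrow> (\<Sum>(x, y)\<in>D. y - x) < \<delta> \<longrightarrow>
       (\<Sum>(x, y)\<in>D. norm (f y - f x)) < e"
  using assms unfolding abs_cont_on_iff by auto

lemma nonoverlappingD:
  assumes "nonoverlapping {x..y} D" "(u, v) \<in> D"
  shows "u \<le> v \<and> x \<le> u \<and> v \<le> y"
  using assms unfolding nonoverlapping_def by (auto simp: atLeastatMost_subset_iff)

text \<open>The open intervals are disjoint and lie in \<open>{x..y}\<close>, so their lengths add
  up to the measure of a subset.\<close>

lemma nonoverlapping_length_le:
  assumes D: "nonoverlapping {x..y} D" and "x \<le> y"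
  shows "(\<Sum>(u, v)\<in>D. v - u) \<le> y - x"
proof -
  have fin: "finite D" and dis: "disjoint_family_on (\<lambda>p. {fst p<..<snd p}) D"
    using D unfolding nonoverlapping_def case_prod_beta by blast+
  have bd: "fst p \<le> snd p \<and> x \<le> fst p \<and> snd p \<le> y" if "p \<in> D" for p
    using nonoverlappingD[OF D] that by (cases p) auto
  have "(\<Sum>(u, v)\<in>D. v - u) = (\<Sum>p\<in>D. measure lebesgue {fst p<..<snd p})"
    using bd by (intro sum.cong) (auto simp: case_prod_beta)
  also have "\<dots> = measure lebesgue (\<Union>p\<in>D. {fst p<..<snd p})"
    using dis emeasure_lborel_Ioo bd by (subst measure_finite_Union[OF fin]) auto
  also have "\<dots> \<le> measure lebesgue {x..y}"
  proof (rule measure_mono_fmeasurable)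
    show "(\<Union>p\<in>D. {fst p<..<snd p}) \<subseteq> {x..y}"
      using bd by (intro UN_least subsetI) (meson atLeastAtMost_iff greaterThanLessThan_iff less_imp_le order_trans)
    show "(\<Union>p\<in>D. {fst p<..<snd p}) \<in> sets lebesgue" by (intro sets.finite_UN fin) auto
  qed simp
  also have "\<dots> = y - x" using \<open>x \<le> y\<close> by simp
  finally show ?thesis .
qed

text \<open>A family is a set of pairs, so \<open>\<phi>\<close> may merge two indices. Disjoint
  interiors force such a repeated pair to be degenerate, and \<open>g t t = 0\<close> makes its term
  harmless.\<close>

lemma nonoverlapping_image_sum:
  fixes \<phi> :: "'a \<Rightarrow> real \<times> real" and g :: "real \<Rightarrow> real \<Rightarrow> real"
  assumes "finite D" "\<And>t. g t t = 0"
    and le: "\<And>d. d \<in> D \<Longrightarrow> fst (\<phi> d) \<le> snd (\<phi> d) \<and> {fst (\<phi> d)..snd (\<phi> d)} \<subseteq> A"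
    and disj: "disjoint_family_on (\<lambda>d. {fst (\<phi> d)<..<snd (\<phi> d)}) D"
  shows "nonoverlapping A (\<phi> ` D)" "(\<Sum>(x, y)\<in>\<phi> ` D. g x y) = (\<Sum>d\<in>D. g (fst (\<phi> d)) (snd (\<phi> d)))"
proof -
  show "nonoverlapping A (\<phi> ` D)"
    unfolding nonoverlapping_def
  proof (intro conjI)
    show "disjoint_family_on (\<lambda>(x, y). {x<..<y}) (\<phi> ` D)"
      unfolding disjoint_family_on_def
    proof (intro ballI impI)
      fix p q assume "p \<in> \<phi> ` D" "q \<in> \<phi> ` D" "p \<noteq> q"
      then obtain d e where de: "p = \<phi> d" "d \<in> D" "q = \<phi> e" "e \<in> D" by (elim imageE)
      with \<open>p \<noteq> q\<close> have "d \<noteq> e" by metis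
      from disjoint_family_onD[OF disj de(2,4) this]
      show "(case p of (x, y) \<Rightarrow> {x<..<y}) \<inter> (case q of (x, y) \<Rightarrow> {x<..<y}) = {}"
        unfolding de case_prod_beta .
    qed
    show "\<forall>(x, y)\<in>\<phi> ` D. x \<le> y \<and> {x..y} \<subseteq> A"
    proof
      fix p assume "p \<in> \<phi> ` D"
      then show "case p of (x, y) \<Rightarrow> x \<le> y \<and> {x..y} \<subseteq> A"
        unfolding case_prod_beta using le by (elim imageE) simp
    qed
  qed (use \<open>finite D\<close> in simp)
  have "(\<Sum>p\<in>\<phi> ` D. g (fst p) (snd p)) = (\<Sum>d\<in>D. g (fst (\<phi> d)) (snd (\<phi> d)))"
  proof (subst sum.reindex_nontrivial)
    fix d e assume de: "d \<in> D" "e \<in> D" "d \<noteq> e" "\<phi> d = \<phi> e"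
    then have "{fst (\<phi> d)<..<snd (\<phi> d)} = {}"
      using disjoint_family_onD[OF disj de(1-3)] by simp
    then have "fst (\<phi> d) = snd (\<phi> d)" using le[OF de(1)] by force
    then show "g (fst (\<phi> d)) (snd (\<phi> d)) = 0" using assms(2) by simp
  qed (use \<open>finite D\<close> in simp_all)
  then show "(\<Sum>(x, y)\<in>\<phi> ` D. g x y) = (\<Sum>d\<in>D. g (fst (\<phi> d)) (snd (\<phi> d)))"
    by (simp add: case_prod_beta)
qed

text \<open>Projecting the endpoints onto \<open>{\<alpha>..\<beta>}\<close> cuts a family off at
  both ends. Intervals outside collapse to points, several of them perhaps to the same one, and
  there \<open>g\<close> vanishes.\<close>

lemma nonoverlapping_clip:
  fixes g :: "real \<Rightarrow> real \<Rightarrow> real"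
  assumes D: "nonoverlapping A D" and "\<alpha> \<le> \<beta>" and g: "\<And>t. g t t = 0"
  defines "c \<equiv> \<lambda>x. max \<alpha> (min \<beta> x)"
  shows "nonoverlapping {\<alpha>..\<beta>} (map_prod c c ` D)"
    "(\<Sum>(x, y)\<in>map_prod c c ` D. g x y) = (\<Sum>(x, y)\<in>D. g (c x) (c y))"
proof -
  have fin: "finite D" using D by (simp add: nonoverlapping_def)
  have le: "fst (map_prod c c d) \<le> snd (map_prod c c d) \<and>
      {fst (map_prod c c d)..snd (map_prod c c d)} \<subseteq> {\<alpha>..\<beta>}" if "d \<in> D" for d
    using that D \<open>\<alpha> \<le> \<beta>\<close> unfolding nonoverlapping_def c_def by (cases d) auto
  have sub: "{fst (map_prod c c d)<..<snd (map_prod c c d)} \<subseteq> {fst d<..<snd d}" if "d \<in> D" for d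
    unfolding c_def by auto
  have disj: "disjoint_family_on (\<lambda>d. {fst (map_prod c c d)<..<snd (map_prod c c d)}) D"
    using D sub unfolding nonoverlapping_def disjoint_family_on_def case_prod_beta by blast
  show "nonoverlapping {\<alpha>..\<beta>} (map_prod c c ` D)"
    by (rule nonoverlapping_image_sum[OF fin _ le disj]) (rule g)
  show "(\<Sum>(x, y)\<in>map_prod c c ` D. g x y) = (\<Sum>(x, y)\<in>D. g (c x) (c y))"
    by (subst nonoverlapping_image_sum(2)[OF fin _ le disj]) (auto simp: g case_prod_beta)
qed

lemma nonoverlapping_mono: "nonoverlapping A D \<Longrightarrow> A \<subseteq> B \<Longrightarrow> nonoverlapping B D"
  unfolding nonoverlapping_def case_prod_beta by (meson order.trans)

lemma abs_cont_on_subset: "abs_cont_on A f \<Longrightarrow> B \<subseteq> A \<Longrightarrow> abs_cont_on B f"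
  unfolding abs_cont_on_iff using nonoverlapping_mono[of B _ A] by (elim all_forward imp_forward ex_forward conj_forward) auto

text \<open>Two dominating functions are allowed so that sums and products come under the same
  criterion as unary operations.\<close>

lemma abs_cont_on_domination:
  fixes f g h :: "real \<Rightarrow> complex"
  assumes f: "abs_cont_on A f" and g: "abs_cont_on A g" and "C \<ge> 0"
    and h: "\<And>x y. x \<in> A \<Longrightarrow> y \<in> A \<Longrightarrow> norm (h y - h x) \<le> C * (norm (f y - f x) + norm (g y - g x))"
  shows "abs_cont_on A h"
  unfolding abs_cont_on_iff
proof (intro allI impI)
  fix \<epsilon> :: real assume "\<epsilon> > 0"
  \<comment> \<open>The summand 1 keeps the quotient meaningful for \<open>C = 0\<close> and makes
    \<open>C * (e + e)\<close> strictly smaller than \<open>\<epsilon>\<close>.\<close>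
  define e where "e = \<epsilon> / (2 * (C + 1))"
  have e0: "e > 0" using \<open>\<epsilon> > 0\<close> \<open>C \<ge> 0\<close> by (simp add: e_def)
  have "\<epsilon> = 2 * (C + 1) * e" using \<open>C \<ge> 0\<close> by (simp add: e_def)
  then have "C * (e + e) < \<epsilon>" using e0 by (simp add: algebra_simps)
  note e = e0 this
  obtain d1 where "d1 > 0" "\<forall>D. nonoverlapping A D \<longrightarrow> (\<Sum>(x, y)\<in>D. y - x) < d1 \<longrightarrow>
       (\<Sum>(x, y)\<in>D. norm (f y - f x)) < e"
    using abs_cont_onE[OF f e(1)] .
  note d1 = this(1) this(2)[rule_format]
  obtain d2 where "d2 > 0" "\<forall>D. nonoverlapping A D \<longrightarrow> (\<Sum>(x, y)\<in>D. y - x) < d2 \<longrightarrow>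
       (\<Sum>(x, y)\<in>D. norm (g y - g x)) < e"
    using abs_cont_onE[OF g e(1)] .
  note d2 = this(1) this(2)[rule_format]
  show "\<exists>\<delta>>0. \<forall>D. nonoverlapping A D \<longrightarrow> (\<Sum>(x, y)\<in>D. y - x) < \<delta> \<longrightarrow>
       (\<Sum>(x, y)\<in>D. norm (h y - h x)) < \<epsilon>"
  proof (intro exI[of _ "min d1 d2"] conjI allI impI)
    fix D assume D: "nonoverlapping A D" "(\<Sum>(x, y)\<in>D. y - x) < min d1 d2"
    have "(\<Sum>(x, y)\<in>D. norm (h y - h x)) \<le> (\<Sum>(x, y)\<in>D. C * (norm (f y - f x) + norm (g y - g x)))"
      using D(1) unfolding nonoverlapping_def by (intro sum_mono) (force intro!: h)
    also have "\<dots> = C * ((\<Sum>(x, y)\<in>D. norm (f y - f x)) + (\<Sum>(x, y)\<in>D. norm (g y - g x)))"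
      by (simp add: case_prod_beta sum_distrib_left[symmetric] sum.distrib)
    also have "\<dots> \<le> C * (e + e)"
      using d1(2)[OF D(1)] d2(2)[OF D(1)] D(2) \<open>C \<ge> 0\<close> by (intro mult_left_mono) auto
    also have "\<dots> < \<epsilon>" by (rule e)
    finally show "(\<Sum>(x, y)\<in>D. norm (h y - h x)) < \<epsilon>" .
  qed (use d1(1) d2(1) in auto)
qed

lemma abs_cont_on_imp_continuous_on:
  assumes "abs_cont_on {c..d} f"
  shows "continuous_on {c..d} f"
  unfolding continuous_on_iff
proof (intro ballI allI impI)
  fix x e assume x: "x \<in> {c..d}" and e: "(0::real) < e"
  obtain \<delta> where "\<delta> > 0" "\<forall>D. nonoverlapping {c..d} D \<longrightarrow> (\<Sum>(x, y)\<in>D. y - x) < \<delta> \<longrightarrow>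
       (\<Sum>(x, y)\<in>D. norm (f y - f x)) < e"
    using abs_cont_onE[OF assms e] .
  note \<delta> = this(1) this(2)[rule_format]
  have "dist (f y) (f x) < e" if y: "y \<in> {c..d}" "dist y x < \<delta>" for y
  proof -
    have "nonoverlapping {c..d} {(min x y, max x y)}"
      using x y by (auto simp: nonoverlapping_def disjoint_family_on_def)
    from \<delta>(2)[OF this] y have "norm (f (max x y) - f (min x y)) < e"
      by (auto simp: dist_real_def)
    then show ?thesis by (auto simp: dist_norm max_def min_def norm_minus_commute split: if_splits)
  qed
  then show "\<exists>da>0. \<forall>x'\<in>{c..d}. dist x' x < da \<longrightarrow> dist (f x') (f x) < e"
    using \<delta>(1) by blast
qed

subsection \<open>The variation function\<close>

text \<open>Gaps between the intervals are permitted. The supremum is still the usual total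
  variation, and the pieces of a family left after a cut need not be completed to a
  partition.\<close>

definition var_sums :: "(real \<Rightarrow> complex) \<Rightarrow> real \<Rightarrow> real \<Rightarrow> real set" where
  "var_sums f x y = {(\<Sum>(u, v)\<in>D. norm (f v - f u)) | D. nonoverlapping {x..y} D}"

definition total_var :: "(real \<Rightarrow> complex) \<Rightarrow> real \<Rightarrow> real \<Rightarrow> real" where
  "total_var f x y = Sup (var_sums f x y)"

lemma var_sumsI: "nonoverlapping {x..y} D \<Longrightarrow> (\<Sum>(u, v)\<in>D. norm (f v - f u)) \<in> var_sums f x y"
  unfolding var_sums_def mem_Collect_eq by (rule exI[of _ D]) simp

lemma var_sumsE:
  assumes "s \<in> var_sums f x y"
  obtains D where "nonoverlapping {x..y} D" "s = (\<Sum>(u, v)\<in>D. norm (f v - f u))"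
  using assms unfolding var_sums_def mem_Collect_eq by (elim exE conjE)

text \<open>Each interval of the family is cut at \<open>y\<close>; the triangle inequality compares
  the sums before and after.\<close>

lemma var_sums_split:
  assumes "s \<in> var_sums f x z" "x \<le> y" "y \<le> z"
  shows "\<exists>s1\<in>var_sums f x y. \<exists>s2\<in>var_sums f y z. s \<le> s1 + s2"
proof -
  obtain D where D: "nonoverlapping {x..z} D" and s: "s = (\<Sum>(u, v)\<in>D. norm (f v - f u))"
    using var_sumsE[OF assms(1)] .
  let ?g = "\<lambda>u v. norm (f v - f u)"
  let ?c1 = "\<lambda>t. max x (min y t)" and ?c2 = "\<lambda>t. max y (min z t)"
  have "s \<le> (\<Sum>(u, v)\<in>D. ?g (?c1 u) (?c1 v)) + (\<Sum>(u, v)\<in>D. ?g (?c2 u) (?c2 v))"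
    unfolding s sum.distrib[symmetric] case_prod_beta
  proof (intro sum_mono)
    fix d assume "d \<in> D"
    then obtain u v where d: "d = (u, v)" "u \<le> v" "x \<le> u" "v \<le> z"
      using D unfolding nonoverlapping_def by (cases d) (auto simp: atLeastatMost_subset_iff)
    \<comment> \<open>If the interval lies on one side of \<open>y\<close>, its clip to the other
      side is a single point and contributes 0.\<close>
    have eq: "f v - f u = (f (?c1 v) - f (?c1 u)) + (f (?c2 v) - f (?c2 u))"
      using d assms(2,3) by (auto simp: max_def min_def)
    show "norm (f (snd d) - f (fst d)) \<le>
      norm (f (?c1 (snd d)) - f (?c1 (fst d))) + norm (f (?c2 (snd d)) - f (?c2 (fst d)))"
      unfolding d(1) prod.sel eq by (simp only: norm_triangle_ineq)
  qed
  moreover have "(\<Sum>(u, v)\<in>D. ?g (?c1 u) (?c1 v)) \<in> var_sums f x y"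
    using var_sumsI[OF nonoverlapping_clip(1)[OF D assms(2), of ?g], of f]
      nonoverlapping_clip(2)[OF D assms(2), of ?g] by simp
  moreover have "(\<Sum>(u, v)\<in>D. ?g (?c2 u) (?c2 v)) \<in> var_sums f y z"
    using var_sumsI[OF nonoverlapping_clip(1)[OF D assms(3), of ?g], of f]
      nonoverlapping_clip(2)[OF D assms(3), of ?g] by simp
  ultimately show ?thesis by blast
qed

lemma var_sums_insert:
  assumes "s \<in> var_sums f x y" "x \<le> y" "y \<le> z"
  shows "s + norm (f z - f y) \<in> var_sums f x z"
proof (cases "y = z")
  case True with assms show ?thesis by simp
next
  case False
  then have "y < z" using assms by simp
  obtain D where D: "nonoverlapping {x..y} D" and s: "s = (\<Sum>(u, v)\<in>D. norm (f v - f u))"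
    using var_sumsE[OF assms(1)] .
  have bd: "u \<le> v \<and> x \<le> u \<and> v \<le> y" if "(u, v) \<in> D" for u v
    using D that unfolding nonoverlapping_def by (auto simp: atLeastatMost_subset_iff)
  \<comment> \<open>A degenerate pair might already belong to the family; a proper interval to the
    right of \<open>y\<close> cannot.\<close>
  have notin: "(y, z) \<notin> D" using bd \<open>y < z\<close> by force
  have "nonoverlapping {x..z} (insert (y, z) D)"
    unfolding nonoverlapping_def
  proof (intro conjI)
    show "disjoint_family_on (\<lambda>(x, y). {x<..<y}) (insert (y, z) D)"
    proof (subst disjoint_family_on_insert[OF notin], intro conjI)
      show "(case (y, z) of (x, y) \<Rightarrow> {x<..<y}) \<inter> (\<Union>i\<in>D. case i of (x, y) \<Rightarrow> {x<..<y}) = {}"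
      proof -
        have "{y<..<z} \<inter> {fst p<..<snd p} = {}" if "p \<in> D" for p
          using bd[of "fst p" "snd p"] that by auto
        then show ?thesis unfolding case_prod_beta prod.sel by blast
      qed
    qed (use D in \<open>simp add: nonoverlapping_def\<close>)
    show "\<forall>(u, v)\<in>insert (y, z) D. u \<le> v \<and> {u..v} \<subseteq> {x..z}"
    proof
      fix p assume "p \<in> insert (y, z) D"
      then show "case p of (u, v) \<Rightarrow> u \<le> v \<and> {u..v} \<subseteq> {x..z}"
        using assms(2,3) bd[of "fst p" "snd p"] by (cases p) auto
    qed
  qed (use D in \<open>simp add: nonoverlapping_def\<close>)
  moreover have "(\<Sum>(u, v)\<in>insert (y, z) D. norm (f v - f u)) = s + norm (f z - f y)"
    using D notin unfolding s nonoverlapping_def by simp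
  ultimately show ?thesis using var_sumsI[of x z "insert (y, z) D" f] by simp
qed

text \<open>Let \<delta> answer to the tolerance 1. Pieces shorter than \<delta> have variation sums
  at most 1, and \<open>{c..d}\<close> is exhausted by finitely many steps of length
  \<delta>/2.\<close>

lemma var_sums_bdd:
  assumes f: "abs_cont_on {c..d} f" and "c \<le> d"
  shows "bdd_above (var_sums f c d)"
proof -
  obtain \<delta> where "\<delta> > 0" "\<forall>D. nonoverlapping {c..d} D \<longrightarrow> (\<Sum>(x, y)\<in>D. y - x) < \<delta> \<longrightarrow>
       (\<Sum>(x, y)\<in>D. norm (f y - f x)) < 1"
    using abs_cont_onE[OF f zero_less_one] .
  note \<delta> = this(1) this(2)[rule_format]
  have small: "s \<le> 1" if xy: "s \<in> var_sums f x y" "c \<le> x" "y \<le> d" "x \<le> y" "y - x < \<delta>" for s x y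
  proof -
    obtain D where D: "nonoverlapping {x..y} D" and s: "s = (\<Sum>(u, v)\<in>D. norm (f v - f u))"
      using var_sumsE[OF xy(1)] .
    have "(\<Sum>(u, v)\<in>D. v - u) < \<delta>"
      using nonoverlapping_length_le[OF D xy(4)] xy(5) by simp
    moreover have "nonoverlapping {c..d} D"
      using xy by (intro nonoverlapping_mono[OF D]) auto
    ultimately show ?thesis using \<delta>(2) unfolding s by (simp add: less_imp_le)
  qed
  have "s \<le> real n" if "s \<in> var_sums f c y" "c \<le> y" "y \<le> d" "y - c < real n * (\<delta>/2)" for n s y
    using that
  proof (induction n arbitrary: s y)
    case 0 then show ?case by simp
  next
    case (Suc n)
    \<comment> \<open>A step back by \<delta>/2 instead of \<delta> gives the strict bound
      \<open>y - m < \<delta>\<close> required by \<open>small\<close>.\<close>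
    define m where "m = max c (y - \<delta>/2)"
    have m: "c \<le> m" "m \<le> y" "y - m < \<delta>" using Suc.prems \<delta>(1) by (auto simp: m_def max_def)
    obtain s1 s2 where s: "s1 \<in> var_sums f c m" "s2 \<in> var_sums f m y" "s \<le> s1 + s2"
      using var_sums_split[OF Suc.prems(1) m(1,2)] by blast
    have "s2 \<le> 1" using small[OF s(2)] m Suc.prems by auto
    moreover have "s1 \<le> real n"
    \<comment> \<open>If the step reaches \<open>c\<close>, the strict premise of the induction
      hypothesis fails for \<open>n = 0\<close>; then only degenerate intervals remain on the
      left.\<close>
    proof (cases "m = c")
      case True
      then have "s1 = 0"
      proof -
        obtain D where D: "nonoverlapping {c..c} D" and s: "s1 = (\<Sum>(u, v)\<in>D. norm (f v - f u))"
          using var_sumsE[OF s(1)[unfolded True]] .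
        have "u = c \<and> v = c" if "(u, v) \<in> D" for u v
          using D that unfolding nonoverlapping_def by (fastforce simp: atLeastatMost_subset_iff)
        then show ?thesis unfolding s by (intro sum.neutral ballI) (metis case_prod_conv diff_self norm_zero surj_pair)
      qed
      then show ?thesis by simp
    next
      case False
      then have "m - c < real n * (\<delta>/2)" using Suc.prems by (auto simp: m_def max_def algebra_simps split: if_splits)
      then show ?thesis using Suc.IH[OF s(1)] m Suc.prems by auto
    qed
    ultimately show ?case using s(3) by simp
  qed
  note bound = this
  obtain n where n: "d - c < real n * (\<delta>/2)"
    using \<delta>(1) reals_Archimedean3[of "\<delta>/2"] by (metis half_gt_zero)
  show ?thesis
    by (rule bdd_aboveI[of _ "real n"]) (rule bound[OF _ \<open>c \<le> d\<close> order_refl n])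
qed

lemma var_sums_nonempty: "0 \<in> var_sums f x y"
  unfolding var_sums_def mem_Collect_eq
  by (rule exI[of _ "{}"]) (simp add: nonoverlapping_def disjoint_family_on_def)

text \<open>Adding the interval from \<open>x\<close> to \<open>y\<close> to any family in
  \<open>{c..x}\<close> raises its sum by the increment of \<open>f\<close>. Consequently V, V + Re
  f and V + Im f are increasing.\<close>

lemma total_var_ge:
  assumes f: "abs_cont_on {c..d} f" and "c \<le> x" "x \<le> y" "y \<le> d"
  shows "norm (f y - f x) \<le> total_var f c y - total_var f c x"
proof -
  have bdd: "bdd_above (var_sums f c y)" 
    using assms by (intro var_sums_bdd abs_cont_on_subset[OF f]) auto
  have "s + norm (f y - f x) \<le> total_var f c y" if "s \<in> var_sums f c x" for s
    unfolding total_var_def by (rule cSup_upper[OF var_sums_insert[OF that assms(2,3)] bdd])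
  then have "total_var f c x \<le> total_var f c y - norm (f y - f x)"
    unfolding total_var_def[of f c x] using var_sums_nonempty[of f c x]
    by (intro cSup_least) (auto simp: algebra_simps)
  then show ?thesis by simp
qed

text \<open>A nearly optimal family on \<open>{c..y}\<close> is cut at \<open>x\<close>. Its left
  part contributes at most the variation up to \<open>x\<close>, so the right part carries the rest
  up to \<open>e\<close>.\<close>

lemma total_var_approx:
  assumes f: "abs_cont_on {c..d} f" and "c \<le> x" "x \<le> y" "y \<le> d" and "e > 0"
  shows "\<exists>D. nonoverlapping {x..y} D \<and>
    total_var f c y - total_var f c x \<le> (\<Sum>(u, v)\<in>D. norm (f v - f u)) + e"
proof -
  have bdd: "bdd_above (var_sums f c x)" 
    using assms by (intro var_sums_bdd abs_cont_on_subset[OF f]) auto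
  have "\<exists>s\<in>var_sums f c y. total_var f c y - e < s"
    unfolding total_var_def using var_sums_nonempty[of f c y] \<open>e > 0\<close>
    by (intro less_cSupD) auto
  then obtain s where s: "s \<in> var_sums f c y" "total_var f c y - e < s" by blast
  obtain s1 s2 where s12: "s1 \<in> var_sums f c x" "s2 \<in> var_sums f x y" "s \<le> s1 + s2"
    using var_sums_split[OF s(1) assms(2,3)] by (elim bexE)
  have "s1 \<le> total_var f c x" unfolding total_var_def by (rule cSup_upper[OF s12(1) bdd])
  then have "total_var f c y - total_var f c x \<le> s2 + e" using s s12 by simp
  moreover obtain D where "nonoverlapping {x..y} D" "s2 = (\<Sum>(u, v)\<in>D. norm (f v - f u))"
    using var_sumsE[OF s12(2)] .
  ultimately show ?thesis by (intro exI[of _ D]) simp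
qed

text \<open>Inside each interval of a short family choose a nearly optimal family. Together these
  are non-overlapping and no longer than the given family, so the \<delta> that belongs to
  \<open>f\<close> for \<epsilon>/2 serves the variation function for \<epsilon>.\<close>

lemma abs_cont_on_total_var:
  assumes f: "abs_cont_on {c..d} f"
  shows "abs_cont_on {c..d} (\<lambda>x. complex_of_real (total_var f c x))"
  unfolding abs_cont_on_iff
proof (intro allI impI)
  fix \<epsilon> :: real assume "\<epsilon> > 0"
  let ?V = "total_var f c"
  obtain \<delta> where "\<delta> > 0" "\<forall>D. nonoverlapping {c..d} D \<longrightarrow> (\<Sum>(x, y)\<in>D. y - x) < \<delta> \<longrightarrow>
       (\<Sum>(x, y)\<in>D. norm (f y - f x)) < \<epsilon>/2"
    using abs_cont_onE[OF f half_gt_zero[OF \<open>\<epsilon> > 0\<close>]] .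
  note \<delta> = this(1) this(2)[rule_format]
  show "\<exists>\<delta>>0. \<forall>D. nonoverlapping {c..d} D \<longrightarrow> (\<Sum>(x, y)\<in>D. y - x) < \<delta> \<longrightarrow>
       (\<Sum>(x, y)\<in>D. norm (complex_of_real (?V y) - complex_of_real (?V x))) < \<epsilon>"
  proof (intro exI[of _ \<delta>] conjI allI impI)
    fix D assume D: "nonoverlapping {c..d} D" and len: "(\<Sum>(x, y)\<in>D. y - x) < \<delta>"
    have fin: "finite D" and dis: "disjoint_family_on (\<lambda>(x, y). {x<..<y}) D"
      using D by (auto simp: nonoverlapping_def)
    have bd: "fst p \<le> snd p \<and> c \<le> fst p \<and> snd p \<le> d" if "p \<in> D" for p
      using D that unfolding nonoverlapping_def by (auto simp: atLeastatMost_subset_iff)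
    \<comment> \<open>The errors of all intervals together stay below \<epsilon>/2; the summand 1
      covers the empty family.\<close>
    define e where "e = \<epsilon> / (2 * (real (card D) + 1))"
    have e: "e > 0" "real (card D) * e < \<epsilon> / 2" using \<open>\<epsilon> > 0\<close> by (auto simp: e_def field_simps)
    have "\<forall>p\<in>D. \<exists>E. nonoverlapping {fst p..snd p} E \<and>
        ?V (snd p) - ?V (fst p) \<le> (\<Sum>(u, v)\<in>E. norm (f v - f u)) + e"
      using total_var_approx[OF f _ _ _ e(1)] bd by auto
    then obtain E where E: "\<And>p. p \<in> D \<Longrightarrow> nonoverlapping {fst p..snd p} (E p)"
      "\<And>p. p \<in> D \<Longrightarrow> ?V (snd p) - ?V (fst p) \<le> (\<Sum>(u, v)\<in>E p. norm (f v - f u)) + e"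
      by metis
    \<comment> \<open>Indexing by pairs keeps the chosen families apart even where two of them share
      a degenerate interval.\<close>
    have finS: "finite (Sigma D E)" using fin E(1) by (auto simp: nonoverlapping_def)
    have Ebd: "fst p \<le> u \<and> u \<le> v \<and> v \<le> snd p" if "p \<in> D" "(u, v) \<in> E p" for p u v
      using E(1)[OF that(1)] that(2) unfolding nonoverlapping_def by (auto simp: atLeastatMost_subset_iff)
    have le: "fst (snd w) \<le> snd (snd w) \<and> {fst (snd w)..snd (snd w)} \<subseteq> {c..d}" if "w \<in> Sigma D E" for w
      using that Ebd[of "fst w" "fst (snd w)" "snd (snd w)"] bd[of "fst w"] by auto
    have dS: "disjoint_family_on (\<lambda>w. {fst (snd w)<..<snd (snd w)}) (Sigma D E)"
      unfolding disjoint_family_on_def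
    proof (intro ballI impI)
      fix w w' assume w: "w \<in> Sigma D E" "w' \<in> Sigma D E" "w \<noteq> w'"
      obtain p e p' e' where pe: "w = (p, e)" "w' = (p', e')" by (cases w, cases w')
      show "{fst (snd w)<..<snd (snd w)} \<inter> {fst (snd w')<..<snd (snd w')} = {}"
      proof (cases "p = p'")
        case True
        then show ?thesis using w pe E(1)[of p]
          unfolding nonoverlapping_def disjoint_family_on_def by (auto simp: case_prod_beta)
      next
        case False
        have "{fst p<..<snd p} \<inter> {fst p'<..<snd p'} = {}"
          using dis w pe False unfolding disjoint_family_on_def by (auto simp: case_prod_beta)
        moreover have "{fst e<..<snd e} \<subseteq> {fst p<..<snd p}" "{fst e'<..<snd e'} \<subseteq> {fst p'<..<snd p'}"
          using w pe Ebd[of p "fst e" "snd e"] Ebd[of p' "fst e'" "snd e'"] by auto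
        ultimately show ?thesis using Int_mono subset_empty unfolding pe snd_conv by metis
      qed
    qed
    note no = nonoverlapping_image_sum(1)[OF finS _ le dS, of "\<lambda>_ _. 0", simplified]
    note ims = nonoverlapping_image_sum(2)[OF finS _ le dS]
    have sE: "(\<Sum>(u, v)\<in>snd ` Sigma D E. g u v) = (\<Sum>p\<in>D. \<Sum>(u, v)\<in>E p. g u v)"
      if "\<And>t. g t t = 0" for g :: "real \<Rightarrow> real \<Rightarrow> real"
      using fin E(1) by (subst ims[OF that]) (auto simp: sum.Sigma nonoverlapping_def case_prod_beta)
    have "(\<Sum>(u, v)\<in>snd ` Sigma D E. v - u) \<le> (\<Sum>p\<in>D. snd p - fst p)"
    proof (subst sE)
      show "(\<Sum>p\<in>D. \<Sum>(u, v)\<in>E p. v - u) \<le> (\<Sum>p\<in>D. snd p - fst p)"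
      proof (intro sum_mono)
        fix p assume p: "p \<in> D"
        show "(\<Sum>(u, v)\<in>E p. v - u) \<le> snd p - fst p"
          using nonoverlapping_length_le[OF E(1)[OF p]] bd[OF p] by simp
      qed
    qed simp
    also have "\<dots> < \<delta>" using len by (simp add: case_prod_beta)
    finally have "(\<Sum>(u, v)\<in>snd ` Sigma D E. norm (f v - f u)) < \<epsilon> / 2"
      using \<delta>(2)[OF no] by simp
    then have *: "(\<Sum>p\<in>D. \<Sum>(u, v)\<in>E p. norm (f v - f u)) < \<epsilon> / 2"
      by (subst (asm) sE) auto
    have "(\<Sum>(x, y)\<in>D. norm (complex_of_real (?V y) - complex_of_real (?V x)))
        = (\<Sum>p\<in>D. ?V (snd p) - ?V (fst p))"
    proof (intro sum.cong refl)
      fix p assume p: "p \<in> D"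
      have "0 \<le> ?V (snd p) - ?V (fst p)"
        using total_var_ge[OF f, of "fst p" "snd p"] bd[OF p] by (smt (verit) norm_ge_zero)
      then show "(case p of (x, y) \<Rightarrow> norm (complex_of_real (?V y) - complex_of_real (?V x))) =
          ?V (snd p) - ?V (fst p)"
        by (simp add: case_prod_beta flip: of_real_diff)
    qed
    also have "\<dots> \<le> (\<Sum>p\<in>D. (\<Sum>(u, v)\<in>E p. norm (f v - f u)) + e)"
      using E(2) by (intro sum_mono)
    also have "\<dots> < \<epsilon>" using * e by (simp add: sum.distrib)
    finally show "(\<Sum>(x, y)\<in>D. norm (complex_of_real (?V y) - complex_of_real (?V x))) < \<epsilon>" .
  qed (rule \<delta>(1))
qed

subsection \<open>Densities and derivatives\<close>

text \<open>Compactness gives a finite cover by balls inside an open set of small measure, and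
  finite families are what absolute continuity speaks about.\<close>

lemma null_set_interval_measure:
  fixes H :: "real \<Rightarrow> real"
  assumes mono: "\<And>x y. x \<le> y \<Longrightarrow> H x \<le> H y" and cont: "continuous_on UNIV H"
    and ac: "\<And>\<epsilon>. \<epsilon> > 0 \<Longrightarrow> \<exists>\<delta>>0. \<forall>D. nonoverlapping UNIV D \<longrightarrow> (\<Sum>(x, y)\<in>D. y - x) < \<delta> \<longrightarrow>
       (\<Sum>(x, y)\<in>D. H y - H x) < \<epsilon>"
    and K: "compact K" "emeasure lborel K = 0"
  shows "emeasure (interval_measure H) K = 0"
proof -
  let ?N = "interval_measure H"
  have Icc: "emeasure ?N {x..y} = ennreal (H y - H x)" if "x \<le> y" for x y
    using that mono cont by (rule emeasure_interval_measure_Icc)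
  have "emeasure ?N K \<le> ennreal \<epsilon>" if pos: "\<epsilon> > 0" for \<epsilon>
  proof -
    obtain \<delta> where \<delta>: "\<delta> > 0" "\<forall>D. nonoverlapping UNIV D \<longrightarrow> (\<Sum>(x, y)\<in>D. y - x) < \<delta> \<longrightarrow>
       (\<Sum>(x, y)\<in>D. H y - H x) < \<epsilon>"
      using ac[OF pos] by (elim exE conjE)
    have Kl: "K \<in> sets lebesgue" "emeasure lebesgue K = 0" using K by (auto simp: borel_compact)
    obtain U where U: "open U" "K \<subseteq> U" "emeasure lebesgue (U - K) < ennreal \<delta>"
      by (rule sets_lebesgue_outer_open[OF Kl(1) \<delta>(1)])
    have Ul: "U \<in> sets lebesgue" using borel_open[OF U(1)] by simp
    have "emeasure lebesgue U \<le> emeasure lebesgue (U - K) + emeasure lebesgue K"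
      using emeasure_subadditive[of "U - K" lebesgue K] Ul Kl by (metis Un_Diff_cancel2 U(2) sets.Diff sup.absorb1)
    then have Um: "emeasure lebesgue U < ennreal \<delta>" using U(3) Kl(2) by simp
    then have Um': "U \<in> lmeasurable" using Ul fmeasurableI by (metis ennreal_less_top less_trans infinity_ennreal_def)
    have mU: "measure lebesgue U < \<delta>"
      using Um \<delta>(1) Um' by (simp add: emeasure_eq_measure2 ennreal_less_iff)
    have "\<forall>x\<in>K. \<exists>e. e > 0 \<and> cball x e \<subseteq> U"
      using U open_contains_cball by blast
    from bchoice[OF this] obtain e where e: "\<forall>x\<in>K. e x > 0 \<and> cball x (e x) \<subseteq> U" by (rule exE)
    obtain F where F: "F \<subseteq> K" "finite F" "K \<subseteq> (\<Union>x\<in>F. ball x (e x))"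
    proof (rule compactE_image[OF K(1), of K "\<lambda>x. ball x (e x)"])
      show "K \<subseteq> (\<Union>x\<in>K. ball x (e x))" using e by force
    qed auto
    have "\<exists>a b. s = cbox a b" if "s \<in> (\<lambda>x. cball x (e x)) ` F" for s :: "real set"
      using that by (auto simp: cball_eq_atLeastAtMost)
    \<comment> \<open>The balls overlap, so their union is recut into a division with disjoint
      interiors.\<close>
    from elementary_unions_intervals[OF finite_imageI[OF F(2)] this]
    obtain P where P: "P division_of (\<Union>x\<in>F. cball x (e x))" .
    have finP: "finite P" using P by (rule division_of_finite)
    have Pk: "Inf k \<le> Sup k \<and> k = {Inf k..Sup k} \<and> k \<subseteq> U \<and> interior k = {Inf k<..<Sup k}" if kP: "k \<in> P" for k
    proof -
      obtain u v where k: "k = cbox u v" "k \<noteq> {}" using division_ofD(3,4)[OF P kP] by auto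
      have "k \<subseteq> (\<Union>x\<in>F. cball x (e x))" using division_ofD(2)[OF P kP] .
      also have "\<dots> \<subseteq> U" using e F(1) by (intro UN_least) (meson subsetD)
      finally show ?thesis using k by auto
    qed
    have disj: "disjoint_family_on (\<lambda>k. {Inf k<..<Sup k}) P"
      unfolding disjoint_family_on_def
    proof (intro ballI impI)
      fix k l assume "k \<in> P" "l \<in> P" "k \<noteq> l"
      then show "{Inf k<..<Sup k} \<inter> {Inf l<..<Sup l} = {}"
        using division_ofD(5)[OF P] Pk by metis
    qed
    note im = nonoverlapping_image_sum[OF finP, of _ "\<lambda>k. (Inf k, Sup k)" UNIV, simplified fst_conv snd_conv, OF _ _ disj]
    have no: "nonoverlapping UNIV ((\<lambda>k. (Inf k, Sup k)) ` P)"
      using Pk by (intro im(1)[of "\<lambda>_ _. 0"]) simp_all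
    have "(\<Sum>(x, y)\<in>(\<lambda>k. (Inf k, Sup k)) ` P. y - x) = (\<Sum>k\<in>P. Sup k - Inf k)"
      using Pk by (intro im(2)) simp_all
    also have "\<dots> = (\<Sum>k\<in>P. measure lebesgue {Inf k<..<Sup k})"
      using Pk by (intro sum.cong) auto
    also have "\<dots> = measure lebesgue (\<Union>k\<in>P. {Inf k<..<Sup k})"
      using disj Pk by (subst measure_finite_Union[OF finP]) auto
    also have "\<dots> \<le> measure lebesgue U"
    proof (rule measure_mono_fmeasurable[OF _ _ Um'])
      show "(\<Union>k\<in>P. {Inf k<..<Sup k}) \<subseteq> U"
        using Pk by (intro UN_least) (metis interior_subset order_trans)
      show "(\<Union>k\<in>P. {Inf k<..<Sup k}) \<in> sets lebesgue" by (intro sets.finite_UN finP) auto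
    qed
    finally have "(\<Sum>(x, y)\<in>(\<lambda>k. (Inf k, Sup k)) ` P. y - x) < \<delta>" using mU by simp
    with \<delta>(2) no have "(\<Sum>(x, y)\<in>(\<lambda>k. (Inf k, Sup k)) ` P. H y - H x) < \<epsilon>" by metis
    moreover have "(\<Sum>(x, y)\<in>(\<lambda>k. (Inf k, Sup k)) ` P. H y - H x) = (\<Sum>k\<in>P. H (Sup k) - H (Inf k))"
      using Pk by (intro im(2)) simp_all
    ultimately have less: "(\<Sum>k\<in>P. H (Sup k) - H (Inf k)) < \<epsilon>" by simp
    have "K \<subseteq> \<Union>P"
    proof -
      have "(\<Union>x\<in>F. ball x (e x)) \<subseteq> (\<Union>x\<in>F. cball x (e x))" by (intro UN_mono ball_subset_cball order_refl)
      then show ?thesis using F(3) division_ofD(6)[OF P] by simp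
    qed
    moreover have Pb: "k \<in> sets ?N" if "k \<in> P" for k
      using Pk[OF that] by (metis borel_closed closed_real_atLeastAtMost sets_interval_measure)
    ultimately have "emeasure ?N K \<le> emeasure ?N (\<Union>P)"
      using finP by (intro emeasure_mono) auto
    also have "\<dots> \<le> (\<Sum>k\<in>P. emeasure ?N k)"
      using emeasure_subadditive_finite[OF finP, of "\<lambda>k. k" ?N] Pb by (simp add: subset_iff)
    also have "\<dots> = (\<Sum>k\<in>P. ennreal (H (Sup k) - H (Inf k)))"
      using Pk Icc by (intro sum.cong refl) metis
    also have "\<dots> = ennreal (\<Sum>k\<in>P. H (Sup k) - H (Inf k))"
      using Pk mono by (intro sum_ennreal) auto
    also have "\<dots> \<le> ennreal \<epsilon>" using less by (intro ennreal_leI) simp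
    finally show ?thesis .
  qed
  then show ?thesis by (metis ennreal_le_epsilon add_0 le_zero_eq)
qed

text \<open>The Stieltjes measure of \<open>h\<close> is finite and vanishes on Lebesgue null sets;
  its Radon-Nikodym density is the \<open>g\<close> sought.\<close>

lemma mono_abs_cont_density:
  fixes h :: "real \<Rightarrow> real"
  assumes ac: "abs_cont_on {c..d} (\<lambda>x. complex_of_real (h x))" and "c \<le> d"
    and mono: "\<And>x y. c \<le> x \<Longrightarrow> x \<le> y \<Longrightarrow> y \<le> d \<Longrightarrow> h x \<le> h y"
  obtains g where "g absolutely_integrable_on {c..d}"
    "\<forall>x\<in>{c..d}. (g has_integral (h x - h c)) {c..x}"
proof -
  \<comment> \<open>Constant continuation outside \<open>{c..d}\<close> makes \<open>h\<close>
    monotone and continuous on the whole line, as the Stieltjes measure requires.\<close>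
  define k where "k \<equiv> \<lambda>x. max c (min d x)"
  define H where "H = (\<lambda>x. h (k x))"
  have Hmono: "H x \<le> H y" if "x \<le> y" for x y
    using that \<open>c \<le> d\<close> unfolding H_def k_def by (intro mono) auto
  have "continuous_on {c..d} (\<lambda>x. Re (complex_of_real (h x)))"
    by (intro continuous_intros abs_cont_on_imp_continuous_on[OF ac])
  then have Hcont: "continuous_on UNIV H"
    unfolding H_def k_def
    by (intro continuous_on_compose2[of "{c..d}" h UNIV] continuous_intros) (use \<open>c \<le> d\<close> in auto)
  have Hac: "\<exists>\<delta>>0. \<forall>D. nonoverlapping UNIV D \<longrightarrow> (\<Sum>(x, y)\<in>D. y - x) < \<delta> \<longrightarrow>
       (\<Sum>(x, y)\<in>D. H y - H x) < \<epsilon>" if pos: "\<epsilon> > 0" for \<epsilon>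
  proof -
    obtain \<delta> where \<delta>: "\<delta> > 0" "\<forall>D. nonoverlapping {c..d} D \<longrightarrow> (\<Sum>(x, y)\<in>D. y - x) < \<delta> \<longrightarrow>
       (\<Sum>(x, y)\<in>D. norm (complex_of_real (h y) - complex_of_real (h x))) < \<epsilon>"
      using abs_cont_onE[OF ac pos] .
    show ?thesis
    proof (intro exI[of _ \<delta>] conjI allI impI \<delta>(1))
      fix D assume D: "nonoverlapping UNIV D" and len: "(\<Sum>(x, y)\<in>D. y - x) < \<delta>"
      have le: "x \<le> y" if "(x, y) \<in> D" for x y
        using D that unfolding nonoverlapping_def by auto
      note clip = nonoverlapping_clip[OF D \<open>c \<le> d\<close>]
      have "(\<Sum>(x, y)\<in>map_prod k k ` D. y - x) = (\<Sum>(x, y)\<in>D. k y - k x)"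
        unfolding k_def by (rule clip(2)) simp
      also have "\<dots> \<le> (\<Sum>(x, y)\<in>D. y - x)"
        using le by (intro sum_mono) (fastforce simp: k_def max_def min_def)
      finally have *: "(\<Sum>(x, y)\<in>map_prod k k ` D. y - x) < \<delta>" using len by simp
      have "nonoverlapping {c..d} (map_prod k k ` D)" unfolding k_def by (rule clip(1)[of "\<lambda>_ _. 0"]) simp
      with \<delta>(2) * have "(\<Sum>(x, y)\<in>map_prod k k ` D. norm (complex_of_real (h y) - complex_of_real (h x))) < \<epsilon>"
        by metis
      also have "(\<Sum>(x, y)\<in>map_prod k k ` D. norm (complex_of_real (h y) - complex_of_real (h x)))
        = (\<Sum>(x, y)\<in>D. norm (complex_of_real (H y) - complex_of_real (H x)))"
        unfolding H_def k_def by (rule clip(2)) simp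
      finally have "(\<Sum>(x, y)\<in>D. norm (complex_of_real (H y) - complex_of_real (H x))) < \<epsilon>" .
      moreover have "(\<Sum>(x, y)\<in>D. H y - H x) \<le> (\<Sum>(x, y)\<in>D. norm (complex_of_real (H y) - complex_of_real (H x)))"
        by (intro sum_mono) (auto simp flip: of_real_diff)
      ultimately show "(\<Sum>(x, y)\<in>D. H y - H x) < \<epsilon>" by simp
    qed
  qed
  let ?N = "interval_measure H"
  have Icc: "emeasure ?N {x..y} = ennreal (H y - H x)" if "x \<le> y" for x y
    using that Hmono Hcont by (rule emeasure_interval_measure_Icc)
  have "emeasure ?N UNIV = (SUP n. emeasure ?N {-real n..real n})"
  proof -
    have inc: "incseq (\<lambda>n. {-real n..real n})" by (auto simp: incseq_def)
    have "UNIV = (\<Union>n. {-real n..real n})"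
    proof (intro UNIV_eq_I)
      fix x :: real
      obtain n where "\<bar>x\<bar> \<le> real n" using real_arch_simple by blast
      then show "x \<in> (\<Union>n. {-real n..real n})" by (intro UN_I[of n]) auto
    qed
    with SUP_emeasure_incseq[OF _ inc, of ?N] show ?thesis by (simp add: image_subset_iff)
  qed
  also have "\<dots> \<le> ennreal (h d - h c)"
  proof (intro SUP_least)
    fix n
    have "H (real n) \<le> h d" "h c \<le> H (- real n)" 
      unfolding H_def k_def using \<open>c \<le> d\<close> by (auto intro!: mono)
    then show "emeasure ?N {-real n..real n} \<le> ennreal (h d - h c)"
      by (subst Icc) (auto intro!: ennreal_leI)
  qed
  finally have fin: "emeasure ?N (space ?N) \<noteq> \<infinity>" by (auto simp: top_unique)
  have "absolutely_continuous lborel ?N"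
    unfolding absolutely_continuous_def
  proof
    fix A :: "real set" assume A: "A \<in> null_sets lborel"
    have Ab: "A \<in> sets borel" using A by auto
    \<comment> \<open>Vanishing is established for compact null sets; inner regularity of the finite
      measure extends it to all Borel null sets.\<close>
    have "emeasure ?N A = (SUP K\<in>{K. K \<subseteq> A \<and> compact K}. emeasure ?N K)"
      by (rule inner_regular) (use fin Ab in auto)
    also have "\<dots> = (SUP K\<in>{K. K \<subseteq> A \<and> compact K}. 0)"
    proof (intro SUP_cong refl)
      fix K assume K: "K \<in> {K. K \<subseteq> A \<and> compact K}"
      then have "emeasure lborel K = 0" using A by (metis (no_types, lifting) emeasure_mono le_zero_eq mem_Collect_eq null_setsD1 null_setsD2)
      then show "emeasure ?N K = 0" using K by (intro null_set_interval_measure Hmono Hcont Hac) auto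
    qed
    also have "\<dots> = (0 :: ennreal)" by (rule antisym[OF SUP_least]) auto
    finally show "A \<in> null_sets ?N" using Ab by (auto simp: null_sets_def)
  qed
  then obtain g0 where g0: "g0 \<in> borel_measurable lborel" "density lborel g0 = ?N"
    using sigma_finite_measure.Radon_Nikodym[OF sigma_finite_lborel, of ?N] by auto
  \<comment> \<open>The density takes values in the extended half-line; it is finite almost
    everywhere on \<open>{c..d}\<close> because its integral there is finite.\<close>
  define g where "g = (\<lambda>x. enn2real (g0 x))"
  have gm: "g \<in> borel_measurable borel" using g0(1) unfolding g_def by simp
  have int: "(\<integral>\<^sup>+t. g0 t * indicator {c..x} t \<partial>lborel) = ennreal (h x - h c)" if "x \<in> {c..d}" for x
  proof -
    have "(\<integral>\<^sup>+t. g0 t * indicator {c..x} t \<partial>lborel) = emeasure ?N {c..x}"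
      unfolding g0(2)[symmetric] using g0(1) by (subst emeasure_density) auto
    also have "\<dots> = ennreal (h x - h c)"
      using that by (subst Icc) (auto simp: H_def k_def)
    finally show ?thesis .
  qed
  have gint: "(g has_integral (h x - h c)) {c..x}" if "x \<in> {c..d}" for x
  proof -
    have "AE t in lborel. g0 t * indicator {c..x} t \<noteq> \<infinity>"
      by (rule nn_integral_noteq_infinite) (use g0 int[OF that] in auto)
    then have "(\<integral>\<^sup>+t. ennreal (g t * indicator {c..x} t) \<partial>lborel) = (\<integral>\<^sup>+t. g0 t * indicator {c..x} t \<partial>lborel)"
      by (intro nn_integral_cong_AE) (auto elim!: eventually_mono simp: g_def indicator_def less_top)
    also have "\<dots> = ennreal (h x - h c)" by (rule int[OF that])
    finally have "((\<lambda>t. g t * indicator {c..x} t) has_integral (h x - h c)) UNIV"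
      using gm that by (intro nn_integral_has_integral) (auto simp: g_def intro!: mono)
    also have "(\<lambda>t. g t * indicator {c..x} t) = (\<lambda>t. if t \<in> {c..x} then g t else 0)"
      by (auto simp: indicator_def)
    finally show ?thesis by (simp only: has_integral_restrict_UNIV)
  qed
  show ?thesis
  proof (rule that)
    show "g absolutely_integrable_on {c..d}"
      using gint[of d] \<open>c \<le> d\<close> by (intro nonnegative_absolutely_integrable_1) (auto simp: g_def)
  qed (rule ballI[OF gint])
qed

text \<open>Re f = (V + Re f) - V, and its analogue for Im f, are differences of increasing
  absolutely continuous functions, with V the variation function.\<close>

lemma abs_cont_on_density:
  fixes f :: "real \<Rightarrow> complex"
  assumes f: "abs_cont_on {c..d} f" and "c \<le> d"
  obtains g where "g absolutely_integrable_on {c..d}"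
    "\<forall>x\<in>{c..d}. (g has_integral (f x - f c)) {c..x}"
proof -
  let ?V = "total_var f c"
  have V: "norm (f y - f x) \<le> ?V y - ?V x" if "c \<le> x" "x \<le> y" "y \<le> d" for x y
    using total_var_ge[OF f that] .
  have monoV0: "?V x \<le> ?V y" if "c \<le> x" "x \<le> y" "y \<le> d" for x y
    using V[OF that] norm_ge_zero[of "f y - f x"] by linarith
  have Vn: "norm (complex_of_real (\<phi> (f y)) - complex_of_real (\<phi> (f x))) \<le> norm (f y - f x)"
    if "\<phi> = Re \<or> \<phi> = Im" for \<phi> x y
    using that abs_Re_le_cmod[of "f y - f x"] abs_Im_le_cmod[of "f y - f x"] by (auto simp flip: of_real_diff)
  have acV: "abs_cont_on {c..d} (\<lambda>x. complex_of_real (?V x + \<phi> (f x)))" if \<phi>: "\<phi> = Re \<or> \<phi> = Im" for \<phi>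
  proof (rule abs_cont_on_domination[OF abs_cont_on_total_var[OF f] f, of 1])
    fix x y
    show "norm (complex_of_real (?V y + \<phi> (f y)) - complex_of_real (?V x + \<phi> (f x)))
      \<le> 1 * (norm (complex_of_real (?V y) - complex_of_real (?V x)) + norm (f y - f x))"
    proof -
      have "complex_of_real (?V y + \<phi> (f y)) - complex_of_real (?V x + \<phi> (f x)) =
        (complex_of_real (?V y) - complex_of_real (?V x)) + (complex_of_real (\<phi> (f y)) - complex_of_real (\<phi> (f x)))"
        by simp
      then show ?thesis using norm_triangle_le[OF add_left_mono[OF Vn[OF \<phi>]]] by (metis mult_1)
    qed
  qed simp
  have monoV: "?V x + \<phi> (f x) \<le> ?V y + \<phi> (f y)" if "\<phi> = Re \<or> \<phi> = Im" "c \<le> x" "x \<le> y" "y \<le> d" for \<phi> x y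
    using V[OF that(2-4)] abs_Re_le_cmod[of "f y - f x"] abs_Im_le_cmod[of "f y - f x"] that(1) by auto
  obtain g1 where g1: "g1 absolutely_integrable_on {c..d}"
    "\<forall>x\<in>{c..d}. (g1 has_integral (?V x - ?V c)) {c..x}"
    using mono_abs_cont_density[OF abs_cont_on_total_var[OF f] \<open>c \<le> d\<close> monoV0] .
  obtain g2 where g2: "g2 absolutely_integrable_on {c..d}"
    "\<forall>x\<in>{c..d}. (g2 has_integral (?V x + Re (f x) - (?V c + Re (f c)))) {c..x}"
    using mono_abs_cont_density[OF acV[OF disjI1[OF refl]] \<open>c \<le> d\<close> monoV[OF disjI1[OF refl]]] .
  obtain g3 where g3: "g3 absolutely_integrable_on {c..d}"
    "\<forall>x\<in>{c..d}. (g3 has_integral (?V x + Im (f x) - (?V c + Im (f c)))) {c..x}"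
    using mono_abs_cont_density[OF acV[OF disjI2[OF refl]] \<open>c \<le> d\<close> monoV[OF disjI2[OF refl]]] .
  define g where "g = (\<lambda>x. complex_of_real (g2 x - g1 x) + \<i> * complex_of_real (g3 x - g1 x))"
  have ofr: "bounded_linear complex_of_real" by (rule bounded_linear_of_real)
  have ii: "bounded_linear (\<lambda>x. \<i> * complex_of_real x)" by (intro bounded_linear_const_mult bounded_linear_of_real)
  show ?thesis
  proof (rule that[of g])
    have "(complex_of_real \<circ> (\<lambda>x. g2 x - g1 x)) absolutely_integrable_on {c..d}"
      "((\<lambda>x. \<i> * complex_of_real x) \<circ> (\<lambda>x. g3 x - g1 x)) absolutely_integrable_on {c..d}"
      using g1 g2 g3 ofr ii by (auto intro!: absolutely_integrable_linear set_integral_diff(1))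
    from set_integral_add(1)[OF this] show "g absolutely_integrable_on {c..d}"
      unfolding g_def o_def .
    show "\<forall>x\<in>{c..d}. (g has_integral (f x - f c)) {c..x}"
    proof
      fix x assume x: "x \<in> {c..d}"
      have "((complex_of_real \<circ> (\<lambda>x. g2 x - g1 x)) has_integral complex_of_real (Re (f x) - Re (f c))) {c..x}"
        using has_integral_diff[OF g2(2)[rule_format, OF x] g1(2)[rule_format, OF x]] by (intro has_integral_linear[OF _ ofr]) simp
      moreover have "(((\<lambda>x. \<i> * complex_of_real x) \<circ> (\<lambda>x. g3 x - g1 x)) has_integral \<i> * complex_of_real (Im (f x) - Im (f c))) {c..x}"
        using has_integral_diff[OF g3(2)[rule_format, OF x] g1(2)[rule_format, OF x]] by (intro has_integral_linear[OF _ ii]) simp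
      ultimately have "(g has_integral (complex_of_real (Re (f x) - Re (f c)) + \<i> * complex_of_real (Im (f x) - Im (f c)))) {c..x}"
        unfolding g_def o_def by (rule has_integral_add)
      also have "complex_of_real (Re (f x) - Re (f c)) + \<i> * complex_of_real (Im (f x) - Im (f c)) = f x - f c"
        by (simp add: complex_eq_iff)
      finally show "(g has_integral (f x - f c)) {c..x}" .
    qed
  qed
qed

section \<open>Lebesgue differentiation and absolute continuity of integrals\<close>

text \<open>\<open>integrable_ccontinuous_explicit\<close> controls averages over intervals that
  begin at \<open>x\<close>, that is, the right derivative. The left derivative is obtained at
  \<open>- x\<close> from the reflected function, so the exceptional set also contains a reflected
  null set.\<close>

lemma indefinite_integral_derivative_ae:
  fixes g :: "real \<Rightarrow> 'b::euclidean_space"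
  assumes g: "g integrable_on {c..d}"
  obtains N where "negligible N"
    "\<forall>x\<in>{c<..<d} - N. ((\<lambda>x. integral {c..x} g) has_vector_derivative g x) (at x)"
proof -
  define g1 where "g1 = (\<lambda>x. if x \<in> {c..d} then g x else 0)"
  have "g1 integrable_on UNIV" using g unfolding g1_def integrable_restrict_UNIV .
  then have i1: "g1 integrable_on cbox a b" for a b by (rule integrable_on_subcbox) simp
  then have i2: "(\<lambda>x. g1 (- x)) integrable_on cbox a b" for a b
    by (metis add.inverse_inverse integrable_reflect)
  obtain N1 where N1: "negligible N1" "\<And>x e. \<lbrakk>x \<notin> N1; 0 < e\<rbrakk> \<Longrightarrow>
     \<exists>d>0. \<forall>h. 0 < h \<and> h < d \<longrightarrow> norm (integral (cbox x (x + h *\<^sub>R One)) g1 /\<^sub>R h ^ DIM(real) - g1 x) < e"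
    using integrable_ccontinuous_explicit[of g1, OF i1] by metis
  obtain N2 where N2: "negligible N2" "\<And>x e. \<lbrakk>x \<notin> N2; 0 < e\<rbrakk> \<Longrightarrow>
     \<exists>d>0. \<forall>h. 0 < h \<and> h < d \<longrightarrow> norm (integral (cbox x (x + h *\<^sub>R One)) (\<lambda>x. g1 (- x)) /\<^sub>R h ^ DIM(real) - g1 (- x)) < e"
    using integrable_ccontinuous_explicit[of "\<lambda>x. g1 (- x)", OF i2] by metis
  have scale: "norm (I - h *\<^sub>R v) \<le> e * h" if "norm (I /\<^sub>R h - v) < e" "h > 0" for I v :: 'b and h e
  proof -
    have "I - h *\<^sub>R v = h *\<^sub>R (I /\<^sub>R h - v)" using that by (simp add: scaleR_diff_right)
    then have "norm (I - h *\<^sub>R v) = h * norm (I /\<^sub>R h - v)" using that by simp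
    also have "\<dots> \<le> h * e" using that by (intro mult_left_mono) auto
    finally show ?thesis by (simp add: mult.commute)
  qed
  let ?F = "\<lambda>x. integral {c..x} g"
  show ?thesis
  proof (rule that[of "N1 \<union> uminus ` N2"])
    show "negligible (N1 \<union> uminus ` N2)"
      using N1(1) N2(1) by (intro negligible_Un negligible_differentiable_image_negligible) (auto intro!: derivative_intros)
    show "\<forall>x\<in>{c<..<d} - (N1 \<union> uminus ` N2). (?F has_vector_derivative g x) (at x)"
    proof
      fix x assume x: "x \<in> {c<..<d} - (N1 \<union> uminus ` N2)"
      then have xN: "x \<notin> N1" "- x \<notin> N2" by (auto simp: image_iff)
      have gx: "g1 x = g x" using x by (simp add: g1_def)
      have Fdiff: "?F y - ?F z = integral {z..y} g1" if "c \<le> z" "z \<le> y" "y \<le> d" for y z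
      proof -
        have "?F z + integral {z..y} g = ?F y"
          using that by (intro Henstock_Kurzweil_Integration.integral_combine integrable_on_subinterval[OF g]) auto
        moreover have "integral {z..y} g = integral {z..y} g1"
          using that by (intro integral_cong) (auto simp: g1_def)
        ultimately show ?thesis by (simp add: algebra_simps)
      qed
      show "(?F has_vector_derivative g x) (at x)"
        unfolding has_vector_derivative_def has_derivative_at_alt
      proof (intro conjI allI impI)
        show "bounded_linear (\<lambda>h. h *\<^sub>R g x)" by (rule bounded_linear_scaleR_left)
        fix e :: real assume "e > 0"
        obtain d1 where d1: "d1 > 0" "\<And>h. 0 < h \<Longrightarrow> h < d1 \<Longrightarrow> norm (integral {x..x + h} g1 /\<^sub>R h - g x) < e"
          using N1(2)[OF xN(1) \<open>e > 0\<close>] gx by auto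
        obtain d2 where d2: "d2 > 0" "\<And>h. 0 < h \<Longrightarrow> h < d2 \<Longrightarrow> norm (integral {-x..-x + h} (\<lambda>x. g1 (- x)) /\<^sub>R h - g x) < e"
          using N2(2)[OF xN(2) \<open>e > 0\<close>] gx by auto
        show "\<exists>\<delta>>0. \<forall>y. norm (y - x) < \<delta> \<longrightarrow> norm (?F y - ?F x - (y - x) *\<^sub>R g x) \<le> e * norm (y - x)"
        proof (intro exI[of _ "min (min d1 d2) (min (x - c) (d - x))"] conjI allI impI)
          show "0 < min (min d1 d2) (min (x - c) (d - x))" using d1(1) d2(1) x by simp
          fix y assume y: "norm (y - x) < min (min d1 d2) (min (x - c) (d - x))"
          consider "y = x" | "y > x" | "y < x" by linarith
          then show "norm (?F y - ?F x - (y - x) *\<^sub>R g x) \<le> e * norm (y - x)"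
          proof cases
            case 2
            have "?F y - ?F x = integral {x..x + (y - x)} g1" using Fdiff[of x y] x y 2 by auto
            moreover have "norm (integral {x..x + (y - x)} g1 /\<^sub>R (y - x) - g x) < e"
              using 2 y by (intro d1(2)) auto
            ultimately show ?thesis using scale[where h="y - x" and v="g x" and e=e] 2 by auto
          next
            case 3
            have "?F x - ?F y = integral {y..x} g1" using Fdiff[of y x] x y 3 by auto
            also have "\<dots> = integral {-x..-x + (x - y)} (\<lambda>x. g1 (- x))"
              by simp
            finally have "?F x - ?F y = integral {-x..-x + (x - y)} (\<lambda>x. g1 (- x))" .
            moreover have "norm (integral {-x..-x + (x - y)} (\<lambda>x. g1 (- x)) /\<^sub>R (x - y) - g x) < e"
              using 3 y by (intro d2(2)) auto
            ultimately have "norm (?F x - ?F y - (x - y) *\<^sub>R g x) \<le> e * (x - y)"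
              using scale[where h="x - y" and v="g x" and e=e] 3 by auto
            moreover have "?F y - ?F x - (y - x) *\<^sub>R g x = - (?F x - ?F y - (x - y) *\<^sub>R g x)"
              by (simp add: algebra_simps)
            ultimately show ?thesis using 3 by (simp only: norm_minus_cancel) simp
          qed simp
        qed
      qed
    qed
  qed
qed

text \<open>The integrands cut off to the open intervals add up to at most \<open>m\<close>;
  endpoints do not affect the integrals.\<close>

lemma sum_integral_nonoverlapping_le:
  fixes m :: "real \<Rightarrow> real"
  assumes D: "nonoverlapping {c..d} D" and m: "m integrable_on {c..d}" "\<And>x. x \<in> {c..d} \<Longrightarrow> 0 \<le> m x"
  shows "(\<Sum>(u, v)\<in>D. integral {u..v} m) \<le> integral {c..d} m"
proof -
  have fin: "finite D" and dis: "disjoint_family_on (\<lambda>p. {fst p<..<snd p}) D"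
    using D unfolding nonoverlapping_def case_prod_beta by blast+
  have sub: "{fst p<..<snd p} \<subseteq> {c..d}" "{fst p..snd p} \<subseteq> {c..d}" if "p \<in> D" for p
    using nonoverlappingD[OF D, of "fst p" "snd p"] that by auto
  define w where "w = (\<lambda>p x. if x \<in> {fst p<..<snd p} then m x else 0)"
  have wi: "(w p) integrable_on {c..d} \<and> integral {c..d} (w p) = integral {fst p..snd p} m" if "p \<in> D" for p
  proof -
    have "m integrable_on {fst p..snd p}" by (rule integrable_on_subinterval[OF m(1) sub(2)[OF that]])
    then have hi: "(m has_integral integral {fst p..snd p} m) {fst p<..<snd p}"
      using has_integral_open_interval[of m _ "fst p" "snd p"] integrable_integral by auto
    have "(w p has_integral integral {fst p..snd p} m) {c..d}"
      unfolding w_def by (rule has_integral_restrict[OF sub(1)[OF that], THEN iffD2, OF hi])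
    then show ?thesis by (auto simp: integrable_on_def integral_unique)
  qed
  have "(\<Sum>(u, v)\<in>D. integral {u..v} m) = (\<Sum>p\<in>D. integral {c..d} (w p))"
    using wi by (intro sum.cong) (auto simp: case_prod_beta)
  also have "\<dots> = integral {c..d} (\<lambda>x. \<Sum>p\<in>D. w p x)"
    using wi fin by (subst integral_sum) auto
  also have "\<dots> \<le> integral {c..d} m"
  proof (rule integral_le)
    show "(\<lambda>x. \<Sum>p\<in>D. w p x) integrable_on {c..d}" using wi fin by (intro integrable_sum) auto
    fix x assume x: "x \<in> {c..d}"
    have "(\<Sum>p\<in>D. w p x) = m x * (\<Sum>p\<in>D. indicator {fst p<..<snd p} x)"
      unfolding sum_distrib_left by (intro sum.cong) (auto simp: w_def indicator_def)
    also have "(\<Sum>p\<in>D. indicator {fst p<..<snd p} x) = (indicator (\<Union>p\<in>D. {fst p<..<snd p}) x :: real)"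
      by (rule indicator_UN_disjoint[OF fin dis, symmetric])
    also have "m x * \<dots> \<le> m x * 1" using m(2)[OF x] by (intro mult_left_mono) (auto simp: indicator_def)
    finally show "(\<Sum>p\<in>D. w p x) \<le> m x" by simp
  qed (rule m)
  finally show ?thesis .
qed

text \<open>Split \<open>k\<close> into its truncation at \<open>n\<close> and the excess
  \<open>m n\<close>. The excess has small integral over all of \<open>{c..d}\<close> by dominated
  convergence, and the truncated part contributes at most \<open>n\<close> times the length of the
  family.\<close>

lemma abs_cont_on_integral_bound:
  fixes k :: "real \<Rightarrow> real"
  assumes k: "k integrable_on {c..d}" "\<And>x. 0 \<le> k x"
    and F: "\<And>x y. c \<le> x \<Longrightarrow> x \<le> y \<Longrightarrow> y \<le> d \<Longrightarrow> norm (F y - F x) \<le> integral {x..y} k"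
  shows "abs_cont_on {c..d} F"
  unfolding abs_cont_on_iff
proof (intro allI impI)
  fix \<epsilon> :: real assume "\<epsilon> > 0"
  define m where "m = (\<lambda>n x. k x - min (k x) (real n))"
  have ka: "k absolutely_integrable_on {c..d}" using k by (intro nonnegative_absolutely_integrable_1) auto
  have mi: "m n integrable_on {c..d}" for n
  proof -
    have "(\<lambda>x. min (k x) (real n)) absolutely_integrable_on {c..d}"
      by (intro absolutely_integrable_min_1 ka) auto
    then show ?thesis unfolding m_def using k(1)
      by (intro integrable_diff) (auto dest: set_lebesgue_integral_eq_integral(1))
  qed
  have "(\<lambda>n. integral {c..d} (m n)) \<longlonglongrightarrow> integral {c..d} (\<lambda>x. 0)"
  proof (rule dominated_convergence(2))
    show "m n integrable_on {c..d}" for n by (rule mi)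
    show "k integrable_on {c..d}" by (rule k)
    show "norm (m n x) \<le> k x" for n x using k(2)[of x] by (auto simp: m_def min_def)
    fix x
    obtain n0 where "k x \<le> real n0" using real_arch_simple by blast
    then have "\<forall>\<^sub>F n in sequentially. m n x = 0"
      by (intro eventually_sequentiallyI[of n0]) (auto simp: m_def min_def)
    then show "(\<lambda>n. m n x) \<longlonglongrightarrow> 0" by (rule tendsto_eventually)
  qed
  then have "(\<lambda>n. integral {c..d} (m n)) \<longlonglongrightarrow> 0" by simp
  then have "\<forall>\<^sub>F n in sequentially. integral {c..d} (m n) < \<epsilon> / 2"
    using \<open>\<epsilon> > 0\<close> by (intro order_tendstoD) auto
  then obtain n where n: "integral {c..d} (m n) < \<epsilon> / 2" by (meson eventually_sequentially order_refl)
  show "\<exists>\<delta>>0. \<forall>D. nonoverlapping {c..d} D \<longrightarrow> (\<Sum>(x, y)\<in>D. y - x) < \<delta> \<longrightarrow>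
       (\<Sum>(x, y)\<in>D. norm (F y - F x)) < \<epsilon>"
  proof (intro exI[of _ "\<epsilon> / (2 * (real n + 1))"] conjI allI impI)
    show "0 < \<epsilon> / (2 * (real n + 1))" using \<open>\<epsilon> > 0\<close> by simp
    fix D assume D: "nonoverlapping {c..d} D" and len: "(\<Sum>(x, y)\<in>D. y - x) < \<epsilon> / (2 * (real n + 1))"
    have "(\<Sum>(x, y)\<in>D. norm (F y - F x)) \<le> (\<Sum>(x, y)\<in>D. integral {x..y} (m n) + real n * (y - x))"
    proof (intro sum_mono)
      fix p assume "p \<in> D"
      then obtain u v where p: "p = (u, v)" "u \<le> v" "c \<le> u" "v \<le> d"
        using nonoverlappingD[OF D] by (cases p) auto
      have ki: "k integrable_on {u..v}" "m n integrable_on {u..v}"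
        using p by (auto intro: integrable_on_subinterval[OF k(1)] integrable_on_subinterval[OF mi])
      have "norm (F v - F u) \<le> integral {u..v} k" using F p by simp
      also have "\<dots> \<le> integral {u..v} (\<lambda>x. m n x + real n)"
        using ki by (intro integral_le integrable_add integrable_const_ivl) (auto simp: m_def)
      also have "\<dots> = integral {u..v} (m n) + real n * (v - u)"
        using ki(2) p by (subst integral_add) (auto intro: integrable_const_ivl)
      finally show "(case p of (x, y) \<Rightarrow> norm (F y - F x)) \<le>
          (case p of (x, y) \<Rightarrow> integral {x..y} (m n) + real n * (y - x))" using p(1) by simp
    qed
    also have "\<dots> = (\<Sum>(x, y)\<in>D. integral {x..y} (m n)) + real n * (\<Sum>(x, y)\<in>D. y - x)"
      by (simp add: case_prod_beta sum.distrib sum_distrib_left)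
    also have "\<dots> \<le> integral {c..d} (m n) + real n * (\<epsilon> / (2 * (real n + 1)))"
      using sum_integral_nonoverlapping_le[OF D mi, of n] len
      by (intro add_mono mult_left_mono) (auto simp: m_def)
    also have "real n * (\<epsilon> / (2 * (real n + 1))) \<le> \<epsilon> / 2"
      using \<open>\<epsilon> > 0\<close> by (simp add: field_simps)
    finally show "(\<Sum>(x, y)\<in>D. norm (F y - F x)) < \<epsilon>" using n by simp
  qed
qed

section \<open>Almost everywhere on open sets, local integrability and derivatives\<close>

lemma AE_lebesgue_on_iff_negligible:
  assumes "S \<in> sets lebesgue"
  shows "(AE x in lebesgue_on S. P x) \<longleftrightarrow> negligible {x\<in>S. \<not> P x}"
proof -
  have "(AE x in lebesgue_on S. P x) \<longleftrightarrow> (AE x in lebesgue. x \<in> S \<longrightarrow> P x)"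
    using assms by (subst AE_restrict_space_iff) auto
  also have "\<dots> \<longleftrightarrow> {x. \<not> (x \<in> S \<longrightarrow> P x)} \<in> null_sets lebesgue"
    by (subst completion.AE_iff_null_sets) auto
  finally show ?thesis by (simp add: negligible_iff_null_sets conj_commute)
qed

text \<open>Intervals with rational endpoints form a countable cover of the open set.\<close>

lemma negligible_open_locally:
  fixes J :: "real set"
  assumes "open J" and "\<And>c d. c < d \<Longrightarrow> {c..d} \<subseteq> J \<Longrightarrow> negligible {x\<in>{c<..<d}. \<not> P x}"
  shows "negligible {x\<in>J. \<not> P x}"
proof -
  define I where "I = {(c, d) \<in> \<rat> \<times> \<rat>. c < d \<and> {c..d} \<subseteq> J}"
  have "countable I" unfolding I_def by (rule countable_subset[of _ "\<rat> \<times> \<rat>"]) (auto intro: countable_rat)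
  then have "negligible (\<Union>((\<lambda>(c, d). {x\<in>{c<..<d}. \<not> P x}) ` I))"
    by (intro negligible_countable_Union) (auto simp: I_def intro!: assms(2)[simplified])
  moreover have "{x\<in>J. \<not> P x} \<subseteq> \<Union>((\<lambda>(c, d). {x\<in>{c<..<d}. \<not> P x}) ` I)"
  proof
    fix x assume x: "x \<in> {x\<in>J. \<not> P x}"
    then obtain e where e: "e > 0" "cball x e \<subseteq> J" using \<open>open J\<close> open_contains_cball by blast
    obtain c where c: "c \<in> \<rat>" "x - e < c" "c < x" using Rats_dense_in_real[of "x - e" x] e by auto
    obtain d where d: "d \<in> \<rat>" "x < d" "d < x + e" using Rats_dense_in_real[of x "x + e"] e by auto
    have "{c..d} \<subseteq> cball x e" using c d by (auto simp: cball_eq_atLeastAtMost)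
    then have "(c, d) \<in> I" using c d e by (auto simp: I_def)
    then show "x \<in> \<Union>((\<lambda>(c, d). {x\<in>{c<..<d}. \<not> P x}) ` I)" using x c d by auto
  qed
  ultimately show ?thesis by (rule negligible_subset)
qed

text \<open>The derivative is an argument and matters only up to a null set. It can be rewritten
  pointwise, independently of the values that \<open>vector_derivative\<close> takes where no
  derivative exists.\<close>

definition ac_deriv :: "real set \<Rightarrow> (real \<Rightarrow> complex) \<Rightarrow> (real \<Rightarrow> complex) \<Rightarrow> bool" where
  "ac_deriv J f g \<longleftrightarrow> f \<in> AC_loc J \<and> (AE x in lebesgue_on J. (f has_vector_derivative g x) (at x))"

definition loc_integrable :: "real set \<Rightarrow> (real \<Rightarrow> complex) \<Rightarrow> bool" where
  "loc_integrable J g \<longleftrightarrow> (\<forall>c d. {c..d} \<subseteq> J \<longrightarrow> g absolutely_integrable_on {c..d})"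

lemma loc_integrableD: "loc_integrable J g \<Longrightarrow> {c..d} \<subseteq> J \<Longrightarrow> g absolutely_integrable_on {c..d}"
  by (simp add: loc_integrable_def)

lemma loc_integrable_of_real: "g \<in> L1_loc J \<Longrightarrow> loc_integrable J (\<lambda>x. complex_of_real (g x))"
  unfolding loc_integrable_def L1_loc_def
  using absolutely_integrable_linear[OF _ bounded_linear_of_real, unfolded o_def] by auto

lemma loc_integrable_add: "loc_integrable J f \<Longrightarrow> loc_integrable J g \<Longrightarrow> loc_integrable J (\<lambda>x. f x + g x)"
  unfolding loc_integrable_def by (auto intro: set_integral_add(1))

lemma loc_integrable_diff: "loc_integrable J f \<Longrightarrow> loc_integrable J g \<Longrightarrow> loc_integrable J (\<lambda>x. f x - g x)"
  unfolding loc_integrable_def by (auto intro: set_integral_diff(1))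

lemma absolutely_integrable_mult_bounded:
  fixes f g :: "real \<Rightarrow> complex"
  assumes "f \<in> borel_measurable (lebesgue_on {c..d})" "bounded (f ` {c..d})" "g absolutely_integrable_on {c..d}"
  shows "(\<lambda>x. f x * g x) absolutely_integrable_on {c..d}"
  using absolutely_integrable_bounded_measurable_product[OF _ assms(1) _ assms(2,3), of "(*)"]
  by (simp add: bilinear_times)

lemma loc_integrable_mult:
  assumes "continuous_on J f" "loc_integrable J g"
  shows "loc_integrable J (\<lambda>x. f x * g x)"
  unfolding loc_integrable_def
proof (intro allI impI absolutely_integrable_mult_bounded)
  fix c d assume cd: "{c..d} \<subseteq> J"
  then have co: "continuous_on {c..d} f" using assms(1) continuous_on_subset by blast
  then show "f \<in> borel_measurable (lebesgue_on {c..d})"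
    by (intro continuous_imp_measurable_on_sets_lebesgue) auto
  show "bounded (f ` {c..d})" using co by (intro compact_imp_bounded compact_continuous_image) auto
  show "g absolutely_integrable_on {c..d}" using assms(2) cd by (rule loc_integrableD)
qed

lemma AC_locD: "f \<in> AC_loc J \<Longrightarrow> {c..d} \<subseteq> J \<Longrightarrow> abs_cont_on {c..d} f"
  by (simp add: AC_loc_def)

lemma open_interval_around:
  assumes "open (J :: real set)" "x \<in> J"
  obtains c d where "c < x" "x < d" "{c..d} \<subseteq> J"
proof -
  obtain e where "e > 0" "cball x e \<subseteq> J" using assms open_contains_cball by blast
  then show ?thesis using that[of "x - e" "x + e"] by (simp add: cball_eq_atLeastAtMost)
qed

lemma AC_loc_continuous_on:
  assumes "f \<in> AC_loc J" "open J"
  shows "continuous_on J f"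
  unfolding continuous_on_eq_continuous_at[OF assms(2)]
proof
  fix x assume "x \<in> J"
  then obtain c d where cd: "c < x" "x < d" "{c..d} \<subseteq> J" using open_interval_around assms(2) by metis
  have "continuous_on {c..d} f" by (rule abs_cont_on_imp_continuous_on[OF AC_locD[OF assms(1) cd(3)]])
  then show "isCont f x" using cd by (intro continuous_on_interior[of "{c..d}"]) auto
qed

lemma AC_loc_derivative:
  assumes f: "f \<in> AC_loc J" and cd: "{c..d} \<subseteq> J" "c \<le> d"
  obtains g N where "g absolutely_integrable_on {c..d}" "(g has_integral (f d - f c)) {c..d}"
    "negligible N" "\<forall>x\<in>{c<..<d} - N. (f has_vector_derivative g x) (at x)"
proof -
  obtain g where g: "g absolutely_integrable_on {c..d}" "\<forall>x\<in>{c..d}. (g has_integral (f x - f c)) {c..x}"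
    using abs_cont_on_density[OF AC_locD[OF f cd(1)] cd(2)] .
  obtain N where N: "negligible N" "\<forall>x\<in>{c<..<d} - N. ((\<lambda>x. integral {c..x} g) has_vector_derivative g x) (at x)"
    using indefinite_integral_derivative_ae[OF set_lebesgue_integral_eq_integral(1)[OF g(1)]] .
  have eq: "integral {c..x} g = f x - f c" if "x \<in> {c..d}" for x
    using g(2) that by (intro integral_unique) simp
  show ?thesis
  proof (rule that[OF g(1) _ N(1)])
    show "(g has_integral (f d - f c)) {c..d}" using g(2) cd(2) by simp
    show "\<forall>x\<in>{c<..<d} - N. (f has_vector_derivative g x) (at x)"
    proof
      fix x assume x: "x \<in> {c<..<d} - N"
      then have der: "((\<lambda>x. f c + integral {c..x} g) has_vector_derivative 0 + g x) (at x)"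
        using N(2) by (intro has_vector_derivative_add has_vector_derivative_const) simp
      show "(f has_vector_derivative g x) (at x)"
      proof (rule has_vector_derivative_transform_within_open[OF der[simplified] open_greaterThanLessThan])
        show "x \<in> {c<..<d}" using x by simp
        show "f c + integral {c..y} g = f y" if "y \<in> {c<..<d}" for y
          using eq[of y] that by simp
      qed
    qed
  qed
qed

lemma AE_lebesgue_on_open_iff: "open (J :: real set) \<Longrightarrow> (AE x in lebesgue_on J. P x) \<longleftrightarrow> negligible {x\<in>J. \<not> P x}"
  by (intro AE_lebesgue_on_iff_negligible) (simp add: borel_open)

lemma AC_loc_ac_deriv:
  assumes f: "f \<in> AC_loc J" and J: "open J"
  shows "ac_deriv J f (\<lambda>x. vector_derivative f (at x))"
proof -
  have "negligible {x\<in>J. \<not> (f has_vector_derivative vector_derivative f (at x)) (at x)}"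
  proof (rule negligible_open_locally[OF J])
    fix c d :: real assume cd: "c < d" "{c..d} \<subseteq> J"
    obtain g N where N: "negligible N" "\<forall>x\<in>{c<..<d} - N. (f has_vector_derivative g x) (at x)"
      using AC_loc_derivative[OF f cd(2) less_imp_le[OF cd(1)]] .
    have "{x\<in>{c<..<d}. \<not> (f has_vector_derivative vector_derivative f (at x)) (at x)} \<subseteq> N"
    proof
      fix x assume x: "x \<in> {x\<in>{c<..<d}. \<not> (f has_vector_derivative vector_derivative f (at x)) (at x)}"
      show "x \<in> N"
      proof (rule ccontr)
        assume "x \<notin> N"
        with N(2) x have "(f has_vector_derivative g x) (at x)" by simp
        with vector_derivative_at[OF this] x show False by simp
      qed
    qed
    with N(1) show "negligible {x\<in>{c<..<d}. \<not> (f has_vector_derivative vector_derivative f (at x)) (at x)}"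
      by (rule negligible_subset)
  qed
  then show ?thesis
    unfolding ac_deriv_def AE_lebesgue_on_open_iff[OF J] using f by blast
qed

lemma ac_deriv_unique:
  assumes "ac_deriv J f g" "ac_deriv J f h"
  shows "AE x in lebesgue_on J. g x = h x"
  using assms unfolding ac_deriv_def by (auto elim!: eventually_elim2 dest: vector_derivative_unique_at)

lemma ac_deriv_cong_AE:
  assumes "ac_deriv J f g" "AE x in lebesgue_on J. g x = h x"
  shows "ac_deriv J f h"
  using assms unfolding ac_deriv_def by (auto elim: eventually_elim2)

lemma AE_lebesgue_onI: "(\<And>x. x \<in> J \<Longrightarrow> P x) \<Longrightarrow> AE x in lebesgue_on J. P x"
  by (rule AE_I2) simp

lemma AC_loc_cong:
  assumes "f \<in> AC_loc J" "\<And>x. x \<in> J \<Longrightarrow> f x = h x"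
  shows "h \<in> AC_loc J"
  unfolding AC_loc_def
proof (intro CollectI allI impI)
  fix c d assume cd: "{c..d} \<subseteq> J"
  show "abs_cont_on {c..d} h"
    by (rule abs_cont_on_domination[OF AC_locD[OF assms(1) cd] AC_locD[OF assms(1) cd], of 1])
      (use assms(2) cd in \<open>auto simp: subset_iff\<close>)
qed

lemma ac_deriv_cong:
  assumes "ac_deriv J f g" "open J" "\<And>x. x \<in> J \<Longrightarrow> f x = h x"
  shows "ac_deriv J h g"
  unfolding ac_deriv_def
proof
  show "h \<in> AC_loc J"
    by (rule AC_loc_cong[of f]) (use assms(1) in \<open>simp add: ac_deriv_def\<close>, rule assms(3))
  have "AE x in lebesgue_on J. (f has_vector_derivative g x) (at x)" using assms(1) by (simp add: ac_deriv_def)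
  moreover have "AE x in lebesgue_on J. x \<in> J" by (rule AE_lebesgue_onI)
  ultimately show "AE x in lebesgue_on J. (h has_vector_derivative g x) (at x)"
  proof eventually_elim
    case (elim x)
    show ?case by (rule has_vector_derivative_transform_within_open[OF elim(1) assms(2) elim(2)]) (rule assms(3))
  qed
qed

lemma ac_deriv_continuous_on: "ac_deriv J f g \<Longrightarrow> open J \<Longrightarrow> continuous_on J f"
  unfolding ac_deriv_def using AC_loc_continuous_on by blast

text \<open>The density of \<open>f\<close> and the function \<open>g\<close> are both derivatives
  of \<open>f\<close> almost everywhere, hence agree almost everywhere.\<close>

lemma ac_deriv_integral:
  assumes fg: "ac_deriv J f g" and J: "open J" and cd: "{c..d} \<subseteq> J" "c \<le> d"
  shows "g absolutely_integrable_on {c..d}" "(g has_integral (f d - f c)) {c..d}"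
proof -
  have f: "f \<in> AC_loc J" using fg by (simp add: ac_deriv_def)
  obtain g0 N where g0: "g0 absolutely_integrable_on {c..d}" "(g0 has_integral (f d - f c)) {c..d}"
    and N: "negligible N" "\<forall>x\<in>{c<..<d} - N. (f has_vector_derivative g0 x) (at x)"
    using AC_loc_derivative[OF f cd] .
  \<comment> \<open>The endpoints are excluded because the density is known to be the derivative
    only inside the interval.\<close>
  let ?N = "N \<union> {x\<in>J. \<not> (f has_vector_derivative g x) (at x)} \<union> {c, d}"
  have "negligible {x\<in>J. \<not> (f has_vector_derivative g x) (at x)}"
    using fg J by (simp add: ac_deriv_def AE_lebesgue_on_open_iff)
  then have neg: "negligible ?N" using N(1) by (intro negligible_Un) auto
  have eq: "g x = g0 x" if "x \<in> {c..d} - ?N" for x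
  proof -
    have "(f has_vector_derivative g0 x) (at x)" using that N(2) by auto
    moreover have "(f has_vector_derivative g x) (at x)" using that cd by auto
    ultimately show ?thesis using vector_derivative_unique_at by metis
  qed
  show "g absolutely_integrable_on {c..d}" by (rule absolutely_integrable_spike[OF g0(1) neg eq])
  show "(g has_integral (f d - f c)) {c..d}" using has_integral_spike[OF neg eq g0(2)] .
qed

lemma ac_deriv_loc_integrable:
  assumes "ac_deriv J f g" "open J"
  shows "loc_integrable J g"
  unfolding loc_integrable_def
proof (intro allI impI)
  fix c d assume "{c..d} \<subseteq> J"
  then show "g absolutely_integrable_on {c..d}"
    using ac_deriv_integral(1)[OF assms, of c d] by (cases "c \<le> d") (auto simp: set_integrable_def)
qed

text \<open>Converse of \<open>ac_deriv_integral\<close>: absolute continuity comes from domination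
  by the norm of \<open>g\<close>, the derivative from Lebesgue differentiation.\<close>

lemma ac_derivI:
  assumes J: "open J" and g: "loc_integrable J g"
    and fg: "\<And>c d. {c..d} \<subseteq> J \<Longrightarrow> c \<le> d \<Longrightarrow> f d - f c = integral {c..d} g"
  shows "ac_deriv J f g"
  unfolding ac_deriv_def AE_lebesgue_on_open_iff[OF J]
proof
  show "f \<in> AC_loc J"
    unfolding AC_loc_def
  proof (intro CollectI allI impI)
    fix c d assume cd: "{c..d} \<subseteq> J"
    have gi: "g absolutely_integrable_on {c..d}" using g cd by (rule loc_integrableD)
    show "abs_cont_on {c..d} f"
    proof (rule abs_cont_on_integral_bound)
      show "(\<lambda>x. norm (g x)) integrable_on {c..d}" using gi by (simp add: absolutely_integrable_on_def)
      fix x y assume xy: "c \<le> x" "x \<le> y" "y \<le> d"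
      then have sub: "{x..y} \<subseteq> {c..d}" by auto
      have "g absolutely_integrable_on {x..y}" by (rule absolutely_integrable_on_subinterval[OF gi sub])
      then have "norm (integral {x..y} g) \<le> integral {x..y} (\<lambda>x. norm (g x))"
        by (intro integral_norm_bound_integral) (auto simp: absolutely_integrable_on_def)
      then show "norm (f y - f x) \<le> integral {x..y} (\<lambda>x. norm (g x))"
        using fg[OF order_trans[OF sub cd] xy(2)] by simp
    qed simp
  qed
  show "negligible {x\<in>J. \<not> (f has_vector_derivative g x) (at x)}"
  proof (rule negligible_open_locally[OF J])
    fix c d :: real assume cd: "c < d" "{c..d} \<subseteq> J"
    have "g integrable_on {c..d}" using loc_integrableD[OF g cd(2)] by (rule set_lebesgue_integral_eq_integral(1))
    from indefinite_integral_derivative_ae[OF this]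
    obtain N where N: "negligible N"
      "\<forall>x\<in>{c<..<d} - N. ((\<lambda>x. integral {c..x} g) has_vector_derivative g x) (at x)" .
    have eq: "f c + integral {c..x} g = f x" if "x \<in> {c<..<d}" for x
    proof -
      have "{c..x} \<subseteq> J" using that cd by force
      from fg[OF this] that have "f x - f c = integral {c..x} g" by simp
      then show ?thesis by (metis add.commute diff_add_cancel)
    qed
    have "(f has_vector_derivative g x) (at x)" if x: "x \<in> {c<..<d} - N" for x
    proof -
      have der: "((\<lambda>x. f c + integral {c..x} g) has_vector_derivative 0 + g x) (at x)"
        using N(2) x by (intro has_vector_derivative_add has_vector_derivative_const) simp
      show ?thesis
      proof (rule has_vector_derivative_transform_within_open[OF der[simplified] open_greaterThanLessThan])
        show "x \<in> {c<..<d}" using x by simp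
        show "f c + integral {c..y} g = f y" if "y \<in> {c<..<d}" for y
          using eq[of y] that by simp
      qed
    qed
    then have "{x\<in>{c<..<d}. \<not> (f has_vector_derivative g x) (at x)} \<subseteq> N" by auto
    with N(1) show "negligible {x\<in>{c<..<d}. \<not> (f has_vector_derivative g x) (at x)}" by (rule negligible_subset)
  qed
qed

text \<open>The set where two continuous functions differ is open, and a nonempty open set is not
  null. This is how a quasi-derivative, specified only almost everywhere, becomes determined at
  every point of \<open>J\<close>.\<close>

lemma AC_loc_AE_eq_imp_eq:
  assumes f: "f \<in> AC_loc J" and h: "h \<in> AC_loc J" and J: "open J"
    and eq: "AE x in lebesgue_on J. f x = h x" and x: "x \<in> J"
  shows "f x = h x"
proof (rule ccontr)
  assume "f x \<noteq> h x"
  have "continuous_on J (\<lambda>x. f x - h x)"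
    using f h J by (intro continuous_intros AC_loc_continuous_on)
  then have "open (J \<inter> (\<lambda>x. f x - h x) -` (- {0}))"
    using J by (intro continuous_open_preimage) auto
  moreover have "J \<inter> (\<lambda>x. f x - h x) -` (- {0}) = {x\<in>J. f x \<noteq> h x}" by auto
  ultimately have "open {x\<in>J. f x \<noteq> h x}" by simp
  moreover have "x \<in> {x\<in>J. f x \<noteq> h x}" using x \<open>f x \<noteq> h x\<close> by simp
  ultimately have "\<not> negligible {x\<in>J. f x \<noteq> h x}" using open_not_negligible by blast
  then show False using eq J by (simp add: AE_lebesgue_on_open_iff)
qed

section \<open>Differentiation rules\<close>

lemma ac_deriv_const: "ac_deriv J (\<lambda>x. c) (\<lambda>x. 0)"
  unfolding ac_deriv_def AC_loc_def abs_cont_on_iff by (auto intro: AE_I2 exI[of _ 1])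

text \<open>The rules below rest on this scheme: a Lipschitz estimate on compact intervals yields
  absolute continuity, the pointwise rule yields the derivative.\<close>

lemma ac_deriv_dominated:
  assumes "ac_deriv J f f'" "ac_deriv J g g'"
    and dom: "\<And>c d. {c..d} \<subseteq> J \<Longrightarrow> \<exists>C\<ge>0. \<forall>x\<in>{c..d}. \<forall>y\<in>{c..d}. norm (h y - h x) \<le> C * (norm (f y - f x) + norm (g y - g x))"
    and der: "\<And>x. x \<in> J \<Longrightarrow> (f has_vector_derivative f' x) (at x) \<Longrightarrow> (g has_vector_derivative g' x) (at x) \<Longrightarrow>
      (h has_vector_derivative h' x) (at x)"
  shows "ac_deriv J h h'"
  unfolding ac_deriv_def
proof
  have fg: "f \<in> AC_loc J" "g \<in> AC_loc J" using assms by (auto simp: ac_deriv_def)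
  show "h \<in> AC_loc J"
    unfolding AC_loc_def
  proof (intro CollectI allI impI)
    fix c d assume cd: "{c..d} \<subseteq> J"
    from dom[OF cd] obtain C where C: "C \<ge> 0"
      "\<forall>x\<in>{c..d}. \<forall>y\<in>{c..d}. norm (h y - h x) \<le> C * (norm (f y - f x) + norm (g y - g x))" by (elim exE conjE)
    show "abs_cont_on {c..d} h"
      by (rule abs_cont_on_domination[OF AC_locD[OF fg(1) cd] AC_locD[OF fg(2) cd] C(1)]) (use C(2) in simp)
  qed
  have "AE x in lebesgue_on J. (f has_vector_derivative f' x) (at x)"
    "AE x in lebesgue_on J. (g has_vector_derivative g' x) (at x)" using assms by (auto simp: ac_deriv_def)
  moreover have "AE x in lebesgue_on J. x \<in> J" by (rule AE_lebesgue_onI)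
  ultimately show "AE x in lebesgue_on J. (h has_vector_derivative h' x) (at x)"
    by eventually_elim (rule der)
qed

lemma ac_deriv_add:
  assumes "ac_deriv J f f'" "ac_deriv J g g'"
  shows "ac_deriv J (\<lambda>x. f x + g x) (\<lambda>x. f' x + g' x)"
proof (rule ac_deriv_dominated[OF assms])
  show "\<exists>C\<ge>0. \<forall>x\<in>{c..d}. \<forall>y\<in>{c..d}. norm (f y + g y - (f x + g x)) \<le> C * (norm (f y - f x) + norm (g y - g x))" for c d
    by (intro exI[of _ 1] conjI ballI) (auto simp: add_diff_add intro: norm_triangle_ineq)
qed (auto intro: derivative_intros)

lemma ac_deriv_mult:
  assumes f: "ac_deriv J f f'" and g: "ac_deriv J g g'" and J: "open J"
  shows "ac_deriv J (\<lambda>x. f x * g x) (\<lambda>x. f x * g' x + f' x * g x)"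
proof (rule ac_deriv_dominated[OF f g])
  fix c d assume cd: "{c..d} \<subseteq> J"
  have bdd: "\<exists>B\<ge>0. \<forall>x\<in>{c..d}. norm (h x) \<le> B" if "ac_deriv J h h'" for h h'
  proof -
    have "continuous_on {c..d} h" using ac_deriv_continuous_on[OF that J] cd continuous_on_subset by blast
    then have "bounded (h ` {c..d})" by (intro compact_imp_bounded compact_continuous_image) auto
    then obtain B where "\<forall>x\<in>{c..d}. norm (h x) \<le> B" unfolding bounded_iff by auto
    then show ?thesis by (intro exI[of _ "\<bar>B\<bar>"]) auto
  qed
  obtain B1 where B1: "B1 \<ge> 0" "\<forall>x\<in>{c..d}. norm (f x) \<le> B1" using bdd[OF f] by blast
  obtain B2 where B2: "B2 \<ge> 0" "\<forall>x\<in>{c..d}. norm (g x) \<le> B2" using bdd[OF g] by blast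
  show "\<exists>C\<ge>0. \<forall>x\<in>{c..d}. \<forall>y\<in>{c..d}. norm (f y * g y - f x * g x) \<le> C * (norm (f y - f x) + norm (g y - g x))"
  proof (intro exI[of _ "B1 + B2"] conjI ballI)
    fix x y assume xy: "x \<in> {c..d}" "y \<in> {c..d}"
    have "f y * g y - f x * g x = f y * (g y - g x) + (f y - f x) * g x" by (simp add: algebra_simps)
    then have "norm (f y * g y - f x * g x) \<le> norm (f y) * norm (g y - g x) + norm (f y - f x) * norm (g x)"
      by (metis norm_mult norm_triangle_ineq)
    also have "\<dots> \<le> B1 * norm (g y - g x) + norm (f y - f x) * B2"
      using B1 B2 xy by (intro add_mono mult_right_mono mult_left_mono) auto
    also have "\<dots> \<le> (B1 + B2) * (norm (f y - f x) + norm (g y - g x))"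
      using B1(1) B2(1) by (simp add: algebra_simps)
    finally show "norm (f y * g y - f x * g x) \<le> (B1 + B2) * (norm (f y - f x) + norm (g y - g x))" .
  qed (use B1 B2 in simp)
qed (rule has_vector_derivative_mult)

lemma ac_deriv_cmult:
  assumes "ac_deriv J f f'" "open J"
  shows "ac_deriv J (\<lambda>x. c * f x) (\<lambda>x. c * f' x)"
  using ac_deriv_mult[OF ac_deriv_const[of J c] assms] by simp

lemma ac_deriv_diff:
  assumes "ac_deriv J f f'" "ac_deriv J g g'" "open J"
  shows "ac_deriv J (\<lambda>x. f x - g x) (\<lambda>x. f' x - g' x)"
  using ac_deriv_add[OF assms(1) ac_deriv_cmult[OF assms(2,3), of "-1"]] by simp

lemma ac_deriv_cnj:
  assumes f: "ac_deriv J f f'"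
  shows "ac_deriv J (\<lambda>x. cnj (f x)) (\<lambda>x. cnj (f' x))"
proof (rule ac_deriv_dominated[OF f f])
  show "\<exists>C\<ge>0. \<forall>x\<in>{c..d}. \<forall>y\<in>{c..d}. norm (cnj (f y) - cnj (f x)) \<le> C * (norm (f y - f x) + norm (f y - f x))" for c d
    by (intro exI[of _ 1] conjI ballI) (auto simp flip: complex_cnj_diff)
qed (rule has_vector_derivative_cnj)

text \<open>On the disc that contains the values of \<open>f\<close> on a compact interval,
  \<open>exp B\<close> bounds the derivative of exp. The rule provides integrating factors.\<close>

lemma ac_deriv_exp:
  assumes f: "ac_deriv J f f'" and J: "open J"
  shows "ac_deriv J (\<lambda>x. exp (f x)) (\<lambda>x. f' x * exp (f x))"
proof (rule ac_deriv_dominated[OF f f])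
  fix c d assume cd: "{c..d} \<subseteq> J"
  have "continuous_on {c..d} f" using ac_deriv_continuous_on[OF f J] cd continuous_on_subset by blast
  then have "bounded (f ` {c..d})" by (intro compact_imp_bounded compact_continuous_image) auto
  then obtain B where B: "\<forall>x\<in>{c..d}. norm (f x) \<le> B" unfolding bounded_iff by auto
  show "\<exists>C\<ge>0. \<forall>x\<in>{c..d}. \<forall>y\<in>{c..d}. norm (exp (f y) - exp (f x)) \<le> C * (norm (f y - f x) + norm (f y - f x))"
  proof (intro exI[of _ "exp B"] conjI ballI)
    fix x y assume xy: "x \<in> {c..d}" "y \<in> {c..d}"
    have "norm (exp (f y) - exp (f x)) \<le> exp B * norm (f y - f x)"
    proof (rule field_differentiable_bound[of "cball 0 B" exp exp])
      fix z :: complex assume "z \<in> cball 0 B"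
      then show "norm (exp z) \<le> exp B" by (simp add: norm_exp_eq_Re order_trans[OF complex_Re_le_cmod])
      show "(exp has_field_derivative exp z) (at z within cball 0 B)" by (auto intro!: derivative_eq_intros)
    qed (use B xy in auto)
    also have "\<dots> \<le> exp B * (norm (f y - f x) + norm (f y - f x))" by (intro mult_left_mono) auto
    finally show "norm (exp (f y) - exp (f x)) \<le> exp B * (norm (f y - f x) + norm (f y - f x))" .
  qed simp
next
  fix x assume "(f has_vector_derivative f' x) (at x)"
  from field_vector_diff_chain_at[OF this DERIV_exp]
  show "((\<lambda>x. exp (f x)) has_vector_derivative f' x * exp (f x)) (at x)" by (simp add: o_def)
qed

lemma ac_deriv_inverse:
  assumes f: "ac_deriv J f f'" and J: "open J" and nz: "\<And>x. x \<in> J \<Longrightarrow> f x \<noteq> 0"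
  shows "ac_deriv J (\<lambda>x. inverse (f x)) (\<lambda>x. - f' x / (f x)\<^sup>2)"
proof (rule ac_deriv_dominated[OF f f])
  fix c d assume cd: "{c..d} \<subseteq> J"
  have "continuous_on {c..d} f" using ac_deriv_continuous_on[OF f J] cd continuous_on_subset by blast
  then have "bounded ((\<lambda>x. inverse (f x)) ` {c..d})"
    using nz cd by (intro compact_imp_bounded compact_continuous_image continuous_on_inverse) auto
  then obtain B where B: "\<forall>x\<in>{c..d}. norm (inverse (f x)) \<le> B" unfolding bounded_iff by auto
  show "\<exists>C\<ge>0. \<forall>x\<in>{c..d}. \<forall>y\<in>{c..d}. norm (inverse (f y) - inverse (f x)) \<le> C * (norm (f y - f x) + norm (f y - f x))"
  proof (intro exI[of _ "B * B"] conjI ballI)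
    fix x y assume xy: "x \<in> {c..d}" "y \<in> {c..d}"
    have "f x \<noteq> 0" "f y \<noteq> 0" using nz xy cd by auto
    then have "inverse (f y) - inverse (f x) = - (inverse (f y) * (f y - f x) * inverse (f x))"
      by (simp add: field_simps)
    then have "norm (inverse (f y) - inverse (f x)) = (norm (inverse (f y)) * norm (inverse (f x))) * norm (f y - f x)"
      by (simp only: norm_minus_cancel norm_mult mult_ac)
    also have "\<dots> \<le> (B * B) * norm (f y - f x)"
      using B xy by (intro mult_right_mono mult_mono) (auto intro: order_trans[OF norm_ge_zero])
    also have "\<dots> \<le> B * B * (norm (f y - f x) + norm (f y - f x))" by (intro mult_left_mono) auto
    finally show "norm (inverse (f y) - inverse (f x)) \<le> B * B * (norm (f y - f x) + norm (f y - f x))" .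
  qed simp
next
  fix x assume x: "x \<in> J" and "(f has_vector_derivative f' x) (at x)"
  from field_vector_diff_chain_at[OF this(2) DERIV_inverse[OF nz[OF x]]]
  show "((\<lambda>x. inverse (f x)) has_vector_derivative - f' x / (f x)\<^sup>2) (at x)"
    by (simp add: o_def field_simps power2_eq_square)
qed

lemma ac_deriv_zero_constant:
  assumes "ac_deriv J f (\<lambda>x. 0)" "open J" "is_interval J" "x \<in> J" "y \<in> J"
  shows "f x = f y"
proof -
  have *: "f v = f u" if "u \<in> J" "v \<in> J" "u \<le> v" for u v
  proof -
    have "{u..v} \<subseteq> J" using assms(3) that by (meson atLeastAtMost_iff mem_is_interval_1_I subsetI)
    from ac_deriv_integral(2)[OF assms(1,2) this that(3)] show ?thesis
      using has_integral_unique has_integral_0 by (metis eq_iff_diff_eq_0)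
  qed
  show ?thesis
  proof (cases "x \<le> y")
    case True then show ?thesis using *[OF assms(4,5)] by simp
  next
    case False then show ?thesis using *[OF assms(5,4)] by simp
  qed
qed

section \<open>Linear first-order systems\<close>

text \<open>The oriented integral from \<open>x0\<close> to \<open>x\<close>: for either order of
  the two points, one of the terms is over an empty or one-point interval and hence 0.\<close>

definition oint :: "real \<Rightarrow> real \<Rightarrow> (real \<Rightarrow> 'b::euclidean_space) \<Rightarrow> 'b" where
  "oint x0 x g = integral {x0..x} g - integral {x..x0} g"

lemma interval_subset:
  assumes "is_interval (J :: real set)" "u \<in> J" "v \<in> J"
  shows "{u..v} \<subseteq> J"
  using assms by (meson atLeastAtMost_iff mem_is_interval_1_I subsetI)

lemma oint_diff:
  assumes J: "is_interval J" "x0 \<in> J" and uv: "u \<in> J" "v \<in> J" "u \<le> v"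
    and g: "\<And>c d. {c..d} \<subseteq> J \<Longrightarrow> g integrable_on {c..d}"
  shows "oint x0 v g - oint x0 u g = integral {u..v} g"
proof -
  have gi: "g integrable_on {c..d}" if "c \<in> J" "d \<in> J" for c d
    using g interval_subset J(1) that by blast
  note combine = Henstock_Kurzweil_Integration.integral_combine
  have trivial: "integral {x..y} g = 0" if "y \<le> x" for x y
    using that by (cases "x = y") auto
  consider "x0 \<le> u" | "u \<le> x0" "x0 \<le> v" | "v \<le> x0" by linarith
  then show ?thesis
  proof cases
    case 1
    then have "integral {x0..u} g + integral {u..v} g = integral {x0..v} g"
      using uv J gi by (intro combine) auto
    then show ?thesis using 1 uv trivial unfolding oint_def by (simp add: algebra_simps)
  next
    case 2
    then have "integral {u..x0} g + integral {x0..v} g = integral {u..v} g"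
      using uv J gi by (intro combine) auto
    then show ?thesis using 2 uv trivial unfolding oint_def by (simp add: algebra_simps)
  next
    case 3
    then have "integral {u..v} g + integral {v..x0} g = integral {u..x0} g"
      using uv J gi by (intro combine) auto
    then show ?thesis using 3 uv trivial unfolding oint_def by (simp add: algebra_simps)
  qed
qed

lemma oint_self [simp]: "oint x x g = 0"
  by (simp add: oint_def)

lemma norm_oint: "norm (oint x0 x g) = norm (integral {min x0 x..max x0 x} g)"
  by (cases x0 x rule: linorder_cases) (auto simp: oint_def min_def max_def)

lemma oint_ac_deriv:
  assumes "open J" "is_interval J" "x0 \<in> J" "loc_integrable J g"
  shows "ac_deriv J (\<lambda>x. oint x0 x g) g"
proof (rule ac_derivI[OF assms(1,4)])
  fix c d assume "{c..d} \<subseteq> J" "c \<le> d"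
  then show "oint x0 d g - oint x0 c g = integral {c..d} g"
    using assms loc_integrableD[OF assms(4)]
    by (intro oint_diff) (auto intro: set_lebesgue_integral_eq_integral(1))
qed

lemma ac_deriv_power:
  assumes f: "ac_deriv J f f'" and J: "open J"
  shows "ac_deriv J (\<lambda>x. f x ^ Suc n) (\<lambda>x. of_nat (Suc n) * f x ^ n * f' x)"
proof (induction n)
  case 0
  then show ?case using f by simp
next
  case (Suc n)
  from ac_deriv_mult[OF f this J] show ?case
    by (simp add: algebra_simps)
qed

text \<open>The \<open>n\<close>-th pair is the difference of successive Picard iterates rather than
  an iterate, so the solution is the sum of a series.\<close>

primrec picard :: "real \<Rightarrow> (real \<Rightarrow> real) \<Rightarrow> (real \<Rightarrow> real) \<Rightarrow> (real \<Rightarrow> real) \<Rightarrow> (real \<Rightarrow> real) \<Rightarrow>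
    complex \<Rightarrow> complex \<Rightarrow> nat \<Rightarrow> (real \<Rightarrow> complex) \<times> (real \<Rightarrow> complex)" where
  "picard x0 a b c d \<alpha> \<beta> 0 = (\<lambda>x. \<alpha>, \<lambda>x. \<beta>)"
| "picard x0 a b c d \<alpha> \<beta> (Suc n) = (let (y, z) = picard x0 a b c d \<alpha> \<beta> n in
    (\<lambda>x. oint x0 x (\<lambda>t. of_real (a t) * y t + of_real (b t) * z t),
     \<lambda>x. oint x0 x (\<lambda>t. of_real (c t) * y t + of_real (d t) * z t)))"

text \<open>The coefficients are merely locally integrable. The usual factorial bound survives with
  the distance from \<open>x0\<close> replaced by \<open>\<phi>\<close>, the oriented integral of
  the sum \<open>m\<close> of their absolute values; the series then converges on all of
  \<open>J\<close> at once.\<close>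

lemma linear_system_solvable:
  fixes a b c d :: "real \<Rightarrow> real" and \<alpha> \<beta> :: complex
  assumes J: "open J" "is_interval J" "x0 \<in> J"
    and coeff: "a \<in> L1_loc J" "b \<in> L1_loc J" "c \<in> L1_loc J" "d \<in> L1_loc J"
  obtains y z where "ac_deriv J y (\<lambda>x. of_real (a x) * y x + of_real (b x) * z x)"
    "ac_deriv J z (\<lambda>x. of_real (c x) * y x + of_real (d x) * z x)" "y x0 = \<alpha>" "z x0 = \<beta>"
proof -
  define Y where "Y = (\<lambda>n. fst (picard x0 a b c d \<alpha> \<beta> n))"
  define Z where "Z = (\<lambda>n. snd (picard x0 a b c d \<alpha> \<beta> n))"
  define GY where "GY = (\<lambda>n t. of_real (a t) * Y n t + of_real (b t) * Z n t)"
  define GZ where "GZ = (\<lambda>n t. of_real (c t) * Y n t + of_real (d t) * Z n t)"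
  have Y0: "Y 0 = (\<lambda>x. \<alpha>)" "Z 0 = (\<lambda>x. \<beta>)" by (simp_all add: Y_def Z_def)
  have YS: "Y (Suc n) = (\<lambda>x. oint x0 x (GY n))" "Z (Suc n) = (\<lambda>x. oint x0 x (GZ n))" for n
    by (simp_all add: Y_def Z_def GY_def GZ_def Let_def case_prod_beta)
  have lin: "loc_integrable J (\<lambda>t. of_real (p t) * u t + of_real (q t) * v t)"
    if pq: "p \<in> L1_loc J" "q \<in> L1_loc J" and uv: "continuous_on J u" "continuous_on J v"
    for p q :: "real \<Rightarrow> real" and u v :: "real \<Rightarrow> complex"
    using loc_integrable_add[OF loc_integrable_mult[OF uv(1) loc_integrable_of_real[OF pq(1)]]
        loc_integrable_mult[OF uv(2) loc_integrable_of_real[OF pq(2)]]]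
    by (simp add: mult.commute)
  have cont: "continuous_on J (Y n) \<and> continuous_on J (Z n)" for n
  proof (induction n)
    case 0 then show ?case by (simp add: Y0)
  next
    case (Suc n)
    then have "loc_integrable J (GY n)" "loc_integrable J (GZ n)"
      unfolding GY_def GZ_def using coeff by (auto intro!: lin)
    then show ?case unfolding YS using oint_ac_deriv[OF J] ac_deriv_continuous_on J(1) by metis
  qed
  have Gint: "loc_integrable J (GY n)" "loc_integrable J (GZ n)" for n
    unfolding GY_def GZ_def using coeff cont by (auto intro!: lin)
  define m where "m = (\<lambda>t. \<bar>a t\<bar> + \<bar>b t\<bar> + \<bar>c t\<bar> + \<bar>d t\<bar>)"
  have m0: "m t \<ge> 0" for t by (simp add: m_def)
  have "m \<in> L1_loc J" using coeff unfolding m_def L1_loc_def by (auto intro!: set_integral_add(1) set_integrable_abs)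
  then have mloc: "loc_integrable J (\<lambda>t. of_real (m t))" by (rule loc_integrable_of_real)
  have mint: "m integrable_on {u..v}" if "{u..v} \<subseteq> J" for u v
    using \<open>m \<in> L1_loc J\<close> that unfolding L1_loc_def by (auto intro: set_lebesgue_integral_eq_integral(1))
  define \<phi> where "\<phi> = (\<lambda>x. oint x0 x m)"
  have \<phi>mono: "\<phi> u \<le> \<phi> v" if "u \<in> J" "v \<in> J" "u \<le> v" for u v
  proof -
    have "\<phi> v - \<phi> u = integral {u..v} m" unfolding \<phi>_def by (rule oint_diff[OF J(2,3) that mint])
    also have "\<dots> \<ge> 0" by (rule integral_nonneg[OF mint[OF interval_subset[OF J(2) that(1,2)]] m0])
    finally show ?thesis by simp
  qed
  have \<phi>ac: "ac_deriv J (\<lambda>x. of_real (\<phi> x)) (\<lambda>x. of_real (m x))"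
  proof (rule ac_derivI[OF J(1) mloc])
    fix u v assume uv: "{u..v} \<subseteq> J" "u \<le> v"
    have "\<phi> v - \<phi> u = integral {u..v} m" unfolding \<phi>_def
      by (rule oint_diff[OF J(2,3) _ _ _ mint]) (use uv in auto)
    then show "of_real (\<phi> v) - of_real (\<phi> u) = integral {u..v} (\<lambda>t. complex_of_real (m t))"
      using integral_linear[OF mint[OF uv(1)] bounded_linear_of_real, unfolded o_def] by (metis of_real_diff)
  qed
  have seg: "{min x0 x..max x0 x} \<subseteq> J" if "x \<in> J" for x
    using interval_subset[OF J(2)] J(3) that by (simp add: min_def max_def)
  \<comment> \<open>This integral produces the next factor of the factorial bound: up to
    orientation, \<open>\<bar>\<phi>\<bar> ^ Suc n / Suc n\<close> is a primitive of the
    integrand.\<close>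
  have pow: "((\<lambda>t. m t * \<bar>\<phi> t\<bar> ^ n) has_integral (\<bar>\<phi> x\<bar> ^ Suc n / real (Suc n))) {min x0 x..max x0 x}"
    if xJ: "x \<in> J" for x n
  proof -
    \<comment> \<open>On the segment between \<open>x0\<close> and \<open>x\<close> the sign of
      \<open>\<phi>\<close> does not change, so \<open>\<sigma>\<close> removes the absolute value
      and the power rule applies.\<close>
    define \<sigma> where "\<sigma> = (if x0 \<le> x then 1 else -1 :: real)"
    have \<phi>abs: "\<bar>\<phi> t\<bar> = \<sigma> * \<phi> t" if "t \<in> {min x0 x..max x0 x}" for t
      using \<phi>mono[of x0 t] \<phi>mono[of t x0] J(3) that seg[OF xJ] unfolding \<sigma>_def
      by (auto simp: \<phi>_def min_def max_def split: if_splits)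
    let ?g = "\<lambda>t. of_nat (Suc n) * (of_real \<sigma> * of_real (\<phi> t)) ^ n * (of_real \<sigma> * complex_of_real (m t))"
    have "ac_deriv J (\<lambda>x. (of_real \<sigma> * complex_of_real (\<phi> x)) ^ Suc n) ?g"
      by (intro ac_deriv_power ac_deriv_cmult \<phi>ac J)
    from ac_deriv_integral(2)[OF this J(1) seg[OF xJ]]
    have "(?g has_integral (of_real \<sigma> * of_real (\<phi> (max x0 x))) ^ Suc n -
        (of_real \<sigma> * of_real (\<phi> (min x0 x))) ^ Suc n) {min x0 x..max x0 x}" by simp
    from has_integral_linear[OF this bounded_linear_Re]
    have "((\<lambda>t. Re (?g t)) has_integral (\<sigma> * \<phi> (max x0 x)) ^ Suc n - (\<sigma> * \<phi> (min x0 x)) ^ Suc n) {min x0 x..max x0 x}"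
      unfolding o_def by (simp del: power_Suc flip: of_real_mult of_real_power)
    also have "(\<sigma> * \<phi> (max x0 x)) ^ Suc n - (\<sigma> * \<phi> (min x0 x)) ^ Suc n = \<sigma> * \<bar>\<phi> x\<bar> ^ Suc n"
      using \<phi>abs[of x] by (auto simp: \<sigma>_def max_def min_def \<phi>_def)
    finally have "((\<lambda>t. (\<sigma> / real (Suc n)) * Re (?g t)) has_integral (\<sigma> / real (Suc n)) * (\<sigma> * \<bar>\<phi> x\<bar> ^ Suc n)) {min x0 x..max x0 x}"
      by (rule has_integral_mult_right)
    also have "(\<sigma> / real (Suc n)) * (\<sigma> * \<bar>\<phi> x\<bar> ^ Suc n) = \<bar>\<phi> x\<bar> ^ Suc n / real (Suc n)"
      by (simp add: \<sigma>_def)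
    finally show ?thesis
    proof (rule has_integral_eq[rotated])
      fix t assume "t \<in> {min x0 x..max x0 x}"
      then have \<phi>t: "\<bar>\<phi> t\<bar> = \<sigma> * \<phi> t" by (rule \<phi>abs)
      have "?g t = of_real (real (Suc n) * (\<sigma> * \<phi> t) ^ n * (\<sigma> * m t))"
        by (simp del: of_nat_Suc)
      then have "Re (?g t) = real (Suc n) * (\<sigma> * \<phi> t) ^ n * (\<sigma> * m t)"
        by (simp only: Re_complex_of_real)
      moreover have "\<sigma> / real (Suc n) * (real (Suc n) * (\<sigma> * \<phi> t) ^ n * (\<sigma> * m t)) =
          (\<sigma> * \<sigma>) * (m t * (\<sigma> * \<phi> t) ^ n)"
        by (simp del: of_nat_Suc)
      moreover have "\<sigma> * \<sigma> = 1" by (simp add: \<sigma>_def)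
      ultimately show "\<sigma> / real (Suc n) * Re (?g t) = m t * \<bar>\<phi> t\<bar> ^ n"
        unfolding \<phi>t by (simp only: mult_1)
    qed
  qed
  define K where "K = norm \<alpha> + norm \<beta>"
  have bound: "norm (Y n x) + norm (Z n x) \<le> K * \<bar>\<phi> x\<bar> ^ n / fact n" if "x \<in> J" for n x
    using that
  proof (induction n arbitrary: x)
    case 0 then show ?case by (simp add: Y0 K_def)
  next
    case (Suc n)
    let ?I = "{min x0 x..max x0 x}"
    have gi: "(\<lambda>t. norm (GY n t)) integrable_on ?I" "(\<lambda>t. norm (GZ n t)) integrable_on ?I"
      and gi': "GY n integrable_on ?I" "GZ n integrable_on ?I"
      using loc_integrableD[OF Gint(1) seg[OF Suc.prems]] loc_integrableD[OF Gint(2) seg[OF Suc.prems]]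
      by (simp_all add: absolutely_integrable_on_def)
    have "norm (Y (Suc n) x) + norm (Z (Suc n) x) = norm (integral ?I (GY n)) + norm (integral ?I (GZ n))"
      by (simp add: YS norm_oint)
    also have "\<dots> \<le> integral ?I (\<lambda>t. norm (GY n t)) + integral ?I (\<lambda>t. norm (GZ n t))"
      using gi gi' by (intro add_mono integral_norm_bound_integral) auto
    also have "\<dots> = integral ?I (\<lambda>t. norm (GY n t) + norm (GZ n t))"
      using gi by (rule integral_add[symmetric])
    also have "\<dots> \<le> K / fact n * (\<bar>\<phi> x\<bar> ^ Suc n / real (Suc n))"
    proof (rule has_integral_le[OF integrable_integral[OF integrable_add[OF gi]] has_integral_mult_right[OF pow[OF Suc.prems]]])
      fix t assume t: "t \<in> ?I"
      have "norm (GY n t) + norm (GZ n t) \<le> (\<bar>a t\<bar> * norm (Y n t) + \<bar>b t\<bar> * norm (Z n t)) + (\<bar>c t\<bar> * norm (Y n t) + \<bar>d t\<bar> * norm (Z n t))"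
        unfolding GY_def GZ_def
        by (intro add_mono; rule norm_triangle_le; simp add: norm_mult)
      also have "\<dots> \<le> m t * (norm (Y n t) + norm (Z n t))"
        unfolding m_def by (simp add: algebra_simps)
      also have "\<dots> \<le> m t * (K * \<bar>\<phi> t\<bar> ^ n / fact n)"
        using Suc.IH[of t] t seg[OF Suc.prems] m0 by (intro mult_left_mono) auto
      finally show "norm (GY n t) + norm (GZ n t) \<le> K / fact n * (m t * \<bar>\<phi> t\<bar> ^ n)"
        by (simp add: field_simps)
    qed
    also have "\<dots> = K * \<bar>\<phi> x\<bar> ^ Suc n / fact (Suc n)" by (simp add: field_simps)
    finally show ?case .
  qed
  have K0: "K \<ge> 0" by (simp add: K_def)
  have esum: "(\<lambda>n. K * \<bar>\<phi> x\<bar> ^ n / fact n) sums (K * exp \<bar>\<phi> x\<bar>)" for x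
    using sums_mult[OF exp_converges[of "\<bar>\<phi> x\<bar>"], of K] by (simp add: field_simps)
  have summ: "summable (\<lambda>n. norm (Y n x) + norm (Z n x))" if "x \<in> J" for x
    using bound[OF that] by (intro summable_comparison_test'[OF sums_summable[OF esum[of x]]]) auto
  have summY: "summable (\<lambda>n. Y n x)" "summable (\<lambda>n. Z n x)" if "x \<in> J" for x
    by (rule summable_norm_cancel, rule summable_comparison_test'[OF summ[OF that]], simp)+
  define y z where "y = (\<lambda>x. \<Sum>n. Y n x)" and "z = (\<lambda>x. \<Sum>n. Z n x)"
  define SY SZ where "SY = (\<lambda>N x. \<Sum>n<N. Y n x)" and "SZ = (\<lambda>N x. \<Sum>n<N. Z n x)"
  have lim: "(\<lambda>N. SY N x) \<longlonglongrightarrow> y x" "(\<lambda>N. SZ N x) \<longlonglongrightarrow> z x" if "x \<in> J" for x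
    unfolding SY_def SZ_def y_def z_def using summY[OF that] by (auto intro: summable_LIMSEQ)
  have Sbound: "norm (SY N x) + norm (SZ N x) \<le> K * exp \<bar>\<phi> x\<bar>" if "x \<in> J" for N x
  proof -
    have "norm (SY N x) + norm (SZ N x) \<le> (\<Sum>n<N. norm (Y n x)) + (\<Sum>n<N. norm (Z n x))"
      unfolding SY_def SZ_def by (intro add_mono norm_sum)
    also have "\<dots> = (\<Sum>n<N. norm (Y n x) + norm (Z n x))" by (simp add: sum.distrib)
    also have "\<dots> \<le> (\<Sum>n<N. K * \<bar>\<phi> x\<bar> ^ n / fact n)" using bound[OF that] by (intro sum_mono)
    also have "\<dots> \<le> (\<Sum>n. K * \<bar>\<phi> x\<bar> ^ n / fact n)"
      using K0 by (intro sum_le_suminf sums_summable[OF esum]) auto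
    also have "\<dots> = K * exp \<bar>\<phi> x\<bar>" using esum sums_unique by metis
    finally show ?thesis .
  qed
  \<comment> \<open>Passage to the limit in the integral equation: on a compact interval the
    integrands are dominated by a multiple of \<open>m\<close> that does not depend on
    \<open>N\<close>.\<close>
  have step: "loc_integrable J (\<lambda>t. of_real (p t) * y t + of_real (q t) * z t) \<and>
      (\<forall>u v. {u..v} \<subseteq> J \<longrightarrow> u \<le> v \<longrightarrow> w v - w u = integral {u..v} (\<lambda>t. of_real (p t) * y t + of_real (q t) * z t))"
    if pq: "p \<in> L1_loc J" "q \<in> L1_loc J" and pqm: "\<And>t. \<bar>p t\<bar> \<le> m t \<and> \<bar>q t\<bar> \<le> m t"
      and w: "\<And>x. x \<in> J \<Longrightarrow> (\<lambda>N. W N x) \<longlonglongrightarrow> w x"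
      and W: "\<And>N u v. {u..v} \<subseteq> J \<Longrightarrow> u \<le> v \<Longrightarrow>
          W (Suc N) v - W (Suc N) u = integral {u..v} (\<lambda>t. of_real (p t) * SY N t + of_real (q t) * SZ N t)"
    for p q :: "real \<Rightarrow> real" and w :: "real \<Rightarrow> complex" and W
  proof -
    let ?f = "\<lambda>N t. of_real (p t) * SY N t + of_real (q t) * SZ N t"
    have main: "(\<lambda>t. of_real (p t) * y t + of_real (q t) * z t) absolutely_integrable_on {u..v} \<and>
        w v - w u = integral {u..v} (\<lambda>t. of_real (p t) * y t + of_real (q t) * z t)"
      if uv: "{u..v} \<subseteq> J" "u \<le> v" for u v
    proof -
      have uJ: "u \<in> J" "v \<in> J" using uv by auto
      have "continuous_on J (SY N)" "continuous_on J (SZ N)" for N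
        unfolding SY_def SZ_def using cont by (auto intro!: continuous_on_sum)
      then have fint: "?f N absolutely_integrable_on {u..v}" for N
        by (intro loc_integrableD[OF lin[OF pq]] uv)
      define h where "h = (\<lambda>t. (K * exp (\<bar>\<phi> u\<bar> + \<bar>\<phi> v\<bar>)) * m t)"
      have hint: "h integrable_on {u..v}" unfolding h_def using integrable_cmul[OF mint[OF uv(1)]] by simp
      have dom: "norm (?f N t) \<le> h t" if t: "t \<in> {u..v}" for N t
      proof -
        have tJ: "t \<in> J" using t uv by auto
        have "\<bar>\<phi> t\<bar> \<le> \<bar>\<phi> u\<bar> + \<bar>\<phi> v\<bar>" using \<phi>mono[OF uJ(1) tJ] \<phi>mono[OF tJ uJ(2)] t by auto
        then have e: "K * exp \<bar>\<phi> t\<bar> \<le> K * exp (\<bar>\<phi> u\<bar> + \<bar>\<phi> v\<bar>)" using K0 by (intro mult_left_mono) auto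
        have "norm (?f N t) \<le> \<bar>p t\<bar> * norm (SY N t) + \<bar>q t\<bar> * norm (SZ N t)"
          by (rule norm_triangle_le) (simp add: norm_mult)
        also have "\<dots> \<le> m t * norm (SY N t) + m t * norm (SZ N t)"
          using pqm[of t] by (intro add_mono mult_right_mono) auto
        also have "\<dots> = m t * (norm (SY N t) + norm (SZ N t))" by (simp add: algebra_simps)
        also have "\<dots> \<le> m t * (K * exp (\<bar>\<phi> u\<bar> + \<bar>\<phi> v\<bar>))"
          using Sbound[OF tJ, of N] e m0 by (intro mult_left_mono) auto
        finally show ?thesis by (simp add: h_def mult.commute)
      qed
      have conv: "(\<lambda>N. ?f N t) \<longlonglongrightarrow> of_real (p t) * y t + of_real (q t) * z t" if "t \<in> {u..v}" for t
        using that uv by (intro tendsto_intros lim) auto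
      have bnd: "norm (of_real (p t) * y t + of_real (q t) * z t) \<le> h t" if "t \<in> {u..v}" for t
        by (rule tendsto_upperbound[OF tendsto_norm[OF conv[OF that]]]) (use dom[OF that] in auto)
      have ai: "(\<lambda>t. of_real (p t) * y t + of_real (q t) * z t) absolutely_integrable_on {u..v}"
        by (rule dominated_convergence_absolutely_integrable[OF fint hint bnd conv])
      have "(\<lambda>N. integral {u..v} (?f N)) \<longlonglongrightarrow> integral {u..v} (\<lambda>t. of_real (p t) * y t + of_real (q t) * z t)"
        by (rule dominated_convergence(2)[OF _ hint dom conv]) (use fint set_lebesgue_integral_eq_integral(1) in blast)
      moreover have "(\<lambda>N. W (Suc N) v - W (Suc N) u) \<longlonglongrightarrow> w v - w u"
        using w[OF uJ(1)] w[OF uJ(2)] by (intro tendsto_diff LIMSEQ_Suc)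
      ultimately have "w v - w u = integral {u..v} (\<lambda>t. of_real (p t) * y t + of_real (q t) * z t)"
        unfolding W[OF uv] using LIMSEQ_unique by blast
      with ai show ?thesis by simp
    qed
    show ?thesis
    proof (intro conjI allI impI)
      show "loc_integrable J (\<lambda>t. of_real (p t) * y t + of_real (q t) * z t)"
        unfolding loc_integrable_def
      proof (intro allI impI)
        fix u v assume "{u..v} \<subseteq> J"
        then show "(\<lambda>t. of_real (p t) * y t + of_real (q t) * z t) absolutely_integrable_on {u..v}"
          using main[of u v] by (cases "u \<le> v") (auto simp: set_integrable_def)
      qed
    qed (use main in simp)
  qed
  \<comment> \<open>The shift by one arises because the zeroth term is constant and drops out of the
    difference.\<close>
  have Sstep: "SY (Suc N) v - SY (Suc N) u = integral {u..v} (\<lambda>t. of_real (a t) * SY N t + of_real (b t) * SZ N t)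
      \<and> SZ (Suc N) v - SZ (Suc N) u = integral {u..v} (\<lambda>t. of_real (c t) * SY N t + of_real (d t) * SZ N t)"
    if uv: "{u..v} \<subseteq> J" "u \<le> v" for N u v
  proof -
    have uJ: "u \<in> J" "v \<in> J" using uv by auto
    have GI: "GY n integrable_on {x..x'}" "GZ n integrable_on {x..x'}" if "{x..x'} \<subseteq> J" for n x x'
      using loc_integrableD[OF Gint(1) that] loc_integrableD[OF Gint(2) that]
      by (auto intro: set_lebesgue_integral_eq_integral(1))
    have dY: "Y (Suc n) v - Y (Suc n) u = integral {u..v} (GY n)" "Z (Suc n) v - Z (Suc n) u = integral {u..v} (GZ n)" for n
      unfolding YS by (rule oint_diff[OF J(2,3) uJ uv(2)], rule GI, assumption)+
    have "SY (Suc N) v - SY (Suc N) u = (\<Sum>n<N. integral {u..v} (GY n))"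
      "SZ (Suc N) v - SZ (Suc N) u = (\<Sum>n<N. integral {u..v} (GZ n))"
      unfolding SY_def SZ_def sum.lessThan_Suc_shift dY[symmetric] sum_subtractf by (simp_all add: Y0)
    moreover have "(\<Sum>n<N. integral {u..v} (GY n)) = integral {u..v} (\<lambda>t. \<Sum>n<N. GY n t)"
      "(\<Sum>n<N. integral {u..v} (GZ n)) = integral {u..v} (\<lambda>t. \<Sum>n<N. GZ n t)"
      using GI[OF uv(1)] by (simp_all add: integral_sum)
    ultimately show ?thesis
      unfolding GY_def GZ_def SY_def SZ_def by (simp add: sum.distrib sum_distrib_left)
  qed
  note sy = step[OF coeff(1,2) _ lim(1) conjunct1[OF Sstep]]
  note sz = step[OF coeff(3,4) _ lim(2) conjunct2[OF Sstep]]
  show ?thesis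
  proof (rule that)
    have "\<bar>a t\<bar> \<le> m t \<and> \<bar>b t\<bar> \<le> m t" for t by (simp add: m_def)
    note s = sy[OF this]
    show "ac_deriv J y (\<lambda>x. of_real (a x) * y x + of_real (b x) * z x)"
      by (rule ac_derivI[OF J(1) conjunct1[OF s]]) (use conjunct2[OF s] in simp_all)
    have "\<bar>c t\<bar> \<le> m t \<and> \<bar>d t\<bar> \<le> m t" for t by (simp add: m_def)
    note s = sz[OF this]
    show "ac_deriv J z (\<lambda>x. of_real (c x) * y x + of_real (d x) * z x)"
      by (rule ac_derivI[OF J(1) conjunct1[OF s]]) (use conjunct2[OF s] in simp_all)
    have "Y (Suc n) x0 = 0" "Z (Suc n) x0 = 0" for n by (simp_all add: YS)
    then have "Y n x0 = 0" "Z n x0 = 0" if "n \<notin> {0}" for n using that by (cases n; simp)+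
    then have "(\<lambda>n. Y n x0) sums (\<Sum>n\<in>{0}. Y n x0)" "(\<lambda>n. Z n x0) sums (\<Sum>n\<in>{0}. Z n x0)"
      by (intro sums_finite; simp)+
    then show "y x0 = \<alpha>" "z x0 = \<beta>" unfolding y_def z_def by (simp_all add: Y0 sums_iff)
  qed
qed

section \<open>The Cauchy-Schwarz inequality for nonnegative hermitian forms\<close>

text \<open>Stated for an abstract form since it serves both the inner product and the shifted form
  of an operator. Functions stand for their classes modulo null sets, so \<open>t v v\<close> may
  vanish for a nonzero \<open>v\<close> and that case is treated separately.\<close>

lemma cauchy_schwarz_form:
  fixes t :: "('a \<Rightarrow> complex) \<Rightarrow> ('a \<Rightarrow> complex) \<Rightarrow> complex"
  assumes D: "\<And>u v z. u \<in> D \<Longrightarrow> v \<in> D \<Longrightarrow> (\<lambda>x. u x - z * v x) \<in> D"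
    and lin: "\<And>w u v z. w \<in> D \<Longrightarrow> u \<in> D \<Longrightarrow> v \<in> D \<Longrightarrow> t w (\<lambda>x. u x - z * v x) = t w u - z * t w v"
    and herm: "\<And>u v. u \<in> D \<Longrightarrow> v \<in> D \<Longrightarrow> t u v = cnj (t v u)"
    and pos: "\<And>u. u \<in> D \<Longrightarrow> 0 \<le> Re (t u u)"
    and u: "u \<in> D" and v: "v \<in> D"
  shows "norm (t u v) \<le> sqrt (Re (t u u)) * sqrt (Re (t v v))"
proof -
  have expand: "Re (t (\<lambda>x. u x - z * v x) (\<lambda>x. u x - z * v x)) =
      Re (t u u) - 2 * Re (z * t u v) + (norm z)\<^sup>2 * Re (t v v)" for z
  proof -
    let ?w = "\<lambda>x. u x - z * v x"
    have w: "?w \<in> D" using D u v .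
    have wu: "t ?w u = t u u - cnj z * t v u"
      using herm[OF w u] lin[OF u u v] herm[OF u u] herm[OF v u] by simp
    have wv: "t ?w v = t u v - cnj z * t v v"
      using herm[OF w v] lin[OF v u v] herm[OF u v] herm[OF v v] by simp
    have "t ?w ?w = t u u - cnj z * t v u - z * (t u v - cnj z * t v v)"
      using lin[OF w u v] wu wv by simp
    also have "\<dots> = t u u - cnj (z * t u v) - z * t u v + (z * cnj z) * t v v"
      using herm[OF v u] by (simp add: algebra_simps)
    also have "Re \<dots> = Re (t u u) - 2 * Re (z * t u v) + (norm z)\<^sup>2 * Re (t v v)"
      by (simp add: complex_norm_square[symmetric] del: of_real_power flip: of_real_mult)
    finally show ?thesis .
  qed
  define n where "n = norm (t u v)"
  \<comment> \<open>The multiplier \<open>k * cnj (t u v)\<close> makes the mixed term real and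
    leaves a real polynomial in \<open>k\<close>.\<close>
  have key: "0 \<le> Re (t u u) - 2 * k * n\<^sup>2 + k\<^sup>2 * n\<^sup>2 * Re (t v v)" for k :: real
  proof -
    let ?z = "of_real k * cnj (t u v)"
    have "?z * t u v = of_real (k * n\<^sup>2)"
      unfolding n_def using complex_norm_square[of "t u v"] by (simp add: mult.assoc mult.commute[of "cnj _"])
    moreover have "(norm ?z)\<^sup>2 = k\<^sup>2 * n\<^sup>2" by (simp add: norm_mult n_def power_mult_distrib)
    ultimately show ?thesis using expand[of ?z] pos[OF D[OF u v, of ?z]] by (simp del: of_real_mult of_real_power)
  qed
  have "n\<^sup>2 \<le> Re (t u u) * Re (t v v)"
  proof (cases "Re (t v v) = 0")
    case False
    then have pv: "Re (t v v) > 0" using pos[OF v] by simp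
    have "0 \<le> Re (t u u) - n\<^sup>2 / Re (t v v)"
      using key[of "1 / Re (t v v)"] pv by (simp add: field_simps power2_eq_square)
    then show ?thesis using pv by (simp add: field_simps)
  next
    case True
    have "n\<^sup>2 = 0"
    proof (rule ccontr)
      assume "n\<^sup>2 \<noteq> 0"
      then have "n\<^sup>2 > 0" by simp
      \<comment> \<open>With \<open>t v v = 0\<close> the polynomial is affine in \<open>k\<close>
        with slope \<open>- 2 * n\<^sup>2\<close>; this \<open>k\<close> makes it negative.\<close>
      define k where "k = (Re (t u u) + 1) / n\<^sup>2"
      have "k * n\<^sup>2 = Re (t u u) + 1" using \<open>n\<^sup>2 > 0\<close> by (simp add: k_def)
      moreover have "0 \<le> Re (t u u) - 2 * (k * n\<^sup>2)" using key[of k] True by (simp add: mult.assoc)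
      ultimately show False using pos[OF u] by linarith
    qed
    then show ?thesis using True by simp
  qed
  then have "sqrt (n\<^sup>2) \<le> sqrt (Re (t u u) * Re (t v v))" by (rule real_sqrt_le_mono)
  then show ?thesis by (simp add: n_def real_sqrt_mult)
qed

section \<open>Square-integrable functions\<close>

lemma L2_integrable_mult:
  assumes "f \<in> L2 M" "g \<in> L2 M"
  shows "integrable M (\<lambda>x. cnj (f x) * g x)"
proof (rule Bochner_Integration.integrable_bound)
  show "integrable M (\<lambda>x. (norm (f x))\<^sup>2 + (norm (g x))\<^sup>2)" using assms by (auto simp: L2_def)
  have [measurable]: "f \<in> borel_measurable M" "g \<in> borel_measurable M" using assms by (auto simp: L2_def)
  have "(\<lambda>x. cnj (f x)) \<in> borel_measurable M"
    by (rule measurable_compose[OF _ borel_measurable_continuous_onI]) (auto intro: continuous_intros)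
  then show "(\<lambda>x. cnj (f x) * g x) \<in> borel_measurable M" by measurable
  show "AE x in M. norm (cnj (f x) * g x) \<le> norm ((norm (f x))\<^sup>2 + (norm (g x))\<^sup>2)"
  proof (rule AE_I2)
    fix x
    have "2 * (norm (f x) * norm (g x)) \<le> (norm (f x))\<^sup>2 + (norm (g x))\<^sup>2"
      using sum_squares_bound[of "norm (f x)" "norm (g x)"] by simp
    moreover have "0 \<le> norm (f x) * norm (g x)" by simp
    ultimately have "norm (f x) * norm (g x) \<le> (norm (f x))\<^sup>2 + (norm (g x))\<^sup>2" by linarith
    then show "norm (cnj (f x) * g x) \<le> norm ((norm (f x))\<^sup>2 + (norm (g x))\<^sup>2)"
      by (simp add: norm_mult)
  qed
qed

lemma L2_lin:
  assumes "f \<in> L2 M" "g \<in> L2 M"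
  shows "(\<lambda>x. f x - z * g x) \<in> L2 M"
proof -
  have [measurable]: "f \<in> borel_measurable M" "g \<in> borel_measurable M" using assms by (auto simp: L2_def)
  have "integrable M (\<lambda>x. (norm (f x - z * g x))\<^sup>2)"
  proof (rule Bochner_Integration.integrable_bound)
    show "integrable M (\<lambda>x. 2 * (norm (f x))\<^sup>2 + (2 * (norm z)\<^sup>2) * (norm (g x))\<^sup>2)"
      using assms by (auto simp: L2_def)
    show "AE x in M. norm ((norm (f x - z * g x))\<^sup>2) \<le> norm (2 * (norm (f x))\<^sup>2 + (2 * (norm z)\<^sup>2) * (norm (g x))\<^sup>2)"
    proof (rule AE_I2)
      fix x
      have "(norm (f x - z * g x))\<^sup>2 \<le> (norm (f x) + norm z * norm (g x))\<^sup>2"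
        using norm_triangle_ineq4[of "f x" "z * g x"] by (intro power_mono) (auto simp: norm_mult)
      also have "\<dots> \<le> 2 * (norm (f x))\<^sup>2 + 2 * (norm z * norm (g x))\<^sup>2"
        using sum_squares_bound[of "norm (f x)" "norm z * norm (g x)"] by (simp add: power2_sum)
      finally show "norm ((norm (f x - z * g x))\<^sup>2) \<le> norm (2 * (norm (f x))\<^sup>2 + (2 * (norm z)\<^sup>2) * (norm (g x))\<^sup>2)"
        by (simp add: power_mult_distrib)
    qed
  qed measurable
  then show ?thesis by (simp add: L2_def)
qed

lemma L2_diff: "f \<in> L2 M \<Longrightarrow> g \<in> L2 M \<Longrightarrow> (\<lambda>x. f x - g x) \<in> L2 M"
  using L2_lin[of f M g 1] by simp

lemma L2_inner_lin:
  assumes "w \<in> L2 M" "u \<in> L2 M" "v \<in> L2 M"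
  shows "L2_inner M w (\<lambda>x. u x - z * v x) = L2_inner M w u - z * L2_inner M w v"
proof -
  have "L2_inner M w (\<lambda>x. u x - z * v x) = (LINT x|M. cnj (w x) * u x - z * (cnj (w x) * v x))"
    unfolding L2_inner_def by (simp add: algebra_simps)
  also have "\<dots> = L2_inner M w u - z * L2_inner M w v"
    unfolding L2_inner_def using L2_integrable_mult[OF assms(1,2)] L2_integrable_mult[OF assms(1,3)]
    by (subst Bochner_Integration.integral_diff) auto
  finally show ?thesis .
qed

lemma L2_inner_diff:
  assumes "w \<in> L2 M" "u \<in> L2 M" "v \<in> L2 M"
  shows "L2_inner M w (\<lambda>x. u x - v x) = L2_inner M w u - L2_inner M w v"
  using L2_inner_lin[OF assms, of 1] by simp

lemma L2_inner_cnj: "L2_inner M u v = cnj (L2_inner M v u)"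
proof -
  have "cnj (L2_inner M v u) = (LINT x|M. cnj (cnj (v x) * u x))"
    unfolding L2_inner_def by (simp only: Bochner_Integration.integral_cnj)
  then show ?thesis unfolding L2_inner_def by (simp add: mult.commute)
qed

lemma L2_inner_diff_left:
  assumes "w \<in> L2 M" "u \<in> L2 M" "v \<in> L2 M"
  shows "L2_inner M (\<lambda>x. u x - v x) w = L2_inner M u w - L2_inner M v w"
  using L2_inner_diff[OF assms] L2_inner_cnj[of M _ w] by (metis complex_cnj_diff)

lemma L2_inner_self: "L2_inner M u u = of_real (LINT x|M. (norm (u x))\<^sup>2)"
proof -
  have "cnj (u x) * u x = of_real ((norm (u x))\<^sup>2)" for x
    using complex_norm_square[of "u x"] by (simp add: mult.commute)
  then show ?thesis unfolding L2_inner_def by (simp del: of_real_power)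
qed

definition L2_norm :: "'a measure \<Rightarrow> ('a \<Rightarrow> complex) \<Rightarrow> real" where
  "L2_norm M f = sqrt (LINT x|M. (norm (f x))\<^sup>2)"

lemma L2_norm_inner: "L2_norm M f = sqrt (Re (L2_inner M f f))"
  by (simp add: L2_norm_def L2_inner_self)

lemma L2_norm_nonneg [simp]: "0 \<le> L2_norm M f"
  by (simp add: L2_norm_def)

lemma L2_tendsto_iff: "L2_tendsto M F f \<longleftrightarrow> (\<lambda>n. L2_norm M (\<lambda>x. F n x - f x)) \<longlonglongrightarrow> 0"
  by (simp add: L2_tendsto_def L2_norm_def)

lemma L2_inner_norm_le:
  assumes "u \<in> L2 M" "v \<in> L2 M"
  shows "norm (L2_inner M u v) \<le> L2_norm M u * L2_norm M v"
  unfolding L2_norm_inner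
proof (rule cauchy_schwarz_form[where D = "L2 M" and t = "L2_inner M"])
  show "0 \<le> Re (L2_inner M u u)" for u by (simp add: L2_inner_self)
qed (use assms L2_lin L2_inner_lin L2_inner_cnj in auto)

lemma seminorm_triangle:
  fixes t :: "('a \<Rightarrow> complex) \<Rightarrow> ('a \<Rightarrow> complex) \<Rightarrow> complex"
  assumes D: "\<And>u v z. u \<in> D \<Longrightarrow> v \<in> D \<Longrightarrow> (\<lambda>x. u x - z * v x) \<in> D"
    and lin: "\<And>w u v z. w \<in> D \<Longrightarrow> u \<in> D \<Longrightarrow> v \<in> D \<Longrightarrow> t w (\<lambda>x. u x - z * v x) = t w u - z * t w v"
    and herm: "\<And>u v. u \<in> D \<Longrightarrow> v \<in> D \<Longrightarrow> t u v = cnj (t v u)"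
    and pos: "\<And>u. u \<in> D \<Longrightarrow> 0 \<le> Re (t u u)"
    and u: "u \<in> D" and v: "v \<in> D"
  defines "s \<equiv> \<lambda>u. sqrt (Re (t u u))"
  shows "s (\<lambda>x. u x - v x) \<le> s u + s v"
proof -
  let ?w = "\<lambda>x. u x - v x"
  have w: "?w \<in> D" using D[OF u v, of 1] by simp
  have "t ?w ?w = t ?w u - t ?w v" using lin[OF w u v, of 1] by simp
  also have "t ?w u = t u u - cnj (t u v)" using herm[OF w u] lin[OF u u v, of 1] herm[OF u u] by simp
  also have "t ?w v = cnj (t v u) - t v v" using herm[OF w v] lin[OF v u v, of 1] herm[OF v v] by simp
  finally have "Re (t ?w ?w) = Re (t u u) - Re (t u v) - Re (t v u) + Re (t v v)" by simp
  also have "Re (t v u) = Re (t u v)" using herm[OF v u] by simp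
  finally have eq: "Re (t ?w ?w) = Re (t u u) - 2 * Re (t u v) + Re (t v v)" by simp
  have "- Re (t u v) \<le> norm (t u v)" using complex_Re_le_cmod[of "- t u v"] by simp
  also have "\<dots> \<le> s u * s v" unfolding s_def by (rule cauchy_schwarz_form[OF D lin herm pos u v])
  finally have "Re (t ?w ?w) \<le> (s u + s v)\<^sup>2"
    unfolding eq using pos[OF u] pos[OF v] by (simp add: s_def power2_sum)
  moreover have "0 \<le> s u + s v" using pos u v by (simp add: s_def)
  ultimately show ?thesis unfolding s_def by (rule real_le_lsqrt[rotated 1])
qed

lemma L2_norm_diff:
  assumes "u \<in> L2 M" "v \<in> L2 M"
  shows "L2_norm M (\<lambda>x. u x - v x) \<le> L2_norm M u + L2_norm M v"
  unfolding L2_norm_inner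
proof (rule seminorm_triangle[where D = "L2 M" and t = "L2_inner M"])
  show "0 \<le> Re (L2_inner M u u)" for u by (simp add: L2_inner_self)
qed (use assms L2_lin L2_inner_lin L2_inner_cnj in auto)

lemma L2_tendsto_diff:
  assumes "L2_tendsto M F f" "L2_tendsto M G g"
    and "\<And>n. F n \<in> L2 M" "f \<in> L2 M" "\<And>n. G n \<in> L2 M" "g \<in> L2 M"
  shows "L2_tendsto M (\<lambda>n x. F n x - z * G n x) (\<lambda>x. f x - z * g x)"
  unfolding L2_tendsto_iff
proof (rule Lim_null_comparison)
  show "(\<lambda>n. L2_norm M (\<lambda>x. F n x - f x) + norm z * L2_norm M (\<lambda>x. G n x - g x)) \<longlonglongrightarrow> 0"
    using assms(1,2) unfolding L2_tendsto_iff by (intro tendsto_eq_intros) auto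
  have "L2_norm M (\<lambda>x. F n x - z * G n x - (f x - z * g x)) \<le>
      L2_norm M (\<lambda>x. F n x - f x) + norm z * L2_norm M (\<lambda>x. G n x - g x)" for n
  proof -
    have FL: "(\<lambda>x. F n x - f x) \<in> L2 M" "(\<lambda>x. G n x - g x) \<in> L2 M" by (intro L2_diff assms)+
    have zero: "(\<lambda>x. 0) \<in> L2 M" by (simp add: L2_def)
    have zL: "(\<lambda>x. z * (G n x - g x)) \<in> L2 M" using L2_lin[OF zero FL(2), of "- z"] by simp
    have "L2_norm M (\<lambda>x. z * (G n x - g x)) = norm z * L2_norm M (\<lambda>x. G n x - g x)"
      by (simp add: L2_norm_def norm_mult power_mult_distrib real_sqrt_mult)
    moreover have "(\<lambda>x. F n x - z * G n x - (f x - z * g x)) = (\<lambda>x. (F n x - f x) - z * (G n x - g x))"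
      by (auto simp: algebra_simps)
    ultimately show ?thesis using L2_norm_diff[OF FL(1) zL] by simp
  qed
  then show "\<forall>\<^sub>F n in sequentially. norm (L2_norm M (\<lambda>x. F n x - z * G n x - (f x - z * g x))) \<le>
      L2_norm M (\<lambda>x. F n x - f x) + norm z * L2_norm M (\<lambda>x. G n x - g x)"
    by simp
qed

lemma L2_inner_tendsto:
  assumes F: "L2_tendsto M F f" and G: "L2_tendsto M G g"
    and L: "\<And>n. F n \<in> L2 M" "f \<in> L2 M" "\<And>n. G n \<in> L2 M" "g \<in> L2 M"
  shows "(\<lambda>n. L2_inner M (F n) (G n)) \<longlonglongrightarrow> L2_inner M f g"
proof -
  let ?a = "\<lambda>n. L2_norm M (\<lambda>x. F n x - f x)" and ?b = "\<lambda>n. L2_norm M (\<lambda>x. G n x - g x)"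
  have "(\<lambda>n. L2_inner M (F n) (G n) - L2_inner M f g) \<longlonglongrightarrow> 0"
  proof (rule Lim_null_comparison)
    show "(\<lambda>n. ?a n * (?b n + L2_norm M g) + L2_norm M f * ?b n) \<longlonglongrightarrow> 0"
      using F G unfolding L2_tendsto_iff by (auto intro!: tendsto_eq_intros)
    have "norm (L2_inner M (F n) (G n) - L2_inner M f g) \<le> ?a n * (?b n + L2_norm M g) + L2_norm M f * ?b n" for n
    proof -
      have d: "(\<lambda>x. F n x - f x) \<in> L2 M" "(\<lambda>x. G n x - g x) \<in> L2 M" by (intro L2_diff L)+
      have zero: "(\<lambda>x. 0) \<in> L2 M" by (simp add: L2_def)
      have mg: "(\<lambda>x. 0 - g x) \<in> L2 M" by (intro L2_diff zero L)
      have "L2_norm M (G n) = L2_norm M (\<lambda>x. (G n x - g x) - (0 - g x))" by simp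
      also have "\<dots> \<le> ?b n + L2_norm M (\<lambda>x. 0 - g x)" by (rule L2_norm_diff[OF d(2) mg])
      also have "L2_norm M (\<lambda>x. 0 - g x) = L2_norm M g" by (simp add: L2_norm_def)
      finally have Gn: "L2_norm M (G n) \<le> ?b n + L2_norm M g" .
      have "L2_inner M (F n) (G n) - L2_inner M f g =
          L2_inner M (\<lambda>x. F n x - f x) (G n) + L2_inner M f (\<lambda>x. G n x - g x)"
        using L2_inner_diff_left[OF L(3) L(1) L(2), of n n] L2_inner_diff[OF L(2) L(3) L(4), of n] by simp
      also have "norm \<dots> \<le> ?a n * L2_norm M (G n) + L2_norm M f * ?b n"
        using L2_inner_norm_le[OF d(1) L(3), of n] L2_inner_norm_le[OF L(2) d(2)] by (intro norm_triangle_le) simp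
      also have "\<dots> \<le> ?a n * (?b n + L2_norm M g) + L2_norm M f * ?b n"
        using Gn by (intro add_mono mult_left_mono) auto
      finally show ?thesis .
    qed
    then show "\<forall>\<^sub>F n in sequentially. norm (L2_inner M (F n) (G n) - L2_inner M f g) \<le>
        ?a n * (?b n + L2_norm M g) + L2_norm M f * ?b n" by simp
  qed
  then show ?thesis by (simp add: LIM_zero_iff)
qed

lemma L2_tendsto_const: "L2_tendsto M (\<lambda>n. f) f"
  by (simp add: L2_tendsto_def)

section \<open>Symmetric operators and the Friedrichs extension\<close>

text \<open>Linearity is recorded through the single operation \<open>f - z * f'\<close>, which
  yields sums, differences and multiples and matches the closure property in
  \<open>cauchy_schwarz_form\<close>.\<close>

locale symmetric_op =
  fixes M :: "'a measure" and S :: "'a l2_op"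
  assumes S_L2: "(f, g) \<in> S \<Longrightarrow> f \<in> L2 M \<and> g \<in> L2 M"
    and S_lin: "(f, g) \<in> S \<Longrightarrow> (f', g') \<in> S \<Longrightarrow> (\<lambda>x. f x - z * f' x, \<lambda>x. g x - z * g' x) \<in> S"
    and S_sym: "(f, g) \<in> S \<Longrightarrow> (f', g') \<in> S \<Longrightarrow> L2_inner M f g' = L2_inner M g f'"
begin

abbreviation "Q \<equiv> form_of_op M S"

abbreviation "D \<equiv> Domain S"

lemma fst_Q [simp]: "fst Q = D"
  by (simp add: form_of_op_def)

lemma D_L2: "u \<in> D \<Longrightarrow> u \<in> L2 M"
  using S_L2 by auto

text \<open>By symmetry, the value of the form depends neither on the choice made in \<open>form_of_op\<close> nor on
  the operator being densely defined.\<close>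

lemma Q_eq:
  assumes u: "u \<in> D" and vw: "(v, w) \<in> S"
  shows "snd Q u v = L2_inner M u w"
proof -
  obtain wu where wu: "(u, wu) \<in> S" using u by auto
  have "(v, SOME w. (v, w) \<in> S) \<in> S" by (rule someI[of "\<lambda>w. (v, w) \<in> S", OF vw])
  from S_sym[OF wu this] S_sym[OF wu vw] show ?thesis by (simp add: form_of_op_def)
qed

lemma D_lin: "u \<in> D \<Longrightarrow> v \<in> D \<Longrightarrow> (\<lambda>x. u x - z * v x) \<in> D"
  using S_lin by (meson Domain.simps)

lemma D_diff: "u \<in> D \<Longrightarrow> v \<in> D \<Longrightarrow> (\<lambda>x. u x - v x) \<in> D"
  using D_lin[of u v 1] by simp

lemma Q_lin:
  assumes "w \<in> D" "u \<in> D" "v \<in> D"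
  shows "snd Q w (\<lambda>x. u x - z * v x) = snd Q w u - z * snd Q w v"
proof -
  obtain u' v' where uv: "(u, u') \<in> S" "(v, v') \<in> S" using assms by auto
  show ?thesis
    using Q_eq[OF assms(1) S_lin[OF uv]] Q_eq[OF assms(1) uv(1)] Q_eq[OF assms(1) uv(2)]
      L2_inner_lin[OF D_L2[OF assms(1)]] S_L2[OF uv(1)] S_L2[OF uv(2)] by simp
qed

lemma Q_herm:
  assumes "u \<in> D" "v \<in> D"
  shows "snd Q u v = cnj (snd Q v u)"
proof -
  obtain u' v' where uv: "(u, u') \<in> S" "(v, v') \<in> S" using assms by auto
  show ?thesis
    using Q_eq[OF assms(1) uv(2)] Q_eq[OF assms(2) uv(1)] S_sym[OF uv] L2_inner_cnj[of M u' v] by simp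
qed

end

locale semibounded_op = symmetric_op +
  fixes c :: real
  assumes S_ge: "op_ge M S c"
begin

text \<open>Subtracting the lower bound makes the form nonnegative on \<open>D\<close>, so it obeys
  the Cauchy-Schwarz inequality and \<open>s\<close> is a seminorm there.\<close>

definition t :: "('a \<Rightarrow> complex) \<Rightarrow> ('a \<Rightarrow> complex) \<Rightarrow> complex" where
  "t u v = snd Q u v - of_real c * L2_inner M u v"

definition s :: "('a \<Rightarrow> complex) \<Rightarrow> real" where
  "s u = sqrt (Re (t u u))"

lemma t_lin:
  assumes "w \<in> D" "u \<in> D" "v \<in> D"
  shows "t w (\<lambda>x. u x - z * v x) = t w u - z * t w v"
  unfolding t_def Q_lin[OF assms] L2_inner_lin[OF assms[THEN D_L2]] by (simp add: algebra_simps)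

lemma t_herm: "u \<in> D \<Longrightarrow> v \<in> D \<Longrightarrow> t u v = cnj (t v u)"
  unfolding t_def using Q_herm[of u v] L2_inner_cnj[of M u v] by simp

lemma t_pos:
  assumes "u \<in> D"
  shows "0 \<le> Re (t u u)"
proof -
  obtain w where w: "(u, w) \<in> S" using assms by auto
  then have "c * Re (L2_inner M u u) \<le> Re (L2_inner M u w)" using S_ge unfolding op_ge_def by fastforce
  then show ?thesis unfolding t_def using Q_eq[OF assms w] by simp
qed

lemma t_bound: "u \<in> D \<Longrightarrow> v \<in> D \<Longrightarrow> norm (t u v) \<le> s u * s v"
  unfolding s_def by (rule cauchy_schwarz_form[OF D_lin t_lin t_herm t_pos])

lemma s_diff: "u \<in> D \<Longrightarrow> v \<in> D \<Longrightarrow> s (\<lambda>x. u x - v x) \<le> s u + s v"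
  unfolding s_def by (rule seminorm_triangle[OF D_lin t_lin t_herm t_pos])

lemma s_nonneg: "u \<in> D \<Longrightarrow> 0 \<le> s u"
  by (simp add: s_def t_pos)

lemma t_self: "u \<in> D \<Longrightarrow> t u u = of_real ((s u)\<^sup>2)"
  using arg_cong[OF t_herm[of u u], of Im] t_pos[of u] unfolding s_def
  by (simp add: complex_eq_iff)

lemma t_diff:
  assumes "u \<in> D" "v \<in> D" "w \<in> D"
  shows "t w (\<lambda>x. u x - v x) = t w u - t w v" "t (\<lambda>x. u x - v x) w = t u w - t v w"
proof -
  show *: "t w (\<lambda>x. u x - v x) = t w u - t w v" using t_lin[OF assms(3,1,2), of 1] by simp
  show "t (\<lambda>x. u x - v x) w = t u w - t v w"
    using t_herm[OF D_diff[OF assms(1,2)] assms(3)] t_herm[OF assms(1,3)] t_herm[OF assms(2,3)] * by simp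
qed

lemma form_tendsto_D: "form_tendsto M Q U u \<Longrightarrow> U n \<in> D"
  by (simp add: form_tendsto_def)

lemma form_tendsto_L2: "form_tendsto M Q U u \<Longrightarrow> L2_tendsto M U u"
  by (simp add: form_tendsto_def)

text \<open>The Cauchy condition in \<open>form_tendsto\<close> concerns \<open>Q\<close>, which may
  be indefinite. Since the differences also tend to 0 in the L2 norm, the shift by \<open>c\<close>
  does no harm.\<close>

lemma form_tendsto_s_cauchy:
  assumes U: "form_tendsto M Q U u" and u: "u \<in> L2 M" and "e > 0"
  shows "\<exists>N. \<forall>m\<ge>N. \<forall>n\<ge>N. s (\<lambda>x. U m x - U n x) < e"
proof -
  \<comment> \<open>Chosen so that \<open>(2 * \<eta>)\<^sup>2\<close> equals
    \<open>e\<^sup>2 / (\<bar>c\<bar> + 1)\<close>, which stays below \<open>e\<^sup>2\<close> even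
    after multiplication by \<open>\<bar>c\<bar>\<close>.\<close>
  define \<eta> where "\<eta> = e / (2 * sqrt (\<bar>c\<bar> + 1))"
  have \<eta>: "\<eta> > 0" "\<bar>c\<bar> * (2 * \<eta>)\<^sup>2 < e\<^sup>2"
    using \<open>e > 0\<close> by (auto simp: \<eta>_def power_mult_distrib power_divide field_simps)
  have UL: "U n \<in> L2 M" for n using form_tendsto_D[OF U] D_L2 by blast
  define r where "r = e\<^sup>2 - \<bar>c\<bar> * (2 * \<eta>)\<^sup>2"
  have r: "r > 0" using \<eta> by (simp add: r_def)
  obtain N1 where N1: "\<And>m n. m \<ge> N1 \<Longrightarrow> n \<ge> N1 \<Longrightarrow> norm (snd Q (\<lambda>x. U m x - U n x) (\<lambda>x. U m x - U n x)) < r"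
    using U r unfolding form_tendsto_def by meson
  have "\<forall>\<^sub>F n in sequentially. L2_norm M (\<lambda>x. U n x - u x) < \<eta>"
    using form_tendsto_L2[OF U] \<eta>(1) unfolding L2_tendsto_iff by (rule order_tendstoD)
  then obtain N2 where N2: "\<And>n. n \<ge> N2 \<Longrightarrow> L2_norm M (\<lambda>x. U n x - u x) < \<eta>"
    unfolding eventually_sequentially by blast
  show ?thesis
  proof (intro exI[of _ "max N1 N2"] allI impI)
    fix m n assume mn: "m \<ge> max N1 N2" "n \<ge> max N1 N2"
    let ?w = "\<lambda>x. U m x - U n x"
    have w: "?w \<in> D" by (intro D_diff form_tendsto_D[OF U])
    have "L2_norm M ?w = L2_norm M (\<lambda>x. (U m x - u x) - (U n x - u x))" by simp
    also have "\<dots> \<le> L2_norm M (\<lambda>x. U m x - u x) + L2_norm M (\<lambda>x. U n x - u x)"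
      by (intro L2_norm_diff L2_diff UL u)
    also have "\<dots> \<le> 2 * \<eta>" using N2[of m] N2[of n] mn by simp
    finally have "(L2_norm M ?w)\<^sup>2 \<le> (2 * \<eta>)\<^sup>2" by (intro power_mono) auto
    then have nw: "norm (L2_inner M ?w ?w) \<le> (2 * \<eta>)\<^sup>2"
      using L2_inner_norm_le[OF D_L2[OF w] D_L2[OF w]] by (simp add: power2_eq_square)
    have "Re (t ?w ?w) \<le> norm (t ?w ?w)" by (rule complex_Re_le_cmod)
    also have "\<dots> \<le> norm (snd Q ?w ?w) + \<bar>c\<bar> * norm (L2_inner M ?w ?w)"
      unfolding t_def using norm_triangle_ineq4[of "snd Q ?w ?w" "of_real c * L2_inner M ?w ?w"] by (simp add: norm_mult)
    also have "\<dots> < r + \<bar>c\<bar> * (2 * \<eta>)\<^sup>2"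
      using N1[of m n] mn nw by (intro add_less_le_mono mult_left_mono) auto
    finally have "Re (t ?w ?w) < e\<^sup>2" by (simp add: r_def)
    then have "sqrt (Re (t ?w ?w)) < sqrt (e\<^sup>2)" by (rule real_sqrt_less_mono)
    then show "s ?w < e" unfolding s_def using \<open>e > 0\<close> by simp
  qed
qed

text \<open>By the triangle inequality two values of \<open>s\<close> differ by at most
  \<open>s\<close> of the difference, so they form a Cauchy sequence of reals.\<close>

lemma form_tendsto_s_convergent:
  assumes U: "form_tendsto M Q U u" and u: "u \<in> L2 M"
  shows "convergent (\<lambda>n. s (U n))"
proof -
  have UD: "U n \<in> D" for n by (rule form_tendsto_D[OF U])
  have le: "s (U m) \<le> s (U n) + s (\<lambda>x. U m x - U n x)" for m n
  proof -
    have "U m = (\<lambda>x. U n x - (U n x - U m x))" by auto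
    then have "s (U m) \<le> s (U n) + s (\<lambda>x. U n x - U m x)"
      using s_diff[OF UD[of n] D_diff[OF UD[of n] UD[of m]]] by simp
    also have "s (\<lambda>x. U n x - U m x) = s (\<lambda>x. U m x - U n x)"
      unfolding s_def using t_diff UD D_diff by simp
    finally show ?thesis .
  qed
  have "Cauchy (\<lambda>n. s (U n))"
  proof (rule metric_CauchyI)
    fix e :: real assume "e > 0"
    then obtain N where N: "\<And>m n. m \<ge> N \<Longrightarrow> n \<ge> N \<Longrightarrow> s (\<lambda>x. U m x - U n x) < e"
      using form_tendsto_s_cauchy[OF U u] by meson
    have "dist (s (U m)) (s (U n)) < e" if "m \<ge> N" "n \<ge> N" for m n
      using le[of m n] le[of n m] N[OF that] N[OF that(2,1)] by (auto simp: dist_real_def)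
    then show "\<exists>N. \<forall>m\<ge>N. \<forall>n\<ge>N. dist (s (U m)) (s (U n)) < e" by blast
  qed
  then show ?thesis by (rule Cauchy_convergent)
qed

lemma form_tendsto_s_bounded:
  assumes "form_tendsto M Q U u" "u \<in> L2 M"
  obtains B where "B > 0" "\<And>n. s (U n) \<le> B"
proof -
  have "Bseq (\<lambda>n. s (U n))" using form_tendsto_s_convergent[OF assms] by (rule convergent_imp_Bseq)
  then obtain B where "B > 0" "\<And>n. norm (s (U n)) \<le> B" unfolding Bseq_def by blast
  then show ?thesis using that[of B] by (metis abs_le_D1 real_norm_def)
qed

text \<open>The form is closable: if \<open>W\<^sub>n\<close> is a form-Cauchy null sequence, let \<open>m\<close> tend to infinity in
  \<open>t(W\<^sub>n, W\<^sub>n) = t(W\<^sub>n, W\<^sub>n - W\<^sub>m) + t(W\<^sub>n, W\<^sub>m)\<close>.\<close>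

lemma form_tendsto_unique:
  assumes U: "form_tendsto M Q U u" and V: "form_tendsto M Q V u" and u: "u \<in> L2 M"
  shows "(\<lambda>n. s (\<lambda>x. U n x - V n x)) \<longlonglongrightarrow> 0"
proof -
  define W where "W = (\<lambda>n x. U n x - V n x)"
  note UD = form_tendsto_D[OF U] and VD = form_tendsto_D[OF V]
  have WD: "W n \<in> D" for n unfolding W_def by (intro D_diff UD VD)
  have W0: "L2_tendsto M W (\<lambda>x. 0)"
    using L2_tendsto_diff[OF form_tendsto_L2[OF U] form_tendsto_L2[OF V] D_L2[OF UD] u D_L2[OF VD] u, of 1]
    by (simp add: W_def)
  have Wd: "s (\<lambda>x. W m x - W n x) \<le> s (\<lambda>x. U m x - U n x) + s (\<lambda>x. V m x - V n x)" for m n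
  proof -
    have "(\<lambda>x. W m x - W n x) = (\<lambda>x. (U m x - U n x) - (V m x - V n x))" by (auto simp: W_def)
    then show ?thesis using s_diff[OF D_diff[OF UD UD] D_diff[OF VD VD]] by metis
  qed
  obtain B1 where B1: "B1 > 0" "\<And>n. s (U n) \<le> B1" using form_tendsto_s_bounded[OF U u] by blast
  obtain B2 where B2: "B2 > 0" "\<And>n. s (V n) \<le> B2" using form_tendsto_s_bounded[OF V u] by blast
  define B where "B = B1 + B2"
  have "s (W n) \<le> B" for n
    using B1(2)[of n] B2(2)[of n] s_diff[OF UD[of n] VD[of n]] unfolding B_def W_def by linarith
  moreover have "B > 0" using B1(1) B2(1) by (simp add: B_def)
  ultimately have B: "B > 0" "s (W n) \<le> B" for n by blast+
  have "(\<lambda>n. (s (W n))\<^sup>2) \<longlonglongrightarrow> 0"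
  proof (rule LIMSEQ_I)
    fix e :: real assume "e > 0"
    define \<eta> where "\<eta> = e / (4 * B)"
    have \<eta>: "\<eta> > 0" "B * (\<eta> + \<eta>) < e" using \<open>e > 0\<close> B(1) by (auto simp: \<eta>_def field_simps)
    obtain N1 where N1: "\<And>m n. m \<ge> N1 \<Longrightarrow> n \<ge> N1 \<Longrightarrow> s (\<lambda>x. U m x - U n x) < \<eta>"
      using form_tendsto_s_cauchy[OF U u \<eta>(1)] by meson
    obtain N2 where N2: "\<And>m n. m \<ge> N2 \<Longrightarrow> n \<ge> N2 \<Longrightarrow> s (\<lambda>x. V m x - V n x) < \<eta>"
      using form_tendsto_s_cauchy[OF V u \<eta>(1)] by meson
    have "(s (W n))\<^sup>2 \<le> B * (\<eta> + \<eta>)" if n: "n \<ge> max N1 N2" for n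
    proof -
      \<comment> \<open>Here it matters that the form comes from an operator: with \<open>w\<close>
        an image of \<open>W n\<close>, the value \<open>t (W m) (W n)\<close> consists of L2 inner
        products of \<open>W m\<close> with fixed functions, so it tends to 0 with
        \<open>W m\<close>.\<close>
      obtain w where w: "(W n, w) \<in> S" using WD by auto
      have "t (W m) (W n) = L2_inner M (W m) w - of_real c * L2_inner M (W m) (W n)" for m
        unfolding t_def using Q_eq[OF WD w] by simp
      moreover have "(\<lambda>m. L2_inner M (W m) w) \<longlonglongrightarrow> 0" "(\<lambda>m. L2_inner M (W m) (W n)) \<longlonglongrightarrow> 0"
        using L2_inner_tendsto[OF W0 L2_tendsto_const, of w] L2_inner_tendsto[OF W0 L2_tendsto_const, of "W n"]
          D_L2[OF WD] S_L2[OF w] by (auto simp: L2_inner_def L2_def)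
      ultimately have "(\<lambda>m. t (W m) (W n)) \<longlonglongrightarrow> 0" by (auto intro!: tendsto_eq_intros)
      then have lim: "(\<lambda>m. B * (\<eta> + \<eta>) + norm (t (W m) (W n))) \<longlonglongrightarrow> B * (\<eta> + \<eta>)"
        by (auto intro!: tendsto_eq_intros)
      have "(s (W n))\<^sup>2 \<le> B * (\<eta> + \<eta>) + norm (t (W m) (W n))" if m: "m \<ge> max N1 N2" for m
      proof -
        have "(s (W n))\<^sup>2 = norm (t (W n) (W n))" using t_self[OF WD] by (simp add: norm_power)
        also have "t (W n) (W n) = t (W n) (\<lambda>x. W n x - W m x) + t (W n) (W m)"
          using t_diff(1)[OF WD WD WD] by simp
        also have "norm \<dots> \<le> s (W n) * s (\<lambda>x. W n x - W m x) + norm (t (W n) (W m))"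
          using t_bound[OF WD D_diff[OF WD WD]] by (intro norm_triangle_le add_mono) auto
        also have "\<dots> \<le> B * (\<eta> + \<eta>) + norm (t (W n) (W m))"
          using B Wd[of n m] N1[of n m] N2[of n m] n m s_nonneg[OF WD] s_nonneg[OF D_diff[OF WD WD]]
          by (intro add_mono mult_mono) auto
        also have "norm (t (W n) (W m)) = norm (t (W m) (W n))" by (subst t_herm[OF WD WD]) simp
        finally show ?thesis .
      qed
      then show ?thesis
        by (intro tendsto_lowerbound[OF lim] eventually_sequentiallyI[of "max N1 N2"]) auto
    qed
    from le_less_trans[OF this \<eta>(2)]
    show "\<exists>no. \<forall>n\<ge>no. norm ((s (W n))\<^sup>2 - 0) < e"
      by (intro exI[of _ "max N1 N2"] allI impI) (simp del: max.bounded_iff)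
  qed
  from tendsto_real_sqrt[OF this] have "(\<lambda>n. sqrt ((s (W n))\<^sup>2)) \<longlonglongrightarrow> 0" by simp
  then show ?thesis using s_nonneg[OF WD] by (simp add: W_def)
qed

lemma Q_t: "snd Q u v = t u v + of_real c * L2_inner M u v"
  by (simp add: t_def)

text \<open>The description by \<open>THE\<close> demands one limit for all approximating sequences.
  Two sequences with the same limit differ by an \<open>s\<close>-null sequence, and Cauchy-Schwarz
  carries this over to the values of the form.\<close>

lemma form_closure_value:
  assumes U: "form_tendsto M Q U u" and V: "form_tendsto M Q V v" and uv: "u \<in> L2 M" "v \<in> L2 M"
    and z: "(\<lambda>n. snd Q (U n) (V n)) \<longlonglongrightarrow> z"
  shows "snd (form_closure M Q) u v = z"
proof -
  have all: "(\<lambda>n. snd Q (U' n) (V' n)) \<longlonglongrightarrow> z"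
    if U': "form_tendsto M Q U' u" and V': "form_tendsto M Q V' v" for U' V'
  proof -
    note D = form_tendsto_D[OF U] form_tendsto_D[OF V] form_tendsto_D[OF U'] form_tendsto_D[OF V']
    obtain B1 where B1: "B1 > 0" "\<And>n. s (U' n) \<le> B1" using form_tendsto_s_bounded[OF U' uv(1)] by blast
    obtain B2 where B2: "B2 > 0" "\<And>n. s (V n) \<le> B2" using form_tendsto_s_bounded[OF V uv(2)] by blast
    have "(\<lambda>n. t (U' n) (V' n) - t (U n) (V n)) \<longlonglongrightarrow> 0"
    proof (rule Lim_null_comparison)
      show "(\<lambda>n. s (\<lambda>x. U' n x - U n x) * B2 + B1 * s (\<lambda>x. V' n x - V n x)) \<longlonglongrightarrow> 0"
        using form_tendsto_unique[OF U' U uv(1)] form_tendsto_unique[OF V' V uv(2)]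
        by (auto intro!: tendsto_eq_intros)
      have "norm (t (U' n) (V' n) - t (U n) (V n)) \<le> s (\<lambda>x. U' n x - U n x) * B2 + B1 * s (\<lambda>x. V' n x - V n x)" for n
      proof -
        have "t (U' n) (V' n) - t (U n) (V n) = t (\<lambda>x. U' n x - U n x) (V n) + t (U' n) (\<lambda>x. V' n x - V n x)"
          using t_diff(2)[OF D(3,1,2)] t_diff(1)[OF D(4,2,3)] by simp
        also have "norm \<dots> \<le> s (\<lambda>x. U' n x - U n x) * s (V n) + s (U' n) * s (\<lambda>x. V' n x - V n x)"
          by (intro norm_triangle_le add_mono t_bound D_diff D)
        also have "\<dots> \<le> s (\<lambda>x. U' n x - U n x) * B2 + B1 * s (\<lambda>x. V' n x - V n x)"
          using B1 B2 by (intro add_mono mult_left_mono mult_right_mono s_nonneg D_diff D) auto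
        finally show ?thesis .
      qed
      then show "\<forall>\<^sub>F n in sequentially. norm (t (U' n) (V' n) - t (U n) (V n)) \<le>
          s (\<lambda>x. U' n x - U n x) * B2 + B1 * s (\<lambda>x. V' n x - V n x)" by simp
    qed
    moreover have "(\<lambda>n. L2_inner M (U' n) (V' n)) \<longlonglongrightarrow> L2_inner M u v" "(\<lambda>n. L2_inner M (U n) (V n)) \<longlonglongrightarrow> L2_inner M u v"
      using L2_inner_tendsto[OF form_tendsto_L2[OF U'] form_tendsto_L2[OF V']]
        L2_inner_tendsto[OF form_tendsto_L2[OF U] form_tendsto_L2[OF V]] D_L2 D uv by auto
    ultimately have "(\<lambda>n. (t (U' n) (V' n) - t (U n) (V n)) +
        of_real c * (L2_inner M (U' n) (V' n) - L2_inner M (U n) (V n)) + snd Q (U n) (V n)) \<longlonglongrightarrow>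
        0 + of_real c * (L2_inner M u v - L2_inner M u v) + z"
      using z by (intro tendsto_intros)
    then show ?thesis by (simp add: Q_t algebra_simps)
  qed
  show ?thesis
    unfolding form_closure_def snd_conv
    by (rule the_equality) (use all U V LIMSEQ_unique[OF z] in blast)+
qed

lemma form_tendsto_const:
  assumes "u \<in> D"
  shows "form_tendsto M Q (\<lambda>n. u) u"
proof -
  have "(\<lambda>x. u x - u x) \<in> D" using D_diff[OF assms assms] .
  moreover have "t (\<lambda>x. u x - u x) (\<lambda>x. u x - u x) = 0" using t_diff(1)[OF assms assms D_diff[OF assms assms]] by simp
  ultimately have "snd Q (\<lambda>x. 0) (\<lambda>x. 0) = 0" by (simp add: Q_t L2_inner_def)
  then show ?thesis using assms by (simp add: form_tendsto_def L2_tendsto_const)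
qed

text \<open>Along an approximating sequence \<open>Q\<close> is \<open>s\<^sup>2\<close> plus
  \<open>c\<close> times the squared norm; in the limit the first part is the nonnegative number
  \<open>l\<^sup>2\<close>.\<close>

lemma friedrichs_ge: "op_ge M (friedrichs_extension M S) c"
  unfolding op_ge_def
proof (clarify)
  fix u w assume "(u, w) \<in> friedrichs_extension M S"
  then have u: "u \<in> L2 M" "\<exists>U. form_tendsto M Q U u"
    and uw: "snd (form_closure M Q) u u = L2_inner M u w"
    unfolding friedrichs_extension_def op_of_form_def by (auto simp: form_closure_def)
  obtain U where U: "form_tendsto M Q U u" using u(2) by blast
  note UD = form_tendsto_D[OF U]
  obtain l where l: "(\<lambda>n. s (U n)) \<longlonglongrightarrow> l"
    using form_tendsto_s_convergent[OF U u(1)] unfolding convergent_def by blast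
  have "(\<lambda>n. of_real ((s (U n))\<^sup>2) + of_real c * L2_inner M (U n) (U n)) \<longlonglongrightarrow>
      complex_of_real (l\<^sup>2) + of_real c * L2_inner M u u"
    using l L2_inner_tendsto[OF form_tendsto_L2[OF U] form_tendsto_L2[OF U] D_L2[OF UD] u(1) D_L2[OF UD] u(1)]
    by (intro tendsto_intros)
  then have "(\<lambda>n. snd Q (U n) (U n)) \<longlonglongrightarrow> complex_of_real (l\<^sup>2) + of_real c * L2_inner M u u"
    by (simp add: Q_t t_self[OF UD] del: of_real_power)
  from form_closure_value[OF U U u(1) u(1) this] uw
  have "L2_inner M u w = complex_of_real (l\<^sup>2) + of_real c * L2_inner M u u" by simp
  then show "c * Re (L2_inner M u u) \<le> Re (L2_inner M u w)" by (simp del: of_real_power)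
qed

text \<open>On \<open>D\<close> the form value of \<open>v\<close> and \<open>u\<close> is the inner
  product of \<open>v\<close> and \<open>w\<close>. An approximating sequence for \<open>v\<close>
  and the constant sequence for \<open>u\<close> carry this to the closed form.\<close>

lemma friedrichs_extends: "S \<subseteq> friedrichs_extension M S"
proof (clarify)
  fix u w assume uw: "(u, w) \<in> S"
  then have u: "u \<in> D" "u \<in> L2 M" "w \<in> L2 M" using S_L2 by auto
  show "(u, w) \<in> friedrichs_extension M S"
    unfolding friedrichs_extension_def op_of_form_def
  proof (intro CollectI case_prodI conjI ballI)
    show "u \<in> fst (form_closure M Q)" unfolding form_closure_def using form_tendsto_const[OF u(1)] u(2) by auto
    fix v assume "v \<in> fst (form_closure M Q)"
    then obtain V where v: "v \<in> L2 M" and V: "form_tendsto M Q V v" by (auto simp: form_closure_def)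
    note VD = form_tendsto_D[OF V]
    have "(\<lambda>n. snd Q (V n) u) \<longlonglongrightarrow> L2_inner M v w"
      using L2_inner_tendsto[OF form_tendsto_L2[OF V] L2_tendsto_const D_L2[OF VD] v u(3) u(3)]
      by (simp add: Q_eq[OF VD uw])
    with form_closure_value[OF V form_tendsto_const[OF u(1)] v u(2)]
    show "snd (form_closure M Q) v u = L2_inner M v w" by blast
  qed (rule u)
qed

end

text \<open>The bound rises to the extension through the closed form and descends by inclusion. In
  the descent the form theory is set up with whatever bound \<open>c\<close> exists, which may
  differ from \<open>l\<close>.\<close>

lemma (in symmetric_op) op_ge_iff_friedrichs_ge:
  "op_ge M S l \<longleftrightarrow> bounded_from_below M S \<and> op_ge M (friedrichs_extension M S) l"
proof
  assume "op_ge M S l"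
  then interpret semibounded_op M S l by unfold_locales
  show "bounded_from_below M S \<and> op_ge M (friedrichs_extension M S) l"
    using friedrichs_ge S_ge bounded_from_below_def by blast
next
  assume *: "bounded_from_below M S \<and> op_ge M (friedrichs_extension M S) l"
  then obtain c where "op_ge M S c" unfolding bounded_from_below_def by blast
  then interpret semibounded_op M S c by unfold_locales
  show "op_ge M S l" using * friedrichs_extends unfolding op_ge_def by blast
qed

section \<open>Lower bounds and symmetry under closure of the graph\<close>

lemma op_closure_subset:
  assumes "\<And>f g. (f, g) \<in> S \<Longrightarrow> f \<in> L2 M \<and> g \<in> L2 M"
  shows "S \<subseteq> op_closure M S"
proof (clarify)
  fix f g assume fg: "(f, g) \<in> S"
  then show "(f, g) \<in> op_closure M S"
    unfolding op_closure_def using assms[OF fg]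
    by (intro CollectI case_prodI conjI exI[of _ "\<lambda>_. f"] exI[of _ "\<lambda>_. g"] L2_tendsto_const) auto
qed

lemma op_closureE:
  assumes "(f, g) \<in> op_closure M S"
  obtains F G where "f \<in> L2 M" "g \<in> L2 M" "\<And>n. (F n, G n) \<in> S" "L2_tendsto M F f" "L2_tendsto M G g"
  using assms unfolding op_closure_def by blast

lemma op_ge_closure_iff:
  assumes S: "\<And>f g. (f, g) \<in> S \<Longrightarrow> f \<in> L2 M \<and> g \<in> L2 M"
  shows "op_ge M (op_closure M S) c \<longleftrightarrow> op_ge M S c"
proof
  assume "op_ge M (op_closure M S) c"
  then show "op_ge M S c" using op_closure_subset[of S M] S unfolding op_ge_def by blast
next
  assume ge: "op_ge M S c"
  show "op_ge M (op_closure M S) c"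
    unfolding op_ge_def
  proof (clarify)
    fix f g assume "(f, g) \<in> op_closure M S"
    then obtain F G where fg: "f \<in> L2 M" "g \<in> L2 M" "\<And>n. (F n, G n) \<in> S"
      and lim: "L2_tendsto M F f" "L2_tendsto M G g" by (rule op_closureE) blast
    have L: "F n \<in> L2 M" "G n \<in> L2 M" for n using S fg(3) by blast+
    have "(\<lambda>n. Re (L2_inner M (F n) (G n))) \<longlonglongrightarrow> Re (L2_inner M f g)"
      by (intro tendsto_Re L2_inner_tendsto lim L fg)
    moreover have "(\<lambda>n. c * Re (L2_inner M (F n) (F n))) \<longlonglongrightarrow> c * Re (L2_inner M f f)"
      by (intro tendsto_intros L2_inner_tendsto lim L fg)
    moreover have "c * Re (L2_inner M (F n) (F n)) \<le> Re (L2_inner M (F n) (G n))" for n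
      using ge fg(3)[of n] unfolding op_ge_def by blast
    ultimately show "c * Re (L2_inner M f f) \<le> Re (L2_inner M f g)"
      by (intro LIMSEQ_le) auto
  qed
qed

lemma L2_norm_cong_AE:
  assumes "f \<in> L2 M" "g \<in> L2 M" "AE x in M. f x = g x"
  shows "L2_norm M f = L2_norm M g"
  unfolding L2_norm_def
  by (intro arg_cong[of _ _ sqrt] integral_cong_AE) (use assms in \<open>auto simp: L2_def elim: eventually_mono\<close>)

text \<open>The operators to be closed apply \<open>SL_expr\<close>, which involves a chosen
  quasi-derivative and derivatives that exist only almost everywhere, so they are linear only up to
  null sets. The closure contains every representative and is linear in the strict sense.\<close>

lemma symmetric_op_closure:
  assumes S: "\<And>f g. (f, g) \<in> S \<Longrightarrow> f \<in> L2 M \<and> g \<in> L2 M"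
    and lin: "\<And>f g f' g' z. (f, g) \<in> S \<Longrightarrow> (f', g') \<in> S \<Longrightarrow>
      \<exists>h. (\<lambda>x. f x - z * f' x, h) \<in> S \<and> (AE x in M. h x = g x - z * g' x)"
    and sym: "\<And>f g f' g'. (f, g) \<in> S \<Longrightarrow> (f', g') \<in> S \<Longrightarrow> L2_inner M f g' = L2_inner M g f'"
  shows "symmetric_op M (op_closure M S)"
proof
  fix f g assume fg: "(f, g) \<in> op_closure M S"
  then show "f \<in> L2 M \<and> g \<in> L2 M" by (simp add: op_closure_def)
  obtain F G where f: "f \<in> L2 M" "g \<in> L2 M" "\<And>n. (F n, G n) \<in> S"
    and lim: "L2_tendsto M F f" "L2_tendsto M G g" using fg by (rule op_closureE) blast
  have L: "F n \<in> L2 M" "G n \<in> L2 M" for n using S f(3) by blast+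
  fix f' g' assume fg': "(f', g') \<in> op_closure M S"
  obtain F' G' where f': "f' \<in> L2 M" "g' \<in> L2 M" "\<And>n. (F' n, G' n) \<in> S"
    and lim': "L2_tendsto M F' f'" "L2_tendsto M G' g'" using fg' by (rule op_closureE) blast
  have L': "F' n \<in> L2 M" "G' n \<in> L2 M" for n using S f'(3) by blast+
  have "(\<lambda>n. L2_inner M (F n) (G' n)) \<longlonglongrightarrow> L2_inner M f g'"
    "(\<lambda>n. L2_inner M (G n) (F' n)) \<longlonglongrightarrow> L2_inner M g f'"
    by (intro L2_inner_tendsto lim lim' L L' f f')+
  then show "L2_inner M f g' = L2_inner M g f'"
    using sym[OF f(3) f'(3)] LIMSEQ_unique by simp
  fix z
  have "\<forall>n. \<exists>h. (\<lambda>x. F n x - z * F' n x, h) \<in> S \<and> (AE x in M. h x = G n x - z * G' n x)"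
    using lin[OF f(3) f'(3)] by blast
  then obtain H where H: "\<And>n. (\<lambda>x. F n x - z * F' n x, H n) \<in> S"
    "\<And>n. AE x in M. H n x = G n x - z * G' n x" by metis
  have HL: "H n \<in> L2 M" for n using S H(1) by blast
  have "L2_tendsto M (\<lambda>n x. G n x - z * G' n x) (\<lambda>x. g x - z * g' x)"
    by (intro L2_tendsto_diff lim lim' L L' f f')
  moreover have "L2_norm M (\<lambda>x. G n x - z * G' n x - (g x - z * g' x)) = L2_norm M (\<lambda>x. H n x - (g x - z * g' x))" for n
    using H(2)[of n] by (intro L2_norm_cong_AE L2_diff L2_lin HL L L' f f') (auto elim: eventually_mono)
  ultimately have limH: "L2_tendsto M H (\<lambda>x. g x - z * g' x)" by (simp add: L2_tendsto_iff)
  have limF: "L2_tendsto M (\<lambda>n x. F n x - z * F' n x) (\<lambda>x. f x - z * f' x)"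
    by (intro L2_tendsto_diff lim lim' L L' f f')
  show "(\<lambda>x. f x - z * f' x, \<lambda>x. g x - z * g' x) \<in> op_closure M S"
    unfolding op_closure_def
  proof (intro CollectI case_prodI conjI exI)
    show "\<forall>n. (\<lambda>x. F n x - z * F' n x, H n) \<in> S" using H(1) by blast
  qed (intro L2_lin f f' limF limH)+
qed

section \<open>Solutions as solutions of a first-order system\<close>

locale sturm_liouville =
  fixes J :: "real set" and p q r s :: "real \<Rightarrow> real"
  assumes open_J: "open J" and ivl_J: "is_interval J" and J_nonempty: "J \<noteq> {}"
    and r_meas: "r \<in> borel_measurable (lebesgue_on J)"
    and p_pos: "AE x in lebesgue_on J. p x > 0" and r_pos: "AE x in lebesgue_on J. r x > 0"
    and coeff: "(\<lambda>x. 1 / p x) \<in> L1_loc J" "q \<in> L1_loc J" "r \<in> L1_loc J" "s \<in> L1_loc J"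
begin

abbreviation "M \<equiv> SL_measure J r"

text \<open>\<open>f\<close> has quasi-derivative \<open>h\<close> and \<open>\<tau> f = w\<close>.\<close>

definition quasi_system :: "(real \<Rightarrow> complex) \<Rightarrow> (real \<Rightarrow> complex) \<Rightarrow> (real \<Rightarrow> complex) \<Rightarrow> bool" where
  "quasi_system f h w \<longleftrightarrow>
     ac_deriv J f (\<lambda>x. h x / of_real (p x) - of_real (s x) * f x) \<and>
     ac_deriv J h (\<lambda>x. of_real (s x) * h x + of_real (q x) * f x - of_real (r x) * w x)"

text \<open>Solving the definitions for the two derivatives uses that \<open>p\<close> and
  \<open>r\<close> are nonzero almost everywhere.\<close>

lemma SL_domain_quasi_system:
  assumes f: "f \<in> SL_domain J p s"
  shows "quasi_system f (quasi_deriv J p s f) (SL_expr J p q r s f)"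
proof -
  let ?h = "quasi_deriv J p s f"
  have fAC: "f \<in> AC_loc J" using f by (simp add: SL_domain_def)
  have h: "is_quasi_deriv J p s f ?h"
  proof -
    obtain h0 where "is_quasi_deriv J p s f h0" using f by (auto simp: SL_domain_def)
    then show ?thesis unfolding quasi_deriv_def by (rule someI[of "is_quasi_deriv J p s f"])
  qed
  then have hAC: "?h \<in> AC_loc J"
    and hAE: "AE x in lebesgue_on J. ?h x = of_real (p x) * (vector_derivative f (at x) + of_real (s x) * f x)"
    by (simp_all add: is_quasi_deriv_def)
  have "AE x in lebesgue_on J. vector_derivative f (at x) = ?h x / of_real (p x) - of_real (s x) * f x"
    using hAE p_pos by eventually_elim (simp add: field_simps)
  moreover have "AE x in lebesgue_on J. vector_derivative ?h (at x) =
      of_real (s x) * ?h x + of_real (q x) * f x - of_real (r x) * SL_expr J p q r s f x"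
    using r_pos by eventually_elim (simp add: SL_expr_def field_simps)
  ultimately show ?thesis
    unfolding quasi_system_def
    by (intro conjI ac_deriv_cong_AE[OF AC_loc_ac_deriv[OF fAC open_J]] ac_deriv_cong_AE[OF AC_loc_ac_deriv[OF hAC open_J]])
qed

lemma AE_in_J: "AE x in lebesgue_on J. x \<in> J"
  by (rule AE_lebesgue_onI)

lemma AE_ac_deriv_vector_derivative:
  assumes "ac_deriv J f g"
  shows "AE x in lebesgue_on J. vector_derivative f (at x) = g x"
proof -
  have "AE x in lebesgue_on J. (f has_vector_derivative g x) (at x)" using assms by (simp add: ac_deriv_def)
  then show ?thesis by eventually_elim (rule vector_derivative_at)
qed

text \<open>The choice in \<open>quasi_deriv\<close> need not return \<open>h\<close>, but both are
  continuous and agree almost everywhere, hence on all of \<open>J\<close>.\<close>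

lemma quasi_system_SL_domain:
  assumes sys: "quasi_system f h w"
  shows "f \<in> SL_domain J p s" "\<forall>x\<in>J. quasi_deriv J p s f x = h x"
    "AE x in lebesgue_on J. SL_expr J p q r s f x = w x"
proof -
  have f: "ac_deriv J f (\<lambda>x. h x / of_real (p x) - of_real (s x) * f x)"
    and h: "ac_deriv J h (\<lambda>x. of_real (s x) * h x + of_real (q x) * f x - of_real (r x) * w x)"
    using sys by (simp_all add: quasi_system_def)
  have AC: "f \<in> AC_loc J" "h \<in> AC_loc J" using f h by (simp_all add: ac_deriv_def)
  have hAE: "AE x in lebesgue_on J. h x = of_real (p x) * (vector_derivative f (at x) + of_real (s x) * f x)"
    using AE_ac_deriv_vector_derivative[OF f] p_pos by eventually_elim simp
  then have qd: "is_quasi_deriv J p s f h" using AC by (simp add: is_quasi_deriv_def)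
  then show dom: "f \<in> SL_domain J p s" using AC unfolding SL_domain_def by auto
  let ?h = "quasi_deriv J p s f"
  have "is_quasi_deriv J p s f ?h" unfolding quasi_deriv_def using qd by (rule someI[of "is_quasi_deriv J p s f"])
  then have h': "?h \<in> AC_loc J"
    "AE x in lebesgue_on J. ?h x = of_real (p x) * (vector_derivative f (at x) + of_real (s x) * f x)"
    by (simp_all add: is_quasi_deriv_def)
  have "AE x in lebesgue_on J. ?h x = h x" using hAE h'(2) by eventually_elim simp
  then show eq: "\<forall>x\<in>J. ?h x = h x" using AC_loc_AE_eq_imp_eq[OF h'(1) AC(2) open_J] by blast
  have "ac_deriv J ?h (\<lambda>x. of_real (s x) * h x + of_real (q x) * f x - of_real (r x) * w x)"
    by (rule ac_deriv_cong[OF h open_J]) (use eq in simp)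
  from AE_ac_deriv_vector_derivative[OF this] r_pos AE_in_J
  show "AE x in lebesgue_on J. SL_expr J p q r s f x = w x"
    by eventually_elim (simp add: SL_expr_def eq field_simps)
qed

text \<open>Eliminates the choice in \<open>quasi_deriv\<close>: from here on solutions are pairs
  that solve a linear first-order system.\<close>

lemma SL_solution_iff:
  "SL_solution J p q r s l u \<longleftrightarrow> (\<exists>v. quasi_system u v (\<lambda>x. l * u x))"
proof
  assume u: "SL_solution J p q r s l u"
  then have sys: "quasi_system u (quasi_deriv J p s u) (SL_expr J p q r s u)"
    by (intro SL_domain_quasi_system) (simp add: SL_solution_def)
  have AE: "AE x in lebesgue_on J. SL_expr J p q r s u x = l * u x" using u by (simp add: SL_solution_def)
  have "ac_deriv J (quasi_deriv J p s u)
      (\<lambda>x. of_real (s x) * quasi_deriv J p s u x + of_real (q x) * u x - of_real (r x) * (l * u x))"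
    by (rule ac_deriv_cong_AE[OF conjunct2[OF sys[unfolded quasi_system_def]]])
      (use AE in eventually_elim, simp)
  with sys show "\<exists>v. quasi_system u v (\<lambda>x. l * u x)" unfolding quasi_system_def by blast
next
  assume "\<exists>v. quasi_system u v (\<lambda>x. l * u x)"
  then show "SL_solution J p q r s l u"
    using quasi_system_SL_domain unfolding SL_solution_def by blast
qed

lemma quasi_system_continuous:
  assumes "quasi_system f h w"
  shows "continuous_on J f" "continuous_on J h"
  using assms ac_deriv_continuous_on open_J unfolding quasi_system_def by blast+

text \<open>\<open>r * w\<close> is what is left when the derivative of \<open>h\<close> is
  subtracted from the locally integrable terms with \<open>s\<close> and \<open>q\<close>.\<close>

lemma quasi_system_loc_integrable:
  assumes sys: "quasi_system f h w"
  shows "loc_integrable J (\<lambda>x. of_real (r x) * w x)"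
proof -
  note co = quasi_system_continuous[OF sys]
  have "loc_integrable J (\<lambda>x. of_real (s x) * h x + of_real (q x) * f x - of_real (r x) * w x)"
    using sys ac_deriv_loc_integrable open_J unfolding quasi_system_def by blast
  moreover have "loc_integrable J (\<lambda>x. h x * of_real (s x) + f x * of_real (q x))"
    by (intro loc_integrable_add loc_integrable_mult co loc_integrable_of_real coeff)
  ultimately have "loc_integrable J (\<lambda>x. (h x * of_real (s x) + f x * of_real (q x)) -
      (of_real (s x) * h x + of_real (q x) * f x - of_real (r x) * w x))"
    by (rule loc_integrable_diff[rotated])
  then show ?thesis by (simp add: mult.commute)
qed

lemma quasi_system_lin:
  assumes 1: "quasi_system f h w" and 2: "quasi_system f' h' w'"
  shows "quasi_system (\<lambda>x. f x - z * f' x) (\<lambda>x. h x - z * h' x) (\<lambda>x. w x - z * w' x)"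
proof -
  have "ac_deriv J (\<lambda>x. f x - z * f' x) (\<lambda>x. (h x / of_real (p x) - of_real (s x) * f x) -
      z * (h' x / of_real (p x) - of_real (s x) * f' x))"
    using 1 2 unfolding quasi_system_def by (intro ac_deriv_diff ac_deriv_cmult open_J) auto
  moreover have "ac_deriv J (\<lambda>x. h x - z * h' x)
     (\<lambda>x. (of_real (s x) * h x + of_real (q x) * f x - of_real (r x) * w x) -
      z * (of_real (s x) * h' x + of_real (q x) * f' x - of_real (r x) * w' x))"
    using 1 2 unfolding quasi_system_def by (intro ac_deriv_diff ac_deriv_cmult open_J) auto
  ultimately show ?thesis unfolding quasi_system_def by (simp add: algebra_simps diff_divide_distrib)
qed

section \<open>The minimal operator\<close>

definition pre_min :: "real l2_op" where
  "pre_min = {(f, g) \<in> SL_max J p q r s. \<exists>K. compact K \<and> K \<subseteq> J \<and> (\<forall>x\<in>J - K. f x = 0)}"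

lemma SL_min_eq: "SL_min J p q r s = op_closure M pre_min"
  by (simp add: SL_min_def pre_min_def)

lemma J_lebesgue: "J \<in> sets lebesgue"
  using borel_open[OF open_J] by simp

lemma AE_M: "(AE x in lebesgue_on J. P x) \<Longrightarrow> (AE x in M. P x)"
  unfolding SL_measure_def by (subst AE_density) (use r_meas in \<open>auto elim: eventually_mono\<close>)

lemma measurable_M: "f \<in> borel_measurable (lebesgue_on J) \<Longrightarrow> f \<in> borel_measurable M"
  by (simp add: SL_measure_def)

text \<open>Passes from the weighted measure on \<open>J\<close> to an integral over a compact
  interval outside of which the integrand vanishes.\<close>

lemma M_integral:
  fixes u :: "real \<Rightarrow> complex"
  assumes cd: "{c..d} \<subseteq> J" and zero: "\<And>x. x \<in> J - {c..d} \<Longrightarrow> u x = 0"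
    and u: "u \<in> borel_measurable M" and int: "(\<lambda>x. of_real (r x) * u x) absolutely_integrable_on {c..d}"
  shows "integrable M u" "(LINT x|M. u x) = integral {c..d} (\<lambda>x. of_real (r x) * u x)"
proof -
  have um: "u \<in> borel_measurable (lebesgue_on J)" using u by (simp add: SL_measure_def)
  have r0: "AE x in lebesgue_on J. 0 \<le> r x" using r_pos by eventually_elim simp
  have eq: "indicator J x *\<^sub>R (r x *\<^sub>R u x) = indicator {c..d} x *\<^sub>R (of_real (r x) * u x)" for x
    using zero[of x] cd by (auto simp: indicator_def scaleR_conv_of_real)
  have "integrable lebesgue (\<lambda>x. indicator J x *\<^sub>R (r x *\<^sub>R u x))"
    unfolding eq using int by (simp add: set_integrable_def)
  then have "integrable (lebesgue_on J) (\<lambda>x. r x *\<^sub>R u x)"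
    using J_lebesgue by (subst integrable_restrict_space) auto
  then show "integrable M u"
    unfolding SL_measure_def by (subst integrable_density[OF um r_meas r0])
  have "(LINT x|M. u x) = (LINT x|lebesgue_on J. r x *\<^sub>R u x)"
    unfolding SL_measure_def by (rule integral_density[OF um r_meas r0])
  also have "\<dots> = (LINT x|lebesgue. indicator J x *\<^sub>R (r x *\<^sub>R u x))"
    using J_lebesgue by (subst integral_restrict_space) auto
  also have "\<dots> = integral {c..d} (\<lambda>x. of_real (r x) * u x)"
    unfolding eq using set_lebesgue_integral_eq_integral(2)[OF int] by (simp add: set_lebesgue_integral_def)
  finally show "(LINT x|M. u x) = integral {c..d} (\<lambda>x. of_real (r x) * u x)" .
qed

lemma compact_subset_interval:
  assumes K: "compact K" "K \<subseteq> J"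
  obtains c d where "c < d" "{c..d} \<subseteq> J" "K \<subseteq> {c<..<d}"
proof -
  obtain x0 where x0: "x0 \<in> J" using J_nonempty by blast
  \<comment> \<open>Inserting a point of \<open>J\<close> covers the case of empty
    \<open>K\<close>.\<close>
  let ?K = "insert x0 K"
  have cK: "compact ?K" using K by simp
  obtain m where m: "m \<in> ?K" "\<And>x. x \<in> ?K \<Longrightarrow> m \<le> x" using compact_attains_inf[OF cK] by auto
  obtain m' where m': "m' \<in> ?K" "\<And>x. x \<in> ?K \<Longrightarrow> x \<le> m'" using compact_attains_sup[OF cK] by auto
  have "m \<in> J" "m' \<in> J" using m m' K x0 by auto
  obtain c c' where c: "c < m" "m < c'" "{c..c'} \<subseteq> J" using open_interval_around[OF open_J \<open>m \<in> J\<close>] .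
  obtain d' d where d: "d' < m'" "m' < d" "{d'..d} \<subseteq> J" using open_interval_around[OF open_J \<open>m' \<in> J\<close>] .
  have "c \<in> J" "d \<in> J" using c d by auto
  from interval_subset[OF ivl_J this] have "{c..d} \<subseteq> J" .
  moreover have "c < d" using c d m(2)[OF m'(1)] by linarith
  moreover have "K \<subseteq> {c<..<d}"
  proof
    fix x assume "x \<in> K"
    then have "m \<le> x" "x \<le> m'" using m(2) m'(2) by auto
    then show "x \<in> {c<..<d}" using c(1) d(2) by simp
  qed
  ultimately show ?thesis using that[of c d] by blast
qed

lemma pre_minD:
  assumes "(f, g) \<in> pre_min"
  shows "f \<in> L2 M" "g \<in> L2 M" "g = SL_expr J p q r s f" "quasi_system f (quasi_deriv J p s f) g"
    "\<exists>K. compact K \<and> K \<subseteq> J \<and> (\<forall>x\<in>J - K. f x = 0)"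
  using assms SL_domain_quasi_system unfolding pre_min_def SL_max_def by auto

lemma pre_min_interval:
  assumes f: "(f, g) \<in> pre_min" and f': "(f', g') \<in> pre_min"
  obtains c d where "c < d" "{c..d} \<subseteq> J" "\<forall>x\<in>J - {c<..<d}. f x = 0" "\<forall>x\<in>J - {c<..<d}. f' x = 0"
proof -
  obtain K where K: "compact K" "K \<subseteq> J" "\<forall>x\<in>J - K. f x = 0" using pre_minD(5)[OF f] by blast
  obtain K' where K': "compact K'" "K' \<subseteq> J" "\<forall>x\<in>J - K'. f' x = 0" using pre_minD(5)[OF f'] by blast
  obtain c d where cd: "c < d" "{c..d} \<subseteq> J" "K \<union> K' \<subseteq> {c<..<d}"
    using compact_subset_interval[of "K \<union> K'"] K K' by (metis Un_least compact_Un)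
  have "\<forall>x\<in>J - {c<..<d}. f x = 0" "\<forall>x\<in>J - {c<..<d}. f' x = 0" using cd(3) K(3) K'(3) by auto
  then show ?thesis by (rule that[OF cd(1,2)])
qed

lemma pre_min_inner:
  assumes f: "(f, g) \<in> pre_min" and f': "(f', g') \<in> pre_min"
    and cd: "{c..d} \<subseteq> J" and zero: "\<And>x. x \<in> J - {c<..<d} \<Longrightarrow> f x = 0"
  shows "L2_inner M f f' = integral {c..d} (\<lambda>x. of_real (r x) * (cnj (f x) * f' x))"
    "L2_inner M f g' = integral {c..d} (\<lambda>x. of_real (r x) * (cnj (f x) * g' x))"
    "(\<lambda>x. of_real (r x) * (cnj (f x) * f' x)) absolutely_integrable_on {c..d}"
    "(\<lambda>x. of_real (r x) * (cnj (f x) * g' x)) absolutely_integrable_on {c..d}"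
proof -
  note sys = pre_minD(4)[OF f] and sys' = pre_minD(4)[OF f']
  note co = quasi_system_continuous[OF sys] and co' = quasi_system_continuous[OF sys']
  have meas: "(\<lambda>x. cnj (f x) * f' x) \<in> borel_measurable M" "(\<lambda>x. cnj (f x) * g' x) \<in> borel_measurable M"
    using L2_integrable_mult[OF pre_minD(1)[OF f] pre_minD(1)[OF f']]
      L2_integrable_mult[OF pre_minD(1)[OF f] pre_minD(2)[OF f']] by auto
  have "loc_integrable J (\<lambda>x. (cnj (f x) * f' x) * of_real (r x))"
    by (intro loc_integrable_mult continuous_intros co co' loc_integrable_of_real coeff)
  then show i1: "(\<lambda>x. of_real (r x) * (cnj (f x) * f' x)) absolutely_integrable_on {c..d}"
    using loc_integrableD cd by (simp add: mult.commute)
  have "loc_integrable J (\<lambda>x. cnj (f x) * (of_real (r x) * g' x))"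
    by (intro loc_integrable_mult continuous_intros co quasi_system_loc_integrable[OF sys'])
  then show i2: "(\<lambda>x. of_real (r x) * (cnj (f x) * g' x)) absolutely_integrable_on {c..d}"
    using loc_integrableD cd by (simp add: mult.left_commute)
  show "L2_inner M f f' = integral {c..d} (\<lambda>x. of_real (r x) * (cnj (f x) * f' x))"
    unfolding L2_inner_def by (rule M_integral(2)[OF cd _ meas(1) i1]) (use zero in auto)
  show "L2_inner M f g' = integral {c..d} (\<lambda>x. of_real (r x) * (cnj (f x) * g' x))"
    unfolding L2_inner_def by (rule M_integral(2)[OF cd _ meas(2) i2]) (use zero in auto)
qed

lemma ac_deriv_boundary_zero:
  assumes "ac_deriv J f g" "{c..d} \<subseteq> J" "c \<le> d" "f c = 0" "f d = 0"
  shows "integral {c..d} g = 0"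
  using ac_deriv_integral(2)[OF assms(1) open_J assms(2,3)] assms(4,5) by (simp add: integral_unique)

text \<open>Lagrange's identity: \<open>cnj (f x) * ?h' x - cnj (?h x) * f' x\<close>, where the
  prime marks the second function, has derivative \<open>r * (cnj g * f' - cnj f * g')\<close>. It
  vanishes at both ends because \<open>f\<close> and \<open>f'\<close> do.\<close>

lemma pre_min_sym:
  assumes f: "(f, g) \<in> pre_min" and f': "(f', g') \<in> pre_min"
  shows "L2_inner M f g' = L2_inner M g f'"
proof -
  obtain c d where cd: "c < d" "{c..d} \<subseteq> J"
    and "\<forall>x\<in>J - {c<..<d}. f x = 0" "\<forall>x\<in>J - {c<..<d}. f' x = 0"
    using pre_min_interval[OF f f'] .
  note zero = this(3,4)[rule_format]
  let ?h = "quasi_deriv J p s f" and ?h' = "quasi_deriv J p s f'"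
  have f1: "ac_deriv J f (\<lambda>x. ?h x / of_real (p x) - of_real (s x) * f x)"
    and h1: "ac_deriv J ?h (\<lambda>x. of_real (s x) * ?h x + of_real (q x) * f x - of_real (r x) * g x)"
    using pre_minD(4)[OF f] by (simp_all add: quasi_system_def)
  have f2: "ac_deriv J f' (\<lambda>x. ?h' x / of_real (p x) - of_real (s x) * f' x)"
    and h2: "ac_deriv J ?h' (\<lambda>x. of_real (s x) * ?h' x + of_real (q x) * f' x - of_real (r x) * g' x)"
    using pre_minD(4)[OF f'] by (simp_all add: quasi_system_def)
  have "ac_deriv J (\<lambda>x. cnj (f x) * ?h' x - cnj (?h x) * f' x)
      (\<lambda>x. (cnj (f x) * (of_real (s x) * ?h' x + of_real (q x) * f' x - of_real (r x) * g' x) +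
            cnj (?h x / of_real (p x) - of_real (s x) * f x) * ?h' x) -
           (cnj (?h x) * (?h' x / of_real (p x) - of_real (s x) * f' x) +
            cnj (of_real (s x) * ?h x + of_real (q x) * f x - of_real (r x) * g x) * f' x))"
    by (intro ac_deriv_diff ac_deriv_mult ac_deriv_cnj f1 f2 h1 h2 open_J)
  also have "(\<lambda>x. (cnj (f x) * (of_real (s x) * ?h' x + of_real (q x) * f' x - of_real (r x) * g' x) +
            cnj (?h x / of_real (p x) - of_real (s x) * f x) * ?h' x) -
           (cnj (?h x) * (?h' x / of_real (p x) - of_real (s x) * f' x) +
            cnj (of_real (s x) * ?h x + of_real (q x) * f x - of_real (r x) * g x) * f' x)) =
      (\<lambda>x. of_real (r x) * (cnj (g x) * f' x) - of_real (r x) * (cnj (f x) * g' x))"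
    by (simp add: algebra_simps)
  finally have der: "ac_deriv J (\<lambda>x. cnj (f x) * ?h' x - cnj (?h x) * f' x)
      (\<lambda>x. of_real (r x) * (cnj (g x) * f' x) - of_real (r x) * (cnj (f x) * g' x))" .
  have "c \<in> J - {c<..<d}" "d \<in> J - {c<..<d}" using cd by auto
  then have c0: "f c = 0" "f' c = 0" "f d = 0" "f' d = 0" by (simp_all only: zero)
  have "integral {c..d} (\<lambda>x. of_real (r x) * (cnj (g x) * f' x) - of_real (r x) * (cnj (f x) * g' x)) = 0"
    by (rule ac_deriv_boundary_zero[OF der cd(2) less_imp_le[OF cd(1)]]) (simp_all add: c0)
  have i2: "(\<lambda>x. of_real (r x) * (cnj (f x) * g' x)) absolutely_integrable_on {c..d}"
    using pre_min_inner(4)[OF f f' cd(2) zero(1)] .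
  have "L2_inner M g f' = cnj (L2_inner M f' g)" by (rule L2_inner_cnj)
  also have "\<dots> = cnj (integral {c..d} (\<lambda>x. of_real (r x) * (cnj (f' x) * g x)))"
    using pre_min_inner(2)[OF f' f cd(2) zero(2)] by simp
  also have "\<dots> = integral {c..d} (\<lambda>x. cnj (of_real (r x) * (cnj (f' x) * g x)))"
    using integral_linear[OF set_lebesgue_integral_eq_integral(1)[OF pre_min_inner(4)[OF f' f cd(2) zero(2)]] bounded_linear_cnj]
    by (simp add: o_def)
  also have "(\<lambda>x. cnj (of_real (r x) * (cnj (f' x) * g x))) = (\<lambda>x. of_real (r x) * (cnj (g x) * f' x))"
    by (simp add: mult_ac)
  finally have gf: "L2_inner M g f' = integral {c..d} (\<lambda>x. of_real (r x) * (cnj (g x) * f' x))" .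
  have "((\<lambda>x. cnj (of_real (r x) * (cnj (f' x) * g x))) absolutely_integrable_on {c..d})"
    using absolutely_integrable_linear[OF pre_min_inner(4)[OF f' f cd(2) zero(2)] bounded_linear_cnj] by (simp add: o_def)
  then have i1: "(\<lambda>x. of_real (r x) * (cnj (g x) * f' x)) absolutely_integrable_on {c..d}"
    by (simp add: mult_ac)
  have "0 = integral {c..d} (\<lambda>x. of_real (r x) * (cnj (g x) * f' x)) - integral {c..d} (\<lambda>x. of_real (r x) * (cnj (f x) * g' x))"
    using \<open>integral {c..d} _ = 0\<close> integral_diff[OF set_lebesgue_integral_eq_integral(1)[OF i1] set_lebesgue_integral_eq_integral(1)[OF i2]]
    by simp
  then show ?thesis using gf pre_min_inner(2)[OF f f' cd(2) zero(1)] by simp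
qed

text \<open>\<open>SL_expr\<close> agrees with \<open>w\<close> only almost everywhere; completeness
  of Lebesgue measure makes it measurable, and square-integrability carries over from
  \<open>w\<close>.\<close>

lemma pre_min_I:
  assumes sys: "quasi_system f h w" and f: "f \<in> L2 M" and w: "w \<in> L2 M"
    and K: "compact K" "K \<subseteq> J" "\<And>x. x \<in> J - K \<Longrightarrow> f x = 0"
  shows "(f, SL_expr J p q r s f) \<in> pre_min \<and> (AE x in M. SL_expr J p q r s f x = w x)"
proof -
  have AE: "AE x in lebesgue_on J. SL_expr J p q r s f x = w x"
    and dom: "f \<in> SL_domain J p s" using quasi_system_SL_domain[OF sys] by auto
  have wm: "w \<in> borel_measurable (lebesgue_on J)" using w by (simp add: L2_def SL_measure_def)
  have "(\<lambda>x. if x \<in> J then w x else 0) \<in> borel_measurable lebesgue"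
    using wm J_lebesgue by (simp add: borel_measurable_if)
  moreover have "AE x in lebesgue. x \<in> J \<longrightarrow> SL_expr J p q r s f x = w x"
    using AE J_lebesgue by (simp add: AE_restrict_space_iff)
  then have "AE x in lebesgue. (if x \<in> J then w x else 0) = (if x \<in> J then SL_expr J p q r s f x else 0)"
    by eventually_elim simp
  ultimately have "(\<lambda>x. if x \<in> J then SL_expr J p q r s f x else 0) \<in> borel_measurable lebesgue"
    by (rule borel_measurable_AE)
  then have "SL_expr J p q r s f \<in> borel_measurable (lebesgue_on J)"
    using J_lebesgue by (simp add: borel_measurable_if)
  then have m: "SL_expr J p q r s f \<in> borel_measurable M" by (rule measurable_M)
  have wM: "w \<in> borel_measurable M" using w by (simp add: L2_def)
  have AEM: "AE x in M. SL_expr J p q r s f x = w x" using AE by (rule AE_M)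
  have "integrable M (\<lambda>x. (norm (SL_expr J p q r s f x))\<^sup>2)"
  proof (rule integrable_cong_AE_imp[of _ "\<lambda>x. (norm (w x))\<^sup>2"])
    show "integrable M (\<lambda>x. (norm (w x))\<^sup>2)" using w by (simp add: L2_def)
    show "(\<lambda>x. (norm (SL_expr J p q r s f x))\<^sup>2) \<in> borel_measurable M" using m by measurable
    show "AE x in M. (norm (w x))\<^sup>2 = (norm (SL_expr J p q r s f x))\<^sup>2" using AEM by eventually_elim simp
  qed
  then have "SL_expr J p q r s f \<in> L2 M" using m by (simp add: L2_def)
  then show ?thesis using AEM f dom K unfolding pre_min_def SL_max_def by auto
qed

lemma pre_min_lin:
  assumes f: "(f, g) \<in> pre_min" and f': "(f', g') \<in> pre_min"
  shows "\<exists>h. (\<lambda>x. f x - z * f' x, h) \<in> pre_min \<and> (AE x in M. h x = g x - z * g' x)"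
proof -
  obtain c d where cd: "c < d" "{c..d} \<subseteq> J"
    and "\<forall>x\<in>J - {c<..<d}. f x = 0" "\<forall>x\<in>J - {c<..<d}. f' x = 0"
    using pre_min_interval[OF f f'] .
  note zero = this(3,4)[rule_format]
  have "quasi_system (\<lambda>x. f x - z * f' x) (\<lambda>x. quasi_deriv J p s f x - z * quasi_deriv J p s f' x) (\<lambda>x. g x - z * g' x)"
    by (intro quasi_system_lin pre_minD(4) f f')
  moreover have "(\<lambda>x. f x - z * f' x) \<in> L2 M" "(\<lambda>x. g x - z * g' x) \<in> L2 M"
    by (intro L2_lin pre_minD(1,2)[OF f] pre_minD(1,2)[OF f'])+
  moreover have "f x - z * f' x = 0" if "x \<in> J - {c..d}" for x
  proof -
    have "x \<in> J - {c<..<d}" using that by auto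
    then show ?thesis by (simp only: zero) simp
  qed
  ultimately show ?thesis
    by (intro exI, rule pre_min_I[OF _ _ _ compact_Icc cd(2)])
qed

lemma symmetric_op_SL_min: "symmetric_op M (SL_min J p q r s)"
  unfolding SL_min_eq
  by (rule symmetric_op_closure[OF _ pre_min_lin pre_min_sym]) (use pre_minD(1,2) in blast)+

lemma op_ge_SL_min_iff: "op_ge M (SL_min J p q r s) c \<longleftrightarrow> op_ge M pre_min c"
  unfolding SL_min_eq by (rule op_ge_closure_iff) (use pre_minD(1,2) in blast)

section \<open>A positive solution bounds the operator from below\<close>

text \<open>Where \<open>p > 0\<close> the quasi-derivative is determined by the values and the
  derivative of \<open>u\<close>, which are real; this gives the claim almost everywhere, and
  continuity gives it everywhere.\<close>

lemma real_solution_quasi_deriv_real: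
  assumes sys: "quasi_system u v w" and u: "\<And>x. x \<in> J \<Longrightarrow> cnj (u x) = u x" and x: "x \<in> J"
  shows "cnj (v x) = v x"
proof -
  have u1: "ac_deriv J u (\<lambda>x. v x / of_real (p x) - of_real (s x) * u x)"
    and v1: "v \<in> AC_loc J" using sys by (simp_all add: quasi_system_def ac_deriv_def)
  have "ac_deriv J (\<lambda>x. cnj (u x)) (\<lambda>x. cnj (v x / of_real (p x) - of_real (s x) * u x))"
    using u1 by (rule ac_deriv_cnj)
  then have "ac_deriv J u (\<lambda>x. cnj (v x / of_real (p x) - of_real (s x) * u x))"
    by (rule ac_deriv_cong[OF _ open_J u])
  from ac_deriv_unique[OF this u1] p_pos AE_in_J
  have AE: "AE x in lebesgue_on J. cnj (v x) = v x"
    by eventually_elim (simp add: u)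
  have "ac_deriv J v (\<lambda>x. vector_derivative v (at x))" using AC_loc_ac_deriv[OF v1 open_J] .
  from ac_deriv_cnj[OF this] have "(\<lambda>x. cnj (v x)) \<in> AC_loc J" by (simp add: ac_deriv_def)
  then show ?thesis using AC_loc_AE_eq_imp_eq[OF _ v1 open_J AE x] by simp
qed

text \<open>Jacobi's factorization: with \<open>H = f\<^sup>[\<^sup>1\<^sup>] - (v / u) f\<close> one has
  \<open>(cnj f H)' = |H|\<^sup>2 / p - r cnj f (\<tau> - l) f\<close>.\<close>

lemma positive_solution_imp_op_ge:
  assumes sys: "quasi_system u v (\<lambda>x. of_real l * u x)"
    and u: "\<And>x. x \<in> J \<Longrightarrow> u x \<in> \<real> \<and> Re (u x) > 0"
  shows "op_ge M pre_min l"
  unfolding op_ge_def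
proof (clarify)
  fix f g assume fg: "(f, g) \<in> pre_min"
  obtain c d where cd: "c < d" "{c..d} \<subseteq> J" and "\<forall>x\<in>J - {c<..<d}. f x = 0"
    using pre_min_interval[OF fg fg] by metis
  note zero = this(3)[rule_format]
  let ?h = "quasi_deriv J p s f"
  have f1: "ac_deriv J f (\<lambda>x. ?h x / of_real (p x) - of_real (s x) * f x)"
    and h1: "ac_deriv J ?h (\<lambda>x. of_real (s x) * ?h x + of_real (q x) * f x - of_real (r x) * g x)"
    using pre_minD(4)[OF fg] by (simp_all add: quasi_system_def)
  have u1: "ac_deriv J u (\<lambda>x. v x / of_real (p x) - of_real (s x) * u x)"
    and v1: "ac_deriv J v (\<lambda>x. of_real (s x) * v x + of_real (q x) * u x - of_real (r x) * (of_real l * u x))"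
    using sys by (simp_all add: quasi_system_def)
  have u0: "u x \<noteq> 0" if "x \<in> J" for x using u[OF that] by auto
  have ur: "cnj (u x) = u x" if "x \<in> J" for x using u[OF that] by (simp add: Reals_cnj_iff)
  have vr: "cnj (v x) = v x" if "x \<in> J" for x using real_solution_quasi_deriv_real[OF sys ur that] .
  define H where "H = (\<lambda>x. ?h x - (v x * inverse (u x)) * f x)"
  let ?dH = "\<lambda>x. (of_real (s x) * ?h x + of_real (q x) * f x - of_real (r x) * g x) -
      ((v x * inverse (u x)) * (?h x / of_real (p x) - of_real (s x) * f x) +
       (v x * (- (v x / of_real (p x) - of_real (s x) * u x) / (u x)\<^sup>2) +
        (of_real (s x) * v x + of_real (q x) * u x - of_real (r x) * (of_real l * u x)) * inverse (u x)) * f x)"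
  have H1: "ac_deriv J H ?dH"
    unfolding H_def by (intro ac_deriv_diff ac_deriv_mult ac_deriv_inverse f1 h1 u1 v1 open_J u0)
  have "ac_deriv J (\<lambda>x. cnj (f x) * H x)
      (\<lambda>x. cnj (f x) * ?dH x + cnj (?h x / of_real (p x) - of_real (s x) * f x) * H x)"
    by (intro ac_deriv_mult ac_deriv_cnj f1 H1 open_J)
  moreover have "AE x in lebesgue_on J. cnj (f x) * ?dH x + cnj (?h x / of_real (p x) - of_real (s x) * f x) * H x =
      of_real ((norm (H x))\<^sup>2 / p x) - (of_real (r x) * (cnj (f x) * g x) - of_real l * (of_real (r x) * (cnj (f x) * f x)))"
    using p_pos AE_in_J
  proof eventually_elim
    case (elim x)
    \<comment> \<open>\<open>\<phi>\<close> is the Riccati variable of the solution. Its equation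
      turns the derivative of \<open>H\<close> into a multiple of \<open>H\<close> plus the source
      term; as \<open>\<phi>\<close> is real, only the square and the source survive in the product
      with \<open>cnj f\<close>.\<close>
    define \<phi> where "\<phi> = v x / u x"
    have \<phi>r: "cnj \<phi> = \<phi>" using ur vr elim by (simp add: \<phi>_def)
    have v: "v x = \<phi> * u x" using u0 elim by (simp add: \<phi>_def)
    have Hx: "H x = ?h x - \<phi> * f x" by (simp add: H_def \<phi>_def divide_inverse)
    have pn: "complex_of_real (p x) \<noteq> 0" using elim by simp
    have un: "u x \<noteq> 0" using u0 elim by simp
    have dH: "?dH x = (of_real (s x) - \<phi> / of_real (p x)) * H x - (of_real (r x) * g x - of_real l * (of_real (r x) * f x))"
      unfolding Hx v using pn un by (simp add: field_simps power2_eq_square)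
    have ch: "cnj (?h x / of_real (p x) - of_real (s x) * f x) = cnj (H x) / of_real (p x) + (\<phi> / of_real (p x) - of_real (s x)) * cnj (f x)"
      unfolding Hx using pn \<phi>r by (simp add: field_simps)
    have nH: "complex_of_real ((norm (H x))\<^sup>2 / p x) = cnj (H x) * H x / of_real (p x)"
      using complex_norm_square[of "H x"] by (simp add: mult.commute)
    show ?case unfolding dH ch nH using pn by (simp add: field_simps)
  qed
  ultimately have der: "ac_deriv J (\<lambda>x. cnj (f x) * H x) (\<lambda>x. of_real ((norm (H x))\<^sup>2 / p x) -
      (of_real (r x) * (cnj (f x) * g x) - of_real l * (of_real (r x) * (cnj (f x) * f x))))"
    by (rule ac_deriv_cong_AE)
  have "c \<in> J - {c<..<d}" "d \<in> J - {c<..<d}" using cd by auto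
  then have c0: "f c = 0" "f d = 0" by (simp_all only: zero)
  have I0: "integral {c..d} (\<lambda>x. of_real ((norm (H x))\<^sup>2 / p x) -
      (of_real (r x) * (cnj (f x) * g x) - of_real l * (of_real (r x) * (cnj (f x) * f x)))) = 0"
    by (rule ac_deriv_boundary_zero[OF der cd(2) less_imp_le[OF cd(1)]]) (simp_all add: c0)
  note inn = pre_min_inner[OF fg fg cd(2) zero]
  note int = inn(3,4)[THEN set_lebesgue_integral_eq_integral(1)]
  have ip: "(\<lambda>x. complex_of_real ((norm (H x))\<^sup>2 / p x)) integrable_on {c..d}"
  proof -
    have "(\<lambda>x. of_real ((norm (H x))\<^sup>2 / p x) -
      (of_real (r x) * (cnj (f x) * g x) - of_real l * (of_real (r x) * (cnj (f x) * f x)))) integrable_on {c..d}"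
      using ac_deriv_integral(2)[OF der open_J cd(2) less_imp_le[OF cd(1)]] by blast
    from integrable_add[OF this integrable_diff[OF int(2) integrable_on_cmult_left[OF int(1), of "of_real l"]]]
    show ?thesis by simp
  qed
  have "Re (integral {c..d} (\<lambda>x. complex_of_real ((norm (H x))\<^sup>2 / p x))) \<ge> 0"
  proof -
    \<comment> \<open>Positivity of \<open>p\<close> holds only almost everywhere, so the integrand
      is replaced by 0 elsewhere before its sign is used.\<close>
    let ?g = "\<lambda>x. if p x > 0 then (norm (H x))\<^sup>2 / p x else 0"
    have neg: "negligible {x\<in>J. \<not> p x > 0}" using p_pos by (simp add: AE_lebesgue_on_open_iff[OF open_J])
    have "Re (integral {c..d} (\<lambda>x. complex_of_real ((norm (H x))\<^sup>2 / p x))) = integral {c..d} (\<lambda>x. (norm (H x))\<^sup>2 / p x)"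
      using integral_linear[OF ip bounded_linear_Re] by (simp add: o_def del: of_real_divide of_real_power)
    also have "\<dots> = integral {c..d} ?g"
      by (rule integral_spike[OF neg]) (use cd(2) in auto)
    also have "\<dots> \<ge> 0"
    proof (cases "?g integrable_on {c..d}")
      case True then show ?thesis by (rule integral_nonneg) simp
    qed (simp add: not_integrable_integral)
    finally show ?thesis .
  qed
  moreover have "integral {c..d} (\<lambda>x. complex_of_real ((norm (H x))\<^sup>2 / p x)) - (L2_inner M f g - of_real l * L2_inner M f f) = 0"
  proof -
    let ?A = "\<lambda>x. complex_of_real ((norm (H x))\<^sup>2 / p x)" and ?B = "\<lambda>x. of_real (r x) * (cnj (f x) * g x)"
      and ?C = "\<lambda>x. of_real (r x) * (cnj (f x) * f x)"
    have "((\<lambda>x. ?A x - (?B x - of_real l * ?C x)) has_integral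
        integral {c..d} ?A - (integral {c..d} ?B - of_real l * integral {c..d} ?C)) {c..d}"
      by (intro has_integral_diff has_integral_mult_right integrable_integral ip int)
    from integral_unique[OF this] I0
    have "integral {c..d} ?A - (integral {c..d} ?B - of_real l * integral {c..d} ?C) = 0" by (simp only:)
    then show ?thesis using inn(1,2) by simp
  qed
  ultimately have "Re (L2_inner M f g - of_real l * L2_inner M f f) \<ge> 0" by simp
  then show "l * Re (L2_inner M f f) \<le> Re (L2_inner M f g)" by simp
qed

end

section \<open>Zeros of solutions\<close>

lemma L1_loc_cmult: "g \<in> L1_loc J \<Longrightarrow> (\<lambda>x. c * g x) \<in> L1_loc J"
  unfolding L1_loc_def by (auto intro!: set_integrable_mult_right)

lemma L1_loc_diff: "f \<in> L1_loc J \<Longrightarrow> g \<in> L1_loc J \<Longrightarrow> (\<lambda>x. f x - g x) \<in> L1_loc J"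
  unfolding L1_loc_def by (auto intro!: set_integral_diff(1))

lemma oint_of_real_ac_deriv:
  fixes g :: "real \<Rightarrow> real"
  assumes J: "open J" "is_interval J" "x0 \<in> J" and g: "g \<in> L1_loc J"
  shows "ac_deriv J (\<lambda>x. of_real (oint x0 x g)) (\<lambda>x. of_real (g x))"
proof (rule ac_derivI[OF J(1) loc_integrable_of_real[OF g]])
  have gi: "g integrable_on {u..v}" if "{u..v} \<subseteq> J" for u v
    using g that unfolding L1_loc_def by (auto intro: set_lebesgue_integral_eq_integral(1))
  fix u v assume uv: "{u..v} \<subseteq> J" "u \<le> v"
  have "oint x0 v g - oint x0 u g = integral {u..v} g"
    by (rule oint_diff[OF J(2,3) _ _ _ gi]) (use uv in auto)
  then show "of_real (oint x0 v g) - of_real (oint x0 u g) = integral {u..v} (\<lambda>t. complex_of_real (g t))"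
    using integral_linear[OF gi[OF uv(1)] bounded_linear_of_real, unfolded o_def] by (metis of_real_diff)
qed

text \<open>\<open>h\<close> differs from \<open>g\<close> on a null set only and is positive
  throughout the interval. Were its integral 0, it would vanish almost everywhere on a proper
  interval.\<close>

lemma has_integral_pos_AE:
  fixes g :: "real \<Rightarrow> real"
  assumes g: "(g has_integral I) {u..v}" and "u < v" and N: "negligible N" "\<And>x. x \<in> {u..v} - N \<Longrightarrow> g x > 0"
  shows "I > 0"
proof -
  define h where "h = (\<lambda>x. if x \<in> N then 1 else g x)"
  have h: "(h has_integral I) {u..v}"
    by (rule has_integral_spike[OF N(1) _ g]) (simp add: h_def)
  have pos: "h x > 0" if "x \<in> {u..v}" for x using N(2)[of x] that by (auto simp: h_def)
  have ai: "h absolutely_integrable_on {u..v}"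
    using h pos by (intro nonnegative_absolutely_integrable_1) (auto intro: less_imp_le)
  have eq: "(LINT x|lebesgue. indicator {u..v} x *\<^sub>R h x) = I"
    using set_lebesgue_integral_eq_integral(2)[OF ai] integral_unique[OF h] by (simp add: set_lebesgue_integral_def)
  have nn: "AE x in lebesgue. 0 \<le> indicator {u..v} x *\<^sub>R h x"
    using pos by (intro AE_I2) (auto simp: indicator_def less_imp_le)
  have "I \<ge> 0" using has_integral_nonneg[OF h] pos by (simp add: less_imp_le)
  moreover have "I \<noteq> 0"
  proof
    assume "I = 0"
    with eq have "AE x in lebesgue. indicator {u..v} x *\<^sub>R h x = 0"
      using integral_nonneg_eq_0_iff_AE[OF ai[unfolded set_integrable_def] nn] by simp
    then have "AE x in lebesgue. x \<notin> {u..v}"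
      by eventually_elim (use pos in \<open>fastforce simp: indicator_def split: if_splits\<close>)
    then have "{x. \<not> x \<notin> {u..v}} \<in> null_sets lebesgue" by (subst (asm) completion.AE_iff_null_sets) auto
    also have "{x. \<not> x \<notin> {u..v}} = {u..v}" by auto
    finally have "negligible {u..v}" by (simp add: negligible_iff_null_sets)
    then show False using \<open>u < v\<close> negligible_interval(1)[of u v] by (simp add: box_eq_empty)
  qed
  ultimately show ?thesis by simp
qed

section \<open>Wronskians and real-valued solutions\<close>

context sturm_liouville
begin

lemma quasi_system_scale:
  assumes "quasi_system f h w"
  shows "quasi_system (\<lambda>x. z * f x) (\<lambda>x. z * h x) (\<lambda>x. z * w x)"
  using quasi_system_lin[OF assms assms, of "1 - z"] by (simp add: algebra_simps)

lemma quasi_system_add: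
  assumes "quasi_system f h w" "quasi_system f' h' w'"
  shows "quasi_system (\<lambda>x. f x + f' x) (\<lambda>x. h x + h' x) (\<lambda>x. w x + w' x)"
  using quasi_system_lin[OF assms, of "-1"] by simp

text \<open>In the derivative of the Wronskian the terms with \<open>1 / p\<close>, \<open>s\<close>
  and \<open>q - l * r\<close> cancel in pairs.\<close>

lemma quasi_system_wronskian:
  assumes 1: "quasi_system f h (\<lambda>x. l * f x)" and 2: "quasi_system f' h' (\<lambda>x. l * f' x)"
    and xy: "x \<in> J" "y \<in> J"
  shows "f x * h' x - f' x * h x = f y * h' y - f' y * h y"
proof (rule ac_deriv_zero_constant[OF _ open_J ivl_J xy])
  have "ac_deriv J (\<lambda>x. f x * h' x - f' x * h x)
     (\<lambda>x. (f x * (of_real (s x) * h' x + of_real (q x) * f' x - of_real (r x) * (l * f' x)) +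
           (h x / of_real (p x) - of_real (s x) * f x) * h' x) -
          (f' x * (of_real (s x) * h x + of_real (q x) * f x - of_real (r x) * (l * f x)) +
           (h' x / of_real (p x) - of_real (s x) * f' x) * h x))"
    using 1 2 unfolding quasi_system_def by (intro ac_deriv_diff ac_deriv_mult open_J) auto
  then show "ac_deriv J (\<lambda>x. f x * h' x - f' x * h x) (\<lambda>x. 0)"
    by (simp add: algebra_simps)
qed

text \<open>The coefficients are real, so real parts of a complex solution form a solution, here
  with the prescribed real initial values.\<close>

lemma real_solution_exists:
  assumes "x0 \<in> J"
  obtains y z :: "real \<Rightarrow> real" where
    "quasi_system (\<lambda>x. of_real (y x)) (\<lambda>x. of_real (z x)) (\<lambda>x. of_real l * of_real (y x))"
    "y x0 = \<alpha>" "z x0 = \<beta>"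
proof -
  have c1: "(\<lambda>x. - s x) \<in> L1_loc J" using L1_loc_cmult[OF coeff(4), of "-1"] by simp
  have c2: "(\<lambda>x. q x - l * r x) \<in> L1_loc J" by (intro L1_loc_diff L1_loc_cmult coeff)
  obtain Y Z where Y: "ac_deriv J Y (\<lambda>x. of_real (- s x) * Y x + of_real (1 / p x) * Z x)"
    and Z: "ac_deriv J Z (\<lambda>x. of_real (q x - l * r x) * Y x + of_real (s x) * Z x)"
    and init: "Y x0 = of_real \<alpha>" "Z x0 = of_real \<beta>"
    using linear_system_solvable[OF open_J ivl_J assms c1 coeff(1) c2 coeff(4)] .
  have half: "complex_of_real (Re z) = (1/2) * (z + cnj z)" for z by (simp add: complex_add_cnj)
  have re: "ac_deriv J (\<lambda>x. of_real (Re (F x))) (\<lambda>x. of_real (Re (F' x)))" if "ac_deriv J F F'" for F F'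
    unfolding half by (intro ac_deriv_cmult ac_deriv_add ac_deriv_cnj that open_J)
  have "quasi_system (\<lambda>x. of_real (Re (Y x))) (\<lambda>x. of_real (Re (Z x))) (\<lambda>x. of_real l * of_real (Re (Y x)))"
    unfolding quasi_system_def using re[OF Y] re[OF Z] by (simp add: algebra_simps)
  then show ?thesis using that[of "\<lambda>x. Re (Y x)" "\<lambda>x. Re (Z x)"] init by simp
qed

end

section \<open>Fundamental systems and the sign of the kernel \<open>k\<close>\<close>

locale sl_fundamental = sturm_liouville +
  fixes l :: real and y1 z1 y2 z2 :: "real \<Rightarrow> real"
  assumes sys1: "quasi_system (\<lambda>x. of_real (y1 x)) (\<lambda>x. of_real (z1 x)) (\<lambda>x. of_real l * of_real (y1 x))"
    and sys2: "quasi_system (\<lambda>x. of_real (y2 x)) (\<lambda>x. of_real (z2 x)) (\<lambda>x. of_real l * of_real (y2 x))"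
    and wronskian: "x \<in> J \<Longrightarrow> y1 x * z2 x - y2 x * z1 x = 1"
begin

text \<open>As a function of \<open>x\<close>, the solution vanishing at \<open>t\<close> with quasi-derivative \<open>1\<close> there;
  \<open>kd\<close> is its quasi-derivative.\<close>

definition k :: "real \<Rightarrow> real \<Rightarrow> real" where
  "k x t = y1 t * y2 x - y2 t * y1 x"

definition kd :: "real \<Rightarrow> real \<Rightarrow> real" where
  "kd x t = y1 t * z2 x - y2 t * z1 x"

lemma k_self [simp]: "k x x = 0"
  by (simp add: k_def)

lemma k_swap: "k x t = - k t x"
  by (simp add: k_def)

lemma real_continuous:
  "continuous_on J y1" "continuous_on J y2" "continuous_on J z1" "continuous_on J z2"
proof -
  have *: "continuous_on J f" if "continuous_on J (\<lambda>x. complex_of_real (f x))" for f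
    using continuous_on_Re[OF that] by simp
  show "continuous_on J y1" "continuous_on J y2" "continuous_on J z1" "continuous_on J z2"
    by (intro * quasi_system_continuous[OF sys1] quasi_system_continuous[OF sys2])+
qed

lemma solution_comb:
  "quasi_system (\<lambda>x. of_real (\<alpha> * y1 x + \<beta> * y2 x)) (\<lambda>x. of_real (\<alpha> * z1 x + \<beta> * z2 x))
     (\<lambda>x. of_real l * of_real (\<alpha> * y1 x + \<beta> * y2 x))"
  using quasi_system_add[OF quasi_system_scale[OF sys1, of "of_real \<alpha>"] quasi_system_scale[OF sys2, of "of_real \<beta>"]]
  by (simp add: algebra_simps)

lemma k_system:
  "quasi_system (\<lambda>x. of_real (k x t)) (\<lambda>x. of_real (kd x t)) (\<lambda>x. of_real l * of_real (k x t))"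
  using solution_comb[of "- y2 t" "y1 t"] by (simp add: k_def kd_def algebra_simps)

lemma k_continuous: "continuous_on J (\<lambda>x. k x t)"
  unfolding k_def by (intro continuous_intros real_continuous)

text \<open>Where the quasi-derivative is positive, \<open>e\<^sup>S k\<close> with \<open>S' = s\<close> is increasing: its derivative
  is \<open>e\<^sup>S kd / p\<close>.\<close>

lemma k_pos_if_kd_pos:
  assumes "t < x" "{t..x} \<subseteq> J" and kd: "\<And>w. w \<in> {t..x} \<Longrightarrow> kd w t > 0"
  shows "k x t > 0"
proof -
  have tJ: "t \<in> J" using assms by auto
  define S where "S = (\<lambda>w. oint t w s)"
  have S: "ac_deriv J (\<lambda>w. of_real (S w)) (\<lambda>w. of_real (s w))"
    unfolding S_def by (rule oint_of_real_ac_deriv[OF open_J ivl_J tJ coeff(4)])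
  have "ac_deriv J (\<lambda>w. of_real (k w t)) (\<lambda>w. of_real (kd w t) / of_real (p w) - of_real (s w) * of_real (k w t))"
    using k_system by (simp add: quasi_system_def)
  from ac_deriv_mult[OF ac_deriv_exp[OF S open_J] this open_J]
  have "ac_deriv J (\<lambda>w. exp (of_real (S w)) * of_real (k w t)) (\<lambda>w. of_real (exp (S w) * kd w t / p w))"
    by (simp add: algebra_simps exp_of_real)
  from ac_deriv_integral(2)[OF this open_J assms(2) less_imp_le[OF assms(1)]]
  have "((\<lambda>w. complex_of_real (exp (S w) * kd w t / p w)) has_integral of_real (exp (S x) * k x t)) {t..x}"
    by (simp add: exp_of_real)
  from has_integral_linear[OF this bounded_linear_Re]
  have hi: "((\<lambda>w. exp (S w) * kd w t / p w) has_integral exp (S x) * k x t) {t..x}"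
    by (simp add: o_def del: of_real_mult of_real_divide)
  have "exp (S x) * k x t > 0"
  proof (rule has_integral_pos_AE[OF hi assms(1)])
    show "negligible {x\<in>J. \<not> p x > 0}" using p_pos by (simp add: AE_lebesgue_on_open_iff[OF open_J])
    show "exp (S w) * kd w t / p w > 0" if "w \<in> {t..x} - {x\<in>J. \<not> p x > 0}" for w
      using that kd[of w] assms(2) by auto
  qed
  then show ?thesis by (simp add: zero_less_mult_iff)
qed

text \<open>On the diagonal \<open>kd\<close> is the Wronskian, hence 1. It stays positive on a
  square around \<open>(x0, x0)\<close>, and there \<open>k_pos_if_kd_pos\<close> applies to all
  pairs uniformly.\<close>

lemma k_locally_pos:
  assumes "x0 \<in> J"
  obtains \<delta> where "\<delta> > 0" "{x0 - \<delta>..x0 + \<delta>} \<subseteq> J"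
    "\<forall>t x. x0 - \<delta> \<le> t \<longrightarrow> t < x \<longrightarrow> x \<le> x0 + \<delta> \<longrightarrow> k x t > 0"
proof -
  let ?f = "\<lambda>w. y1 (fst w) * z2 (snd w) - y2 (fst w) * z1 (snd w)"
  have cont: "continuous_on (J \<times> J) ?f"
    by (intro continuous_intros continuous_on_compose2[OF real_continuous(1)] continuous_on_compose2[OF real_continuous(2)]
        continuous_on_compose2[OF real_continuous(3)] continuous_on_compose2[OF real_continuous(4)]) auto
  define W where "W = (J \<times> J) \<inter> ?f -` {0<..}"
  have W1: "open W"
    unfolding W_def by (intro continuous_open_preimage[OF cont]) (simp_all add: open_Times open_J)
  have W2: "(x0, x0) \<in> W" unfolding W_def using assms wronskian[OF assms] by simp
  obtain A B where AB: "open A" "open B" "(x0, x0) \<in> A \<times> B" "A \<times> B \<subseteq> W"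
    using open_prod_elim[OF W1 W2] .
  have "open (A \<inter> B)" "x0 \<in> A \<inter> B" using AB by auto
  then obtain \<delta> where \<delta>: "\<delta> > 0" "cball x0 \<delta> \<subseteq> A \<inter> B" by (metis open_contains_cball)
  have sub: "{x0 - \<delta>..x0 + \<delta>} \<subseteq> A \<inter> B" using \<delta>(2) by (simp add: cball_eq_atLeastAtMost)
  have prod: "t \<in> J \<and> w \<in> J \<and> kd w t > 0" if "t \<in> {x0 - \<delta>..x0 + \<delta>}" "w \<in> {x0 - \<delta>..x0 + \<delta>}" for t w
  proof -
    have "(t, w) \<in> A \<times> B" using sub that by blast
    then have "(t, w) \<in> W" using AB(4) by blast
    then show ?thesis by (simp add: W_def kd_def)
  qed
  show ?thesis
  proof (rule that[OF \<delta>(1)])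
    show "{x0 - \<delta>..x0 + \<delta>} \<subseteq> J" using prod by blast
    show "\<forall>t x. x0 - \<delta> \<le> t \<longrightarrow> t < x \<longrightarrow> x \<le> x0 + \<delta> \<longrightarrow> k x t > 0"
    proof (intro allI impI)
      fix t x assume tx: "x0 - \<delta> \<le> t" "t < x" "x \<le> x0 + \<delta>"
      have mem: "w \<in> {x0 - \<delta>..x0 + \<delta>}" if "w \<in> {t..x}" for w using that tx by simp
      show "k x t > 0"
      proof (rule k_pos_if_kd_pos[OF tx(2)])
        show "{t..x} \<subseteq> J" using prod[OF mem mem] by blast
        show "kd w t > 0" if "w \<in> {t..x}" for w
          using prod[OF mem[of t] mem[OF that]] tx(2) by simp
      qed
    qed
  qed
qed

text \<open>\<open>k x0 t = 0\<close> says that the vectors (y1, y2) at \<open>t\<close> and at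
  \<open>x0\<close> are parallel. The one at \<open>x0\<close> is nonzero by the Wronskian, and
  \<open>c\<close> is the coefficient of the projection onto it.\<close>

lemma k_proportional:
  assumes "x0 \<in> J" and zero: "k x0 t = 0"
  obtains c where "\<forall>x. k x t = c * k x x0"
proof -
  define N where "N = (y1 x0)\<^sup>2 + (y2 x0)\<^sup>2"
  have "N \<noteq> 0"
  proof
    assume "N = 0"
    then have "y1 x0 = 0" "y2 x0 = 0" unfolding N_def by (auto simp: sum_power2_eq_zero_iff)
    then show False using wronskian[OF assms(1)] by simp
  qed
  define c where "c = (y1 t * y1 x0 + y2 t * y2 x0) / N"
  have z: "y1 t * y2 x0 = y2 t * y1 x0" using zero by (simp add: k_def)
  have "N * y1 t = (y1 t * y1 x0 + y2 t * y2 x0) * y1 x0"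
    using z by (simp add: N_def power2_eq_square algebra_simps)
  then have 1: "y1 t = c * y1 x0" using \<open>N \<noteq> 0\<close> by (simp add: c_def field_simps)
  have "N * y2 t = (y1 t * y1 x0 + y2 t * y2 x0) * y2 x0"
    using z by (simp add: N_def power2_eq_square algebra_simps)
  then have 2: "y2 t = c * y2 x0" using \<open>N \<noteq> 0\<close> by (simp add: c_def field_simps)
  show ?thesis by (rule that[of c]) (simp add: k_def 1 2 algebra_simps)
qed

text \<open>The alternative in the conclusion keeps \<open>x\<close> to the left of a given
  \<open>y\<close> whenever \<open>y\<close> lies right of \<open>t\<close>.\<close>

lemma k_right_positive:
  assumes "t \<in> J"
  obtains x where "t < x" "x \<in> J" "x < y \<or> y \<le> t" "\<forall>w. t < w \<longrightarrow> w \<le> x \<longrightarrow> k w t > 0"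
proof -
  obtain \<delta> where \<delta>: "\<delta> > 0" "{t - \<delta>..t + \<delta>} \<subseteq> J"
    "\<forall>t' x. t - \<delta> \<le> t' \<longrightarrow> t' < x \<longrightarrow> x \<le> t + \<delta> \<longrightarrow> k x t' > 0" using k_locally_pos[OF assms] .
  define x where "x = (if t < y then min (t + \<delta>) ((t + y) / 2) else t + \<delta>)"
  have x: "t < x" "x \<le> t + \<delta>" "x < y \<or> y \<le> t" using \<delta>(1) by (auto simp: x_def min_def)
  have "x \<in> J" using x \<delta> by (intro subsetD[OF \<delta>(2)]) auto
  moreover have "\<forall>w. t < w \<longrightarrow> w \<le> x \<longrightarrow> k w t > 0" using \<delta>(1,3) x by auto
  ultimately show ?thesis using that[of x] x by blast
qed

text \<open>Since \<open>k t t = 0\<close>, the search starts at a point \<open>x1\<close> beyond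
  \<open>t\<close> up to which the kernel is positive. The least point where it is nonpositive is a
  zero by the intermediate value theorem.\<close>

lemma k_first_zero:
  assumes "t \<in> J" "x \<in> J" "t < x" "k x t \<le> 0"
  obtains x0 where "t < x0" "x0 \<le> x" "k x0 t = 0" "\<forall>w. t < w \<longrightarrow> w < x0 \<longrightarrow> k w t > 0"
proof -
  obtain x1 where x1: "t < x1" "x1 \<in> J" "x1 < x \<or> x \<le> t" "\<forall>w. t < w \<longrightarrow> w \<le> x1 \<longrightarrow> k w t > 0"
    using k_right_positive[OF assms(1), where y = x] .
  have "x1 < x" using x1 assms by auto
  have sub: "{x1..x} \<subseteq> J" by (rule interval_subset[OF ivl_J x1(2) assms(2)])
  have cont: "continuous_on {x1..x} (\<lambda>w. k w t)" using k_continuous sub continuous_on_subset by blast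
  let ?A = "{x1..x} \<inter> (\<lambda>w. k w t) -` {..0}"
  have "closed ?A" by (rule continuous_closed_preimage[OF cont]) auto
  then have "compact ?A" using compact_Int_closed[of "{x1..x}" ?A] by (simp add: Int_absorb1)
  moreover have "x \<in> ?A" using \<open>x1 < x\<close> assms by auto
  ultimately obtain x0 where x0: "x0 \<in> ?A" "\<And>w. w \<in> ?A \<Longrightarrow> x0 \<le> w"
    using compact_attains_inf[of ?A] by (metis empty_iff)
  have pos: "k w t > 0" if "t < w" "w < x0" for w
  proof (rule ccontr)
    assume n: "\<not> k w t > 0"
    then have "\<not> w \<le> x1" using x1(4) that by auto
    then have "w \<in> ?A" using n that x0(1) by auto
    then show False using x0(2) that by fastforce
  qed
  have k1: "k x1 t > 0" using x1 by simp
  have "x1 \<le> x0" using x0(1) by simp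
  have "continuous_on {x1..x0} (\<lambda>w. k w t)" by (rule continuous_on_subset[OF cont]) (use x0(1) in auto)
  then obtain w where w: "x1 \<le> w" "w \<le> x0" "k w t = 0"
    using IVT2'[of "\<lambda>w. k w t" x0 0 x1] x0(1) k1 \<open>x1 \<le> x0\<close> by auto
  then have "w \<in> ?A" using x0(1) by auto
  then have "w = x0" using x0(2) w by (meson order_antisym)
  then show ?thesis using that[of x0] w x0(1) x1 pos by auto
qed

text \<open>If \<open>x0\<close> is the first zero, k(., t) is \<open>c\<close> times k(., x0),
  which near \<open>x0\<close> is negative on the left and positive on the right. So
  \<open>c < 0\<close>, and k(., t) turns negative. The points \<open>t\<close>,
  \<open>t2 < x0\<close> and \<open>t3 > x0\<close> then give a negative product.\<close>

lemma k_pos_if_three_points: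
  assumes three: "\<And>t1 t2 t3. \<lbrakk>t1 \<in> J; t2 \<in> J; t3 \<in> J; t1 < t2; t2 < t3\<rbrakk> \<Longrightarrow> k t2 t1 * k t3 t2 * k t3 t1 \<ge> 0"
    and tx: "t \<in> J" "x \<in> J" "t < x"
  shows "k x t > 0"
proof (rule ccontr)
  assume "\<not> k x t > 0"
  then obtain x0 where x0: "t < x0" "x0 \<le> x" "k x0 t = 0" "\<forall>w. t < w \<longrightarrow> w < x0 \<longrightarrow> k w t > 0"
    using k_first_zero[OF tx] by (metis not_le)
  have x0J: "x0 \<in> J" using interval_subset[OF ivl_J tx(1,2)] x0 by auto
  obtain c where c: "\<forall>x. k x t = c * k x x0" using k_proportional[OF x0J x0(3)] .
  obtain \<delta> where \<delta>: "\<delta> > 0" "{x0 - \<delta>..x0 + \<delta>} \<subseteq> J"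
    "\<forall>t x. x0 - \<delta> \<le> t \<longrightarrow> t < x \<longrightarrow> x \<le> x0 + \<delta> \<longrightarrow> k x t > 0" using k_locally_pos[OF x0J] .
  \<comment> \<open>The midpoint keeps \<open>t2\<close> strictly beyond \<open>t\<close> in case
    \<open>x0 - \<delta>\<close> does not.\<close>
  define t2 where "t2 = max (x0 - \<delta>) ((t + x0) / 2)"
  define t3 where "t3 = x0 + \<delta>"
  have t2: "x0 - \<delta> \<le> t2" "t < t2" "t2 < x0" using \<delta>(1) x0(1) by (auto simp: t2_def max_def)
  have t3: "x0 < t3" using \<delta>(1) by (simp add: t3_def)
  have inJ: "t2 \<in> J" "t3 \<in> J" using t2 t3 \<delta> by (auto simp: t3_def intro!: subsetD[OF \<delta>(2)])
  have p1: "k t2 t > 0" using x0(4) t2 by simp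
  have "k x0 t2 > 0" using \<delta> t2 by simp
  then have "k t2 x0 < 0" using k_swap[of t2 x0] by simp
  then have "c < 0" using p1 c by (metis not_less_iff_gr_or_eq zero_less_mult_iff)
  moreover have "k t3 x0 > 0" using \<delta> t3 by (simp add: t3_def)
  ultimately have p2: "k t3 t < 0" using c by (simp add: mult_less_0_iff)
  have p3: "k t3 t2 > 0" using \<delta>(3) t2 t3 by (simp add: t3_def)
  have "k t2 t * k t3 t2 * k t3 t < 0" using p1 p2 p3 by (simp add: mult_pos_neg)
  moreover have "k t2 t * k t3 t2 * k t3 t \<ge> 0" by (rule three[OF tx(1) inJ t2(2)]) (use t2 t3 in simp)
  ultimately show False by simp
qed

text \<open>The coefficients are, up to sign, the Wronskians of \<open>u\<close> with the basis
  solutions and thus constant; Cramer's rule at \<open>x\<close> recovers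
  \<open>u x\<close>.\<close>

lemma solution_span:
  assumes u: "SL_solution J p q r s (of_real l) u"
  obtains A B where "\<forall>x\<in>J. u x = A * of_real (y1 x) + B * of_real (y2 x)"
proof -
  obtain v where uv: "quasi_system u v (\<lambda>x. of_real l * u x)" using u SL_solution_iff by blast
  obtain x0 where x0: "x0 \<in> J" using J_nonempty by blast
  define A where "A = u x0 * of_real (z2 x0) - of_real (y2 x0) * v x0"
  define B where "B = - (u x0 * of_real (z1 x0) - of_real (y1 x0) * v x0)"
  have "u x = A * of_real (y1 x) + B * of_real (y2 x)" if x: "x \<in> J" for x
  proof -
    have A: "A = u x * of_real (z2 x) - of_real (y2 x) * v x"
      unfolding A_def by (rule quasi_system_wronskian[OF uv sys2 x0 x])
    have B: "B = - (u x * of_real (z1 x) - of_real (y1 x) * v x)"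
      unfolding B_def by (subst quasi_system_wronskian[OF uv sys1 x0 x]) simp
    have "A * of_real (y1 x) + B * of_real (y2 x) = u x * of_real (y1 x * z2 x - y2 x * z1 x)"
      unfolding A B by (simp add: algebra_simps)
    then show ?thesis using wronskian[OF x] by simp
  qed
  then show ?thesis using that by blast
qed

text \<open>Two zeros \<open>x\<close> and \<open>y\<close> give a homogeneous linear system for the
  coefficients of \<open>u\<close> whose determinant is, up to sign, \<open>k x y\<close>.\<close>

lemma k_pos_imp_disconjugate:
  assumes pos: "\<And>t x. t \<in> J \<Longrightarrow> x \<in> J \<Longrightarrow> t < x \<Longrightarrow> k x t > 0"
  shows "disconjugate J p q r s l"
  unfolding disconjugate_def
proof (intro allI impI ballI)
  fix u x y assume u: "SL_solution J p q r s (of_real l) u" and nz: "\<exists>x\<in>J. u x \<noteq> 0"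
    and xy: "x \<in> J" "y \<in> J" "u x = 0" "u y = 0"
  obtain A B where AB: "\<forall>x\<in>J. u x = A * of_real (y1 x) + B * of_real (y2 x)" using solution_span[OF u] .
  show "x = y"
  proof (rule ccontr)
    assume "x \<noteq> y"
    then have "k x y \<noteq> 0" using pos[OF xy(1,2)] pos[OF xy(2,1)] k_swap[of x y] by (cases "x < y") auto
    have e: "A * of_real (y1 x) + B * of_real (y2 x) = 0" "A * of_real (y1 y) + B * of_real (y2 y) = 0"
      using AB xy by auto
    have "B * of_real (k x y) = of_real (y1 y) * (A * of_real (y1 x) + B * of_real (y2 x)) -
        of_real (y1 x) * (A * of_real (y1 y) + B * of_real (y2 y))"
      by (simp add: k_def algebra_simps)
    then have "B = 0" using e \<open>k x y \<noteq> 0\<close> by simp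
    have "A * of_real (k x y) = of_real (y2 x) * (A * of_real (y1 y) + B * of_real (y2 y)) -
        of_real (y2 y) * (A * of_real (y1 x) + B * of_real (y2 x))"
      by (simp add: k_def algebra_simps)
    then have "A = 0" using e \<open>k x y \<noteq> 0\<close> by simp
    with \<open>B = 0\<close> AB nz show False by simp
  qed
qed

text \<open>k(., t) vanishes at \<open>t\<close> and is nontrivial, being positive before its first
  zero beyond \<open>t\<close>; such a zero would contradict disconjugacy.\<close>

lemma disconjugate_imp_k_pos:
  assumes dis: "disconjugate J p q r s l" and tx: "t \<in> J" "x \<in> J" "t < x"
  shows "k x t > 0"
proof (rule ccontr)
  assume "\<not> k x t > 0"
  then obtain x0 where x0: "t < x0" "x0 \<le> x" "k x0 t = 0" "\<forall>w. t < w \<longrightarrow> w < x0 \<longrightarrow> k w t > 0"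
    using k_first_zero[OF tx] by (metis not_le)
  have x0J: "x0 \<in> J" using interval_subset[OF ivl_J tx(1,2)] x0 by auto
  let ?w = "(t + x0) / 2"
  have w: "?w \<in> J" using interval_subset[OF ivl_J tx(1) x0J] x0(1) by auto
  have "k ?w t > 0" using x0 by simp
  then have nz: "\<exists>w\<in>J. complex_of_real (k w t) \<noteq> 0" using w by (intro bexI[of _ ?w]) auto
  have sol: "SL_solution J p q r s (of_real l) (\<lambda>x. of_real (k x t))"
    unfolding SL_solution_iff using k_system by (intro exI)
  have "\<forall>x\<in>J. complex_of_real (k x t) \<in> \<real>" by simp
  with dis[unfolded disconjugate_def, rule_format, OF sol, rule_format, OF _ nz]
  have "complex_of_real (k x t) = 0 \<Longrightarrow> complex_of_real (k y t) = 0 \<Longrightarrow> x = y" if "x \<in> J" "y \<in> J" for x y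
    using that by simp
  from this[OF tx(1) x0J] have "t = x0" using tx(1) x0J x0(3) by simp
  then show False using x0(1) by simp
qed

text \<open>The finite intersection property stands in for an explicit limit. \<open>C x\<close>
  consists of the coefficient pairs whose combination is nonnegative at \<open>x\<close>; any
  finitely many of these sets share the normalized coefficients of k(d, .) with \<open>d\<close> to
  the right of all points involved.\<close>

lemma k_pos_imp_positive_solution:
  assumes pos: "\<And>t x. t \<in> J \<Longrightarrow> x \<in> J \<Longrightarrow> t < x \<Longrightarrow> k x t > 0"
  shows "\<exists>u. SL_solution J p q r s (of_real l) u \<and> (\<forall>x\<in>J. u x \<in> \<real> \<and> Re (u x) > 0)"
proof -
  define C where "C = (\<lambda>x. {w::real \<times> real. 0 \<le> fst w * y1 x + snd w * y2 x})"
  have "sphere 0 1 \<inter> (\<Inter>x\<in>J. C x) \<noteq> {}"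
  proof (rule compact_imp_fip_image)
    show "compact (sphere 0 1 :: (real \<times> real) set)" by (rule compact_sphere)
    show "closed (C x)" for x
      unfolding C_def by (intro closed_Collect_le continuous_intros)
    fix I assume I: "finite I" "I \<subseteq> J"
    obtain d where d: "d \<in> J" "\<forall>x\<in>I. x < d"
    proof (cases "I = {}")
      case True then show ?thesis using that J_nonempty by blast
    next
      case False
      then have "Max I \<in> J" using I Max_in by blast
      then obtain a d where ad: "a < Max I" "Max I < d" "{a..d} \<subseteq> J"
        using open_interval_around[OF open_J \<open>Max I \<in> J\<close>] by metis
      have "d \<in> J" by (rule subsetD[OF ad(3)]) (use ad in simp)
      moreover have "\<forall>x\<in>I. x < d" using Max_ge[OF I(1)] ad(2) by (meson le_less_trans)
      ultimately show ?thesis by (rule that)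
    qed
    define w0 where "w0 = (y2 d, - y1 d)"
    have w0: "w0 \<noteq> 0"
    proof
      assume "w0 = 0"
      then have "y1 d = 0" "y2 d = 0" by (simp_all add: w0_def zero_prod_def)
      then show False using wronskian[OF d(1)] by simp
    qed
    define w where "w = (1 / norm w0) *\<^sub>R w0"
    have "w \<in> sphere 0 1" using w0 by (simp add: w_def)
    moreover have "w \<in> C x" if "x \<in> I" for x
    proof -
      have "k d x > 0" using pos d that I by blast
      then have "0 \<le> (1 / norm w0) * k d x" by simp
      also have "(1 / norm w0) * k d x = fst w * y1 x + snd w * y2 x"
        unfolding w_def by (simp add: w0_def k_def algebra_simps diff_divide_distrib)
      finally show ?thesis unfolding C_def by simp
    qed
    ultimately show "sphere 0 1 \<inter> (\<Inter>x\<in>I. C x) \<noteq> {}" by blast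
  qed
  then obtain w where w: "w \<in> sphere 0 1" "\<forall>x\<in>J. w \<in> C x" by blast
  define \<alpha> \<beta> where "\<alpha> = fst w" and "\<beta> = snd w"
  have "w \<noteq> 0" using w(1) by auto
  then have ab: "\<alpha> \<noteq> 0 \<or> \<beta> \<noteq> 0" by (simp add: \<alpha>_def \<beta>_def prod_eq_iff)
  define u where "u = (\<lambda>x. \<alpha> * y1 x + \<beta> * y2 x)"
  have u0: "u x \<ge> 0" if "x \<in> J" for x using w(2) that by (simp add: C_def u_def \<alpha>_def \<beta>_def)
  \<comment> \<open>So far \<open>u\<close> is only nonnegative. A zero at \<open>x\<close> would
    make it \<open>V\<close> times k(., x), with \<open>V\<close> its quasi-derivative there; as
    that kernel changes sign at \<open>x\<close>, this forces \<open>V = 0\<close> and both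
    coefficients to vanish.\<close>
  have upos: "u x > 0" if x: "x \<in> J" for x
  proof (rule ccontr)
    assume "\<not> u x > 0"
    then have ux: "\<alpha> * y1 x + \<beta> * y2 x = 0" using u0[OF x] by (simp add: u_def)
    define V where "V = \<alpha> * z1 x + \<beta> * z2 x"
    have "V * y1 x = \<beta> * (y1 x * z2 x - y2 x * z1 x) + z1 x * (\<alpha> * y1 x + \<beta> * y2 x)" by (simp add: V_def algebra_simps)
    then have b: "\<beta> = V * y1 x" using ux wronskian[OF x] by simp
    have "V * y2 x = - \<alpha> * (y1 x * z2 x - y2 x * z1 x) + z2 x * (\<alpha> * y1 x + \<beta> * y2 x)" by (simp add: V_def algebra_simps)
    then have a: "\<alpha> = - (V * y2 x)" using ux wronskian[OF x] by simp
    have uk: "u w = V * k w x" for w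
    proof -
      have "u w = - (V * y2 x) * y1 w + V * y1 x * y2 w" unfolding u_def using a b by metis
      then show ?thesis by (simp add: k_def algebra_simps)
    qed
    obtain c d where cd: "c < x" "x < d" "{c..d} \<subseteq> J" using open_interval_around[OF open_J x] .
    then have cJ: "c \<in> J" "d \<in> J" by auto
    have "V \<ge> 0" using u0[OF cJ(2)] uk[of d] pos[OF x cJ(2) cd(2)] by (simp add: zero_le_mult_iff)
    moreover have "V \<le> 0" using u0[OF cJ(1)] uk[of c] pos[OF cJ(1) x cd(1)] k_swap[of c x] by (simp add: zero_le_mult_iff mult_le_0_iff)
    ultimately show False using a b ab by simp
  qed
  have "SL_solution J p q r s (of_real l) (\<lambda>x. of_real (u x))"
    unfolding u_def SL_solution_iff by (rule exI, rule solution_comb)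
  then show ?thesis using upos by (intro exI[of _ "\<lambda>x. of_real (u x)"]) auto
qed

end

text \<open>Initial values (1, 0) and (0, 1) at one point make the Wronskian 1 there, hence
  everywhere.\<close>

lemma (in sturm_liouville) fundamental_system_exists:
  obtains y1 z1 y2 z2 where "sl_fundamental J p q r s l y1 z1 y2 z2"
proof -
  obtain x0 where x0: "x0 \<in> J" using J_nonempty by blast
  obtain y1 z1 where 1: "quasi_system (\<lambda>x. of_real (y1 x)) (\<lambda>x. of_real (z1 x)) (\<lambda>x. of_real l * of_real (y1 x))"
    "y1 x0 = 1" "z1 x0 = 0" using real_solution_exists[OF x0] .
  obtain y2 z2 where 2: "quasi_system (\<lambda>x. of_real (y2 x)) (\<lambda>x. of_real (z2 x)) (\<lambda>x. of_real l * of_real (y2 x))"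
    "y2 x0 = 0" "z2 x0 = 1" using real_solution_exists[OF x0] .
  show ?thesis
  proof (rule that[of y1 z1 y2 z2], unfold_locales)
    fix x assume "x \<in> J"
    have "complex_of_real (y1 x) * of_real (z2 x) - of_real (y2 x) * of_real (z1 x) =
      of_real (y1 x0) * of_real (z2 x0) - of_real (y2 x0) * of_real (z1 x0)"
      by (rule quasi_system_wronskian[OF 1(1) 2(1) \<open>x \<in> J\<close> x0])
    then have "complex_of_real (y1 x * z2 x - y2 x * z1 x) = of_real 1" using 1 2 by simp
    then show "y1 x * z2 x - y2 x * z1 x = 1" by (simp only: of_real_eq_iff)
  qed (rule 1 2)+
qed

section \<open>Test functions\<close>

lemma L1_loc_mult_bounded:
  fixes f g :: "real \<Rightarrow> real"
  assumes f: "f \<in> borel_measurable (lebesgue_on J)" and bdd: "\<And>c d. {c..d} \<subseteq> J \<Longrightarrow> bounded (f ` {c..d})"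
    and g: "g \<in> L1_loc J"
  shows "(\<lambda>x. f x * g x) \<in> L1_loc J"
  unfolding L1_loc_def
proof (intro CollectI allI impI absolutely_integrable_bounded_measurable_product_real)
  fix c d assume cd: "{c..d} \<subseteq> J"
  show "f \<in> borel_measurable (lebesgue_on {c..d})" by (rule measurable_restrict_mono[OF f cd])
  show "bounded (f ` {c..d})" by (rule bdd[OF cd])
  show "g absolutely_integrable_on {c..d}" using g cd by (simp add: L1_loc_def)
qed simp

lemma L1_loc_mult_continuous:
  fixes f g :: "real \<Rightarrow> real"
  assumes f: "continuous_on J f" and J: "open J" and g: "g \<in> L1_loc J"
  shows "(\<lambda>x. f x * g x) \<in> L1_loc J"
proof (rule L1_loc_mult_bounded[OF _ _ g])
  show "f \<in> borel_measurable (lebesgue_on J)"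
    by (rule continuous_imp_measurable_on_sets_lebesgue[OF f]) (simp add: borel_open[OF J])
  show "bounded (f ` {c..d})" if "{c..d} \<subseteq> J" for c d
    by (rule compact_imp_bounded, rule compact_continuous_image[OF continuous_on_subset[OF f that]]) simp
qed

lemma L1_loc_integrable: "g \<in> L1_loc J \<Longrightarrow> {c..d} \<subseteq> J \<Longrightarrow> g integrable_on {c..d}"
  unfolding L1_loc_def by (auto intro: set_lebesgue_integral_eq_integral(1))

lemma integrable_cmult_real:
  fixes f :: "real \<Rightarrow> real"
  shows "f integrable_on S \<Longrightarrow> (\<lambda>x. c * f x) integrable_on S"
  using integrable_cmul[of f S c] by simp

lemma abs_integral_le:
  fixes f g :: "real \<Rightarrow> real"
  assumes "f integrable_on S" "g integrable_on S" "\<And>x. x \<in> S \<Longrightarrow> \<bar>f x\<bar> \<le> g x"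
  shows "\<bar>integral S f\<bar> \<le> integral S g"
  using integral_norm_bound_integral[of f S g] assms by simp

lemma oint_eq_integral: "x0 \<le> x \<Longrightarrow> oint x0 x g = integral {x0..x} g"
  by (cases "x0 = x") (auto simp: oint_def)

lemma integral_zero_interior:
  fixes g :: "real \<Rightarrow> 'b::euclidean_space"
  assumes "\<And>x. u < x \<Longrightarrow> x < v \<Longrightarrow> g x = 0"
  shows "integral {u..v} g = 0"
proof -
  have "integral {u..v} g = integral {u..v} (\<lambda>x. 0 :: 'b)"
    by (rule integral_spike[of "{u, v}"]) (use assms in \<open>auto simp: less_le\<close>)
  then show ?thesis by simp
qed

text \<open>Local integrability of \<open>r\<close> makes the weighted measure finite on compact
  subintervals, so bounded functions supported there are square-integrable.\<close>

lemma (in sturm_liouville) L2_compactI: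
  assumes cd: "{c..d} \<subseteq> J" and f: "f \<in> borel_measurable (lebesgue_on J)"
    and B: "\<And>x. x \<in> J \<Longrightarrow> norm (f x) \<le> B" and zero: "\<And>x. x \<in> J - {c..d} \<Longrightarrow> f x = 0"
  shows "f \<in> L2 M"
proof -
  let ?u = "\<lambda>x. complex_of_real ((norm (f x))\<^sup>2)"
  have um: "?u \<in> borel_measurable (lebesgue_on J)" using f by measurable
  have "(\<lambda>x. ?u x * of_real (r x)) absolutely_integrable_on {c..d}"
  proof (rule absolutely_integrable_mult_bounded)
    show "?u \<in> borel_measurable (lebesgue_on {c..d})" by (rule measurable_restrict_mono[OF um cd])
    show "bounded (?u ` {c..d})"
      unfolding bounded_iff
    proof (intro exI[of _ "B\<^sup>2"] ballI)
      fix v assume "v \<in> ?u ` {c..d}"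
      then obtain x where x: "x \<in> {c..d}" "v = ?u x" by blast
      then have "norm (f x) \<le> B" using B cd by blast
      then show "norm v \<le> B\<^sup>2" unfolding x(2) by (simp only: norm_of_real) (simp add: power_mono)
    qed
    show "(\<lambda>x. complex_of_real (r x)) absolutely_integrable_on {c..d}"
      using loc_integrableD[OF loc_integrable_of_real[OF coeff(3)] cd] .
  qed
  then have ai: "(\<lambda>x. of_real (r x) * ?u x) absolutely_integrable_on {c..d}" by (simp add: mult.commute)
  have "integrable M ?u"
    by (rule M_integral(1)[OF cd _ measurable_M[OF um] ai]) (use zero in simp)
  then have "integrable M (\<lambda>x. Re (?u x))" by (rule integrable_Re)
  then have "integrable M (\<lambda>x. (norm (f x))\<^sup>2)" by (simp only: Re_complex_of_real)
  then show ?thesis using measurable_M[OF f] by (simp add: L2_def)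
qed

section \<open>The lower bound tested on three bumps\<close>

context sl_fundamental
begin

text \<open>Variation of constants yields \<open>F\<close> with \<open>(\<tau> - l) F = \<psi>\<close>; the moment conditions make \<open>F\<close>
  vanish beyond the support of \<open>\<psi>\<close>.\<close>

lemma test_function:
  assumes ge: "op_ge M pre_min l" and tT: "t0 < T" "{t0..T} \<subseteq> J"
    and \<psi>: "\<psi> \<in> borel_measurable (lebesgue_on J)" "\<And>x. \<bar>\<psi> x\<bar> \<le> B" "\<And>x. x \<notin> {t0..T} \<Longrightarrow> \<psi> x = 0"
    and m1: "integral {t0..T} (\<lambda>x. y1 x * (r x * \<psi> x)) = 0"
    and m2: "integral {t0..T} (\<lambda>x. y2 x * (r x * \<psi> x)) = 0"
  shows "0 \<le> integral {t0..T} (\<lambda>x. r x * \<psi> x *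
    (y1 x * integral {t0..x} (\<lambda>x. y2 x * (r x * \<psi> x)) - y2 x * integral {t0..x} (\<lambda>x. y1 x * (r x * \<psi> x))))"
proof -
  define g1 g2 where "g1 = (\<lambda>x. y1 x * (r x * \<psi> x))" and "g2 = (\<lambda>x. y2 x * (r x * \<psi> x))"
  define I1 I2 where "I1 = (\<lambda>x. oint t0 x g1)" and "I2 = (\<lambda>x. oint t0 x g2)"
  have t0: "t0 \<in> J" "T \<in> J" using tT by auto
  have "(\<lambda>x. \<psi> x * r x) \<in> L1_loc J"
    by (rule L1_loc_mult_bounded[OF \<psi>(1) _ coeff(3)]) (use \<psi>(2) in \<open>auto simp: bounded_iff\<close>)
  then have r\<psi>: "(\<lambda>x. r x * \<psi> x) \<in> L1_loc J" by (simp add: mult.commute)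
  have g: "g1 \<in> L1_loc J" "g2 \<in> L1_loc J"
    unfolding g1_def g2_def by (intro L1_loc_mult_continuous real_continuous open_J r\<psi>)+
  have I1: "ac_deriv J (\<lambda>x. of_real (I1 x)) (\<lambda>x. of_real (g1 x))"
    and I2: "ac_deriv J (\<lambda>x. of_real (I2 x)) (\<lambda>x. of_real (g2 x))"
    unfolding I1_def I2_def by (intro oint_of_real_ac_deriv open_J ivl_J t0 g)+
  define F where "F = (\<lambda>x. complex_of_real (y1 x) * of_real (I2 x) - of_real (y2 x) * of_real (I1 x))"
  define G where "G = (\<lambda>x. complex_of_real (z1 x) * of_real (I2 x) - of_real (z2 x) * of_real (I1 x))"
  \<comment> \<open>This is \<psi> + l F; the double minus fits the pattern \<open>u - z * v\<close>
    of \<open>L2_lin\<close> and \<open>L2_inner_lin\<close>.\<close>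
  define w where "w = (\<lambda>x. of_real (\<psi> x) - (- of_real l) * F x)"
  have y: "ac_deriv J (\<lambda>x. of_real (y1 x)) (\<lambda>x. of_real (z1 x) / of_real (p x) - of_real (s x) * of_real (y1 x))"
    "ac_deriv J (\<lambda>x. of_real (y2 x)) (\<lambda>x. of_real (z2 x) / of_real (p x) - of_real (s x) * of_real (y2 x))"
    "ac_deriv J (\<lambda>x. of_real (z1 x)) (\<lambda>x. of_real (s x) * of_real (z1 x) + of_real (q x) * of_real (y1 x) - of_real (r x) * (of_real l * of_real (y1 x)))"
    "ac_deriv J (\<lambda>x. of_real (z2 x)) (\<lambda>x. of_real (s x) * of_real (z2 x) + of_real (q x) * of_real (y2 x) - of_real (r x) * (of_real l * of_real (y2 x)))"
    using sys1 sys2 by (simp_all add: quasi_system_def)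
  have "ac_deriv J F
      (\<lambda>x. (of_real (y1 x) * of_real (g2 x) + (of_real (z1 x) / of_real (p x) - of_real (s x) * of_real (y1 x)) * of_real (I2 x)) -
        (of_real (y2 x) * of_real (g1 x) + (of_real (z2 x) / of_real (p x) - of_real (s x) * of_real (y2 x)) * of_real (I1 x)))"
    unfolding F_def by (intro ac_deriv_diff ac_deriv_mult y I1 I2 open_J)
  then have F1: "ac_deriv J F (\<lambda>x. G x / of_real (p x) - of_real (s x) * F x)"
    by (rule ac_deriv_cong_AE) (rule AE_I2, simp add: F_def G_def g1_def g2_def algebra_simps diff_divide_distrib)
  let ?g = "\<lambda>x. (of_real (z1 x) * of_real (g2 x) + (of_real (s x) * of_real (z1 x) + of_real (q x) * of_real (y1 x) - of_real (r x) * (of_real l * of_real (y1 x))) * of_real (I2 x)) -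
        (of_real (z2 x) * of_real (g1 x) + (of_real (s x) * of_real (z2 x) + of_real (q x) * of_real (y2 x) - of_real (r x) * (of_real l * of_real (y2 x))) * of_real (I1 x))"
  have "ac_deriv J G ?g"
    unfolding G_def by (intro ac_deriv_diff ac_deriv_mult y I1 I2 open_J)
  \<comment> \<open>The source \<psi> enters with the Wronskian as a factor, which is 1.\<close>
  then have G1: "ac_deriv J G (\<lambda>x. of_real (s x) * G x + of_real (q x) * F x - of_real (r x) * w x)"
  proof (rule ac_deriv_cong_AE, intro AE_lebesgue_onI)
    fix x assume x: "x \<in> J"
    have "?g x
      = of_real (s x) * G x + of_real (q x) * F x - of_real (r x) * (of_real l * F x)
        - of_real (r x) * of_real (\<psi> x) * complex_of_real (y1 x * z2 x - y2 x * z1 x)"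
      by (simp add: F_def G_def g1_def g2_def algebra_simps)
    then show "?g x
      = of_real (s x) * G x + of_real (q x) * F x - of_real (r x) * w x"
      unfolding wronskian[OF x] by (simp add: w_def algebra_simps)
  qed
  have sys: "quasi_system F G w" using F1 G1 by (simp add: quasi_system_def)
  \<comment> \<open>Left of \<open>t0\<close> the integrand is 0; right of \<open>T\<close> the
    integral has reached the full moment, which is 0.\<close>
  have I0: "oint t0 x h = 0" if x: "x \<in> J - {t0..T}" and h: "h \<in> L1_loc J" "\<And>x. x \<notin> {t0..T} \<Longrightarrow> h x = 0"
    "integral {t0..T} h = 0" for x and h :: "real \<Rightarrow> real"
  proof (cases "x < t0")
    case True
    then have "oint t0 x h = - integral {x..t0} h" by (simp add: oint_def)
    also have "integral {x..t0} h = 0" by (rule integral_zero_interior) (use h(2) in simp)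
    finally show ?thesis by simp
  next
    case False
    then have "T \<le> x" using x by auto
    have "oint t0 x h - oint t0 T h = integral {T..x} h"
      by (rule oint_diff[OF ivl_J t0(1) t0(2) _ \<open>T \<le> x\<close> L1_loc_integrable[OF h(1)]]) (use x in simp)
    also have "\<dots> = 0" by (rule integral_zero_interior) (use h(2) in simp)
    finally show ?thesis using oint_eq_integral[of t0 T h] tT(1) h(3) by simp
  qed
  have F0: "F x = 0" if "x \<in> J - {t0..T}" for x
  proof -
    have "I1 x = 0" unfolding I1_def by (rule I0[OF that g(1)]) (use \<psi>(3) m1 in \<open>simp_all add: g1_def\<close>)
    moreover have "I2 x = 0" unfolding I2_def by (rule I0[OF that g(2)]) (use \<psi>(3) m2 in \<open>simp_all add: g2_def\<close>)
    ultimately show ?thesis by (simp add: F_def)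
  qed
  have Fc: "continuous_on J F" by (rule quasi_system_continuous[OF sys])
  have "bounded (F ` {t0..T})"
    by (rule compact_imp_bounded, rule compact_continuous_image[OF continuous_on_subset[OF Fc tT(2)]]) simp
  then obtain C where C: "\<forall>v\<in>F ` {t0..T}. norm v \<le> C" unfolding bounded_iff by (rule exE)
  have Fb: "norm (F x) \<le> \<bar>C\<bar>" if "x \<in> J" for x
    using C F0[of x] that by (cases "x \<in> {t0..T}") force+
  have Fm: "F \<in> borel_measurable (lebesgue_on J)"
    by (rule continuous_imp_measurable_on_sets_lebesgue[OF Fc J_lebesgue])
  have FL: "F \<in> L2 M" by (rule L2_compactI[OF tT(2) Fm Fb F0])
  let ?\<psi> = "\<lambda>x. complex_of_real (\<psi> x)"
  have \<psi>m: "?\<psi> \<in> borel_measurable (lebesgue_on J)" using \<psi>(1) by measurable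
  have \<psi>L: "?\<psi> \<in> L2 M" by (rule L2_compactI[OF tT(2) \<psi>m, of B]) (use \<psi> in auto)
  have wL: "w \<in> L2 M" unfolding w_def by (rule L2_lin[OF \<psi>L FL])
  have pm: "(F, SL_expr J p q r s F) \<in> pre_min" "AE x in M. SL_expr J p q r s F x = w x"
    using pre_min_I[OF sys FL wL compact_Icc tT(2) F0] by auto
  have "L2_inner M F (SL_expr J p q r s F) = L2_inner M F w"
    unfolding L2_inner_def
  proof (rule integral_cong_AE)
    show "(\<lambda>x. cnj (F x) * SL_expr J p q r s F x) \<in> borel_measurable M"
      using L2_integrable_mult[OF FL pre_minD(2)[OF pm(1)]] by auto
    show "(\<lambda>x. cnj (F x) * w x) \<in> borel_measurable M" using L2_integrable_mult[OF FL wL] by auto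
    show "AE x in M. cnj (F x) * SL_expr J p q r s F x = cnj (F x) * w x"
      using pm(2) by eventually_elim simp
  qed
  also have "\<dots> = L2_inner M F ?\<psi> + of_real l * L2_inner M F F"
    unfolding w_def by (subst L2_inner_lin[OF FL \<psi>L FL]) simp
  finally have eq: "L2_inner M F (SL_expr J p q r s F) = L2_inner M F ?\<psi> + of_real l * L2_inner M F F" .
  have "l * Re (L2_inner M F F) \<le> Re (L2_inner M F (SL_expr J p q r s F))"
    using ge pm(1) unfolding op_ge_def by blast
  then have nn: "0 \<le> Re (L2_inner M F ?\<psi>)" unfolding eq by simp
  define h where "h = (\<lambda>x. r x * \<psi> x * (y1 x * I2 x - y2 x * I1 x))"
  have h: "h \<in> L1_loc J"
  proof -
    have "continuous_on J (\<lambda>x. Re (F x))" by (intro continuous_intros Fc)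
    from L1_loc_mult_continuous[OF this open_J r\<psi>] show ?thesis
      by (simp add: h_def F_def mult.commute)
  qed
  have rF: "of_real (r x) * (cnj (F x) * ?\<psi> x) = complex_of_real (h x)" for x
    by (simp add: F_def h_def algebra_simps)
  have "L2_inner M F ?\<psi> = integral {t0..T} (\<lambda>x. of_real (r x) * (cnj (F x) * ?\<psi> x))"
    unfolding L2_inner_def
  proof (rule M_integral(2)[OF tT(2)])
    show "(\<lambda>x. cnj (F x) * ?\<psi> x) \<in> borel_measurable M" using L2_integrable_mult[OF FL \<psi>L] by auto
    show "(\<lambda>x. of_real (r x) * (cnj (F x) * ?\<psi> x)) absolutely_integrable_on {t0..T}"
      unfolding rF using loc_integrableD[OF loc_integrable_of_real[OF h] tT(2)] .
  qed (use \<psi>(3) in simp)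
  also have "\<dots> = of_real (integral {t0..T} h)"
    unfolding rF using integral_linear[OF L1_loc_integrable[OF h tT(2)] bounded_linear_of_real, unfolded o_def] .
  finally have "0 \<le> integral {t0..T} h" using nn by simp
  also have "integral {t0..T} h = integral {t0..T} (\<lambda>x. r x * \<psi> x *
    (y1 x * integral {t0..x} (\<lambda>x. y2 x * (r x * \<psi> x)) - y2 x * integral {t0..x} (\<lambda>x. y1 x * (r x * \<psi> x))))"
    by (rule integral_cong) (simp add: h_def I1_def I2_def oint_eq_integral g1_def g2_def)
  finally show ?thesis .
qed

text \<open>The test functions: \<open>\<psi>\<close> is a combination of three normalized bumps next to \<open>t\<^sub>0 < t\<^sub>1 < t\<^sub>2\<close>,
  whose coefficients, the cross products of the moments \<open>(m1 i, m2 i)\<close>, annihilate the moments of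
  \<open>\<psi>\<close>. The quadratic form then is the double sum below, with small diagonal terms \<open>E i\<close>.\<close>

definition bump_form :: "(nat \<Rightarrow> real) \<Rightarrow> (nat \<Rightarrow> real) \<Rightarrow> (nat \<Rightarrow> real) \<Rightarrow> (nat \<Rightarrow> real) \<Rightarrow> real" where
  "bump_form \<alpha> m1 m2 E = (\<Sum>i<3. \<Sum>j<3. \<alpha> i * \<alpha> j *
     (if i = j then E i else if j < i then m1 i * m2 j - m2 i * m1 j else 0))"

definition cross :: "(nat \<Rightarrow> real) \<Rightarrow> (nat \<Rightarrow> real) \<Rightarrow> nat \<Rightarrow> real" where
  "cross m1 m2 i = (if i = 0 then m1 1 * m2 2 - m2 1 * m1 2
     else if i = 1 then m1 2 * m2 0 - m2 2 * m1 0 else m1 0 * m2 1 - m2 0 * m1 1)"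

lemma sum_lessThan_3: "(\<Sum>i<3. f i) = f 0 + f 1 + f (2 :: nat)"
  by (simp add: numeral_3_eq_3 numeral_2_eq_2)

text \<open>The support condition requires vanishing moments exactly, so the coefficients are built
  from the actual moments of the bumps. These match the values of \<open>y1\<close> and
  \<open>y2\<close> at the points only up to \<open>\<omega>\<close>; the limit is taken
  afterwards.\<close>

lemma bump_form_nonneg:
  fixes t :: "nat \<Rightarrow> real"
  assumes ge: "op_ge M pre_min l" and "\<eta> > 0"
    and ord: "t 0 + \<eta> < t 1" "t 1 + \<eta> < t 2" and sub: "{t 0..t 2 + \<eta>} \<subseteq> J"
    and y1: "\<And>i x. i < 3 \<Longrightarrow> x \<in> {t i..t i + \<eta>} \<Longrightarrow> \<bar>y1 x - y1 (t i)\<bar> \<le> \<omega>"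
    and y2: "\<And>i x. i < 3 \<Longrightarrow> x \<in> {t i..t i + \<eta>} \<Longrightarrow> \<bar>y2 x - y2 (t i)\<bar> \<le> \<omega>"
    and k: "\<And>i x w. i < 3 \<Longrightarrow> x \<in> {t i..t i + \<eta>} \<Longrightarrow> w \<in> {t i..t i + \<eta>} \<Longrightarrow> \<bar>k x w\<bar> \<le> \<omega>"
  shows "\<exists>m1 m2 E. (\<forall>i<3. \<bar>m1 i - y1 (t i)\<bar> \<le> \<omega> \<and> \<bar>m2 i - y2 (t i)\<bar> \<le> \<omega> \<and> \<bar>E i\<bar> \<le> \<omega>) \<and>
    0 \<le> bump_form (cross m1 m2) m1 m2 E"
proof -
  define a b where "a = t 0" and "b = t 2 + \<eta>"
  have ab: "a < b" "{a..b} \<subseteq> J" using ord \<open>\<eta> > 0\<close> sub by (auto simp: a_def b_def)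
  have three: "i = 0 \<or> i = 1 \<or> i = 2" if "i < 3" for i :: nat using that by linarith
  have tin: "{t i..t i + \<eta>} \<subseteq> {a..b}" if "i < 3" for i
    using three[OF that] ord \<open>\<eta> > 0\<close> by (auto simp: a_def b_def)
  have tlt: "t j + \<eta> < t i" if "i < 3" "j < i" for i j
  proof -
    have "(i = 1 \<and> j = 0) \<or> (i = 2 \<and> j = 0) \<or> (i = 2 \<and> j = 1)" using that by linarith
    then show ?thesis using ord \<open>\<eta> > 0\<close> by auto
  qed
  have \<omega>0: "\<omega> \<ge> 0" using y1[of 0 "t 0"] \<open>\<eta> > 0\<close> by simp
  \<comment> \<open>Dividing by the mass \<open>N i\<close> of \<open>r\<close> gives bumps of
    weighted integral 1, so that a moment is a weighted average of \<open>y1\<close> or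
    \<open>y2\<close> over \<open>{t i..t i + \<eta>}\<close>.\<close>
  define N where "N = (\<lambda>i. integral {t i..t i + \<eta>} r)"
  have neg: "negligible {x\<in>J. \<not> r x > 0}" using r_pos by (simp add: AE_lebesgue_on_open_iff[OF open_J])
  have Npos: "N i > 0" if i: "i < 3" for i
  proof -
    have "(r has_integral N i) {t i..t i + \<eta>}"
      unfolding N_def by (intro integrable_integral L1_loc_integrable[OF coeff(3)] order_trans[OF tin[OF i] ab(2)])
    then show ?thesis
    proof (rule has_integral_pos_AE[OF _ _ neg])
      fix x assume x: "x \<in> {t i..t i + \<eta>} - {x\<in>J. \<not> r x > 0}"
      then have "x \<in> J" using tin[OF i] ab(2) by (meson DiffD1 subsetD)
      with x show "r x > 0" by simp
    qed (use \<open>\<eta> > 0\<close> in simp)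
  qed
  define \<beta> where "\<beta> = (\<lambda>i x. if x \<in> {t i..t i + \<eta>} then 1 / N i else 0)"
  define \<rho> where "\<rho> = (\<lambda>i x. r x * \<beta> i x)"
  have \<beta>m: "\<beta> i \<in> borel_measurable (lebesgue_on J)" for i
    unfolding \<beta>_def by (intro measurable_restrict_space1 measurable_If) (auto simp: pred_def)
  have \<beta>b: "\<bar>\<beta> i x\<bar> \<le> \<bar>1 / N i\<bar>" for i x by (simp add: \<beta>_def)
  have "(\<lambda>x. \<beta> i x * r x) \<in> L1_loc J" for i
    by (rule L1_loc_mult_bounded[OF \<beta>m _ coeff(3)]) (use \<beta>b in \<open>auto simp: bounded_iff\<close>)
  then have \<rho>L: "\<rho> i \<in> L1_loc J" for i by (simp add: \<rho>_def mult.commute)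
  have \<rho>0: "\<rho> i x = 0" if "x \<notin> {t i..t i + \<eta>}" for i x
    unfolding \<rho>_def \<beta>_def using that by (simp only: if_False mult_zero_right)
  have y\<rho>L: "(\<lambda>x. y1 x * \<rho> i x) \<in> L1_loc J" "(\<lambda>x. y2 x * \<rho> i x) \<in> L1_loc J" for i
    by (intro L1_loc_mult_continuous real_continuous open_J \<rho>L)+
  have subJ: "{u..v} \<subseteq> J" if "a \<le> u" "v \<le> b" for u v using that ab(2) by (meson atLeastatMost_subset_iff order_trans)
  have abs\<rho>i: "(\<lambda>x. \<bar>\<rho> i x\<bar>) integrable_on {u..v}" if "a \<le> u" "v \<le> b" for i u v
    using \<rho>L[of i] subJ[OF that] unfolding L1_loc_def by (auto simp: absolutely_integrable_on_def)
  have \<rho>1: "integral {a..b} (\<rho> i) = 1" "integral {a..b} (\<lambda>x. \<bar>\<rho> i x\<bar>) = 1" if i: "i < 3" for i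
  proof -
    have "(r has_integral N i) {t i..t i + \<eta>}"
      unfolding N_def by (intro integrable_integral L1_loc_integrable[OF coeff(3)] order_trans[OF tin[OF i] ab(2)])
    from has_integral_mult_right[OF this, of "1 / N i"]
    have "((\<lambda>x. 1 / N i * r x) has_integral 1) {t i..t i + \<eta>}" using Npos[OF i] by simp
    then have "((\<lambda>x. if x \<in> {t i..t i + \<eta>} then 1 / N i * r x else 0) has_integral 1) {a..b}"
      by (rule has_integral_restrict[OF tin[OF i], THEN iffD2])
    also have "(\<lambda>x. if x \<in> {t i..t i + \<eta>} then 1 / N i * r x else 0) = \<rho> i"
      by (auto simp: \<rho>_def \<beta>_def)
    finally have hi: "(\<rho> i has_integral 1) {a..b}" .
    then show "integral {a..b} (\<rho> i) = 1" by (rule integral_unique)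
    have "((\<lambda>x. \<bar>\<rho> i x\<bar>) has_integral 1) {a..b}"
    proof (rule has_integral_spike[OF neg _ hi])
      fix x assume "x \<in> {a..b} - {x\<in>J. \<not> r x > 0}"
      then have "r x > 0" using ab(2) by auto
      then show "\<bar>\<rho> i x\<bar> = \<rho> i x" using Npos[OF i] by (simp add: \<rho>_def \<beta>_def)
    qed
    then show "integral {a..b} (\<lambda>x. \<bar>\<rho> i x\<bar>) = 1" by (rule integral_unique)
  qed
  define I1 I2 where "I1 = (\<lambda>i x. integral {a..x} (\<lambda>x. y1 x * \<rho> i x))"
    and "I2 = (\<lambda>i x. integral {a..x} (\<lambda>x. y2 x * \<rho> i x))"
  define m1 m2 where "m1 = (\<lambda>i. I1 i b)" and "m2 = (\<lambda>i. I2 i b)"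
  define E where "E = (\<lambda>i. integral {a..b} (\<lambda>x. \<rho> i x * (y1 x * I2 i x - y2 x * I1 i x)))"
  have yI: "(\<lambda>x. y1 x * \<rho> i x) integrable_on {u..v}" "(\<lambda>x. y2 x * \<rho> i x) integrable_on {u..v}"
    if "a \<le> u" "v \<le> b" for i u v
    using L1_loc_integrable[OF y\<rho>L(1) subJ[OF that]] L1_loc_integrable[OF y\<rho>L(2) subJ[OF that]] by auto
  have moment: "\<bar>integral {a..b} (\<lambda>x. y x * \<rho> i x) - y (t i)\<bar> \<le> \<omega>"
    if i: "i < 3" and y: "\<And>x. x \<in> {t i..t i + \<eta>} \<Longrightarrow> \<bar>y x - y (t i)\<bar> \<le> \<omega>"
      and yi: "(\<lambda>x. y x * \<rho> i x) integrable_on {a..b}" for i and y :: "real \<Rightarrow> real"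
  proof -
    have \<rho>i: "\<rho> i integrable_on {a..b}" by (rule L1_loc_integrable[OF \<rho>L ab(2)])
    have "integral {a..b} (\<lambda>x. y x * \<rho> i x) - y (t i) = integral {a..b} (\<lambda>x. y x * \<rho> i x - y (t i) * \<rho> i x)"
      using integral_diff[OF yi integrable_cmult_real[OF \<rho>i, of "y (t i)"]] \<rho>1(1)[OF i] by simp
    also have "\<bar>\<dots>\<bar> \<le> integral {a..b} (\<lambda>x. \<omega> * \<bar>\<rho> i x\<bar>)"
    proof (rule abs_integral_le)
      show "(\<lambda>x. y x * \<rho> i x - y (t i) * \<rho> i x) integrable_on {a..b}"
        by (intro integrable_diff integrable_cmult_real yi \<rho>i)
      show "(\<lambda>x. \<omega> * \<bar>\<rho> i x\<bar>) integrable_on {a..b}"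
          by (intro integrable_cmult_real abs\<rho>i order_refl)
      fix x
      have "\<bar>(y x - y (t i)) * \<rho> i x\<bar> \<le> \<omega> * \<bar>\<rho> i x\<bar>"
        using y[of x] \<rho>0[of x i] by (cases "x \<in> {t i..t i + \<eta>}") (auto simp: abs_mult intro: mult_right_mono)
      then show "\<bar>y x * \<rho> i x - y (t i) * \<rho> i x\<bar> \<le> \<omega> * \<bar>\<rho> i x\<bar>" by (simp add: algebra_simps)
    qed
    also have "\<dots> = \<omega>" using \<rho>1(2)[OF i] by simp
    finally show ?thesis .
  qed
  have M1: "\<bar>m1 i - y1 (t i)\<bar> \<le> \<omega>" "\<bar>m2 i - y2 (t i)\<bar> \<le> \<omega>" if i: "i < 3" for i
    unfolding m1_def m2_def I1_def I2_def by (intro moment i y1 y2 yI order_refl; assumption)+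
  have Icont: "continuous_on {a..b} (I1 i)" "continuous_on {a..b} (I2 i)" for i
    unfolding I1_def I2_def by (intro indefinite_integral_continuous_1 yI order_refl)+
  have yc: "continuous_on {a..b} y1" "continuous_on {a..b} y2"
    using real_continuous(1,2) ab(2) continuous_on_subset by blast+
  have int2: "(\<lambda>x. \<rho> i x * (y1 x * I2 j x - y2 x * I1 j x)) integrable_on {a..b}" for i j
  proof -
    have c: "continuous_on {a..b} (\<lambda>x. y1 x * I2 j x - y2 x * I1 j x)" by (intro continuous_intros yc Icont)
    have "(\<lambda>x. (y1 x * I2 j x - y2 x * I1 j x) * \<rho> i x) absolutely_integrable_on {a..b}"
    proof (rule absolutely_integrable_bounded_measurable_product_real)
      show "bounded ((\<lambda>x. y1 x * I2 j x - y2 x * I1 j x) ` {a..b})"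
        by (rule compact_imp_bounded, rule compact_continuous_image[OF c]) simp
      show "\<rho> i absolutely_integrable_on {a..b}" using \<rho>L[of i] ab(2) by (simp add: L1_loc_def)
    qed (auto intro: continuous_imp_measurable_on_sets_lebesgue[OF c])
    then show ?thesis by (simp add: mult.commute set_lebesgue_integral_eq_integral(1))
  qed
  \<comment> \<open>The diagonal terms only see \<open>k\<close> with both arguments in one short
    interval, where it is at most \<open>\<omega>\<close>.\<close>
  have E: "\<bar>E i\<bar> \<le> \<omega>" if i: "i < 3" for i
  proof -
    have "\<bar>E i\<bar> \<le> integral {a..b} (\<lambda>x. \<omega> * \<bar>\<rho> i x\<bar>)"
      unfolding E_def
    proof (rule abs_integral_le[OF int2])
      show "(\<lambda>x. \<omega> * \<bar>\<rho> i x\<bar>) integrable_on {a..b}"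
          by (intro integrable_cmult_real abs\<rho>i order_refl)
      fix x assume x: "x \<in> {a..b}"
      show "\<bar>\<rho> i x * (y1 x * I2 i x - y2 x * I1 i x)\<bar> \<le> \<omega> * \<bar>\<rho> i x\<bar>"
      proof (cases "x \<in> {t i..t i + \<eta>}")
        case False then show ?thesis using \<rho>0 by simp
      next
        case True
        have xi: "a \<le> a" "x \<le> b" using x by auto
        have "y1 x * I2 i x - y2 x * I1 i x = integral {a..x} (\<lambda>w. y1 x * (y2 w * \<rho> i w) - y2 x * (y1 w * \<rho> i w))"
          unfolding I1_def I2_def by (subst integral_diff) (intro integrable_cmult_real yI xi | simp)+
        also have "\<bar>\<dots>\<bar> \<le> integral {a..x} (\<lambda>w. \<omega> * \<bar>\<rho> i w\<bar>)"
        proof (rule abs_integral_le)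
          show "(\<lambda>w. y1 x * (y2 w * \<rho> i w) - y2 x * (y1 w * \<rho> i w)) integrable_on {a..x}"
            by (intro integrable_diff integrable_cmult_real yI xi)
          show "(\<lambda>x. \<omega> * \<bar>\<rho> i x\<bar>) integrable_on {a..x}"
            by (intro integrable_cmult_real abs\<rho>i xi)
          fix w
          have "y1 x * (y2 w * \<rho> i w) - y2 x * (y1 w * \<rho> i w) = k w x * \<rho> i w" by (simp add: k_def algebra_simps)
          moreover have "\<bar>k w x * \<rho> i w\<bar> \<le> \<omega> * \<bar>\<rho> i w\<bar>"
            using k[OF i _ True, of w] \<rho>0[of w i] by (cases "w \<in> {t i..t i + \<eta>}") (auto simp: abs_mult intro: mult_right_mono)
          ultimately show "\<bar>y1 x * (y2 w * \<rho> i w) - y2 x * (y1 w * \<rho> i w)\<bar> \<le> \<omega> * \<bar>\<rho> i w\<bar>" by simp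
        qed
        also have "\<dots> = \<omega> * integral {a..x} (\<lambda>w. \<bar>\<rho> i w\<bar>)" by simp
        also have "\<dots> \<le> \<omega> * integral {a..b} (\<lambda>w. \<bar>\<rho> i w\<bar>)"
          using x \<omega>0 abs\<rho>i by (intro mult_left_mono integral_subset_le) auto
        also have "\<dots> = \<omega>" using \<rho>1(2)[OF i] by simp
        finally have "\<bar>y1 x * I2 i x - y2 x * I1 i x\<bar> \<le> \<omega>" .
        from mult_left_mono[OF this abs_ge_zero, of "\<rho> i x"] show ?thesis
          by (simp only: abs_mult mult.commute)
      qed
    qed
    also have "\<dots> = \<omega>" using \<rho>1(2)[OF i] by simp
    finally show ?thesis .
  qed
  have Izero: "I1 i x = 0" "I2 i x = 0" if "x \<le> t i" for i x
    unfolding I1_def I2_def using that \<rho>0 by (auto intro!: integral_zero_interior)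
  have Ifull: "I1 i x = m1 i" "I2 i x = m2 i" if x: "t i + \<eta> \<le> x" "a \<le> x" "x \<le> b" for i x
  proof -
    have *: "integral {a..x} h = integral {a..b} h" if "h integrable_on {a..b}" "\<And>w. w > x \<Longrightarrow> h w = 0" for h :: "real \<Rightarrow> real"
    proof -
      have "integral {a..x} h + integral {x..b} h = integral {a..b} h"
        by (rule Henstock_Kurzweil_Integration.integral_combine[OF x(2,3) that(1)])
      moreover have "integral {x..b} h = 0" by (rule integral_zero_interior) (use that(2) in simp)
      ultimately show ?thesis by simp
    qed
    show "I1 i x = m1 i" "I2 i x = m2 i"
      unfolding I1_def I2_def m1_def m2_def
      by (intro * yI order_refl; use \<rho>0 x(1) in simp)+
  qed
  let ?c = "\<lambda>i j. if i = j then E i else if j < i then m1 i * m2 j - m2 i * m1 j else 0"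
  \<comment> \<open>On bump \<open>i\<close>, bump \<open>j\<close> has already been integrated
    completely if \<open>j < i\<close>, and not at all if \<open>i < j\<close>. Only the diagonal
    retains a genuine double integral.\<close>
  have B: "integral {a..b} (\<lambda>x. \<rho> i x * (y1 x * I2 j x - y2 x * I1 j x)) = ?c i j" if ij: "i < 3" "j < 3" for i j
  proof -
    consider "i = j" | "j < i" | "i < j" by linarith
    then show ?thesis
    proof cases
      case 1 then show ?thesis by (simp add: E_def)
    next
      case 2
      have "integral {a..b} (\<lambda>x. \<rho> i x * (y1 x * I2 j x - y2 x * I1 j x)) =
          integral {a..b} (\<lambda>x. m2 j * (y1 x * \<rho> i x) - m1 j * (y2 x * \<rho> i x))"
      proof (rule integral_cong)
        fix x assume x: "x \<in> {a..b}"
        show "\<rho> i x * (y1 x * I2 j x - y2 x * I1 j x) = m2 j * (y1 x * \<rho> i x) - m1 j * (y2 x * \<rho> i x)"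
        proof (cases "x \<in> {t i..t i + \<eta>}")
          case True
          then have "t j + \<eta> \<le> x" using tlt[OF ij(1) 2] by simp
          then show ?thesis using Ifull[of j x] x by (simp add: algebra_simps)
        qed (simp add: \<rho>0)
      qed
      also have "\<dots> = m2 j * m1 i - m1 j * m2 i"
        unfolding m1_def m2_def I1_def I2_def
        by (subst integral_diff) (intro integrable_cmult_real yI order_refl | simp)+
      finally show ?thesis using 2 by (simp add: algebra_simps)
    next
      case 3
      have "integral {a..b} (\<lambda>x. \<rho> i x * (y1 x * I2 j x - y2 x * I1 j x)) = integral {a..b} (\<lambda>x. 0)"
      proof (rule integral_cong)
        fix x assume x: "x \<in> {a..b}"
        show "\<rho> i x * (y1 x * I2 j x - y2 x * I1 j x) = 0"
        proof (cases "x \<in> {t i..t i + \<eta>}")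
          case True
          then have "x \<le> t j" using tlt[OF ij(2) 3] by simp
          then show ?thesis using Izero[of x j] by simp
        qed (simp add: \<rho>0)
      qed
      then show ?thesis using 3 by simp
    qed
  qed
  \<comment> \<open>The cross product is orthogonal to both moment vectors.\<close>
  define \<alpha> where "\<alpha> = cross m1 m2"
  have \<alpha>0: "(\<Sum>i<3. \<alpha> i * m1 i) = 0" "(\<Sum>i<3. \<alpha> i * m2 i) = 0"
    unfolding sum_lessThan_3 by (simp_all add: \<alpha>_def cross_def algebra_simps)
  define \<psi> where "\<psi> = (\<lambda>x. \<Sum>i<3. \<alpha> i * \<beta> i x)"
  have r\<psi>: "r x * \<psi> x = (\<Sum>i<3. \<alpha> i * \<rho> i x)" for x
    by (simp add: \<psi>_def \<rho>_def sum_distrib_left algebra_simps)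
  have yr\<psi>: "integral {a..x} (\<lambda>x. y1 x * (r x * \<psi> x)) = (\<Sum>i<3. \<alpha> i * I1 i x)"
    "integral {a..x} (\<lambda>x. y2 x * (r x * \<psi> x)) = (\<Sum>i<3. \<alpha> i * I2 i x)" if x: "x \<le> b" for x
  proof -
    have "integral {a..x} (\<lambda>x. y1 x * (r x * \<psi> x)) = integral {a..x} (\<lambda>x. \<Sum>i<3. \<alpha> i * (y1 x * \<rho> i x))"
      unfolding r\<psi> by (simp add: sum_distrib_left algebra_simps)
    also have "\<dots> = (\<Sum>i<3. \<alpha> i * I1 i x)"
      unfolding I1_def by (subst integral_sum) (intro integrable_cmult_real yI order_refl x | simp)+
    finally show "integral {a..x} (\<lambda>x. y1 x * (r x * \<psi> x)) = (\<Sum>i<3. \<alpha> i * I1 i x)" .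
    have "integral {a..x} (\<lambda>x. y2 x * (r x * \<psi> x)) = integral {a..x} (\<lambda>x. \<Sum>i<3. \<alpha> i * (y2 x * \<rho> i x))"
      unfolding r\<psi> by (simp add: sum_distrib_left algebra_simps)
    also have "\<dots> = (\<Sum>i<3. \<alpha> i * I2 i x)"
      unfolding I2_def by (subst integral_sum) (intro integrable_cmult_real yI order_refl x | simp)+
    finally show "integral {a..x} (\<lambda>x. y2 x * (r x * \<psi> x)) = (\<Sum>i<3. \<alpha> i * I2 i x)" .
  qed
  have "0 \<le> integral {a..b} (\<lambda>x. r x * \<psi> x *
    (y1 x * integral {a..x} (\<lambda>x. y2 x * (r x * \<psi> x)) - y2 x * integral {a..x} (\<lambda>x. y1 x * (r x * \<psi> x))))"
  proof (rule test_function[OF ge ab])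
    show "\<psi> \<in> borel_measurable (lebesgue_on J)" unfolding \<psi>_def using \<beta>m by measurable
    show "\<bar>\<psi> x\<bar> \<le> (\<Sum>i<3. \<bar>\<alpha> i\<bar> * \<bar>1 / N i\<bar>)" for x
      unfolding \<psi>_def
      by (intro order_trans[OF sum_abs] sum_mono) (simp only: abs_mult mult_left_mono[OF \<beta>b abs_ge_zero])
    show "\<psi> x = 0" if "x \<notin> {a..b}" for x
      unfolding \<psi>_def
    proof (intro sum.neutral ballI)
      fix i :: nat assume "i \<in> {..<3}"
      then have "x \<notin> {t i..t i + \<eta>}" using tin[of i] that by blast
      then show "\<alpha> i * \<beta> i x = 0" unfolding \<beta>_def by (simp only: if_False mult_zero_right)
    qed
    show "integral {a..b} (\<lambda>x. y1 x * (r x * \<psi> x)) = 0" "integral {a..b} (\<lambda>x. y2 x * (r x * \<psi> x)) = 0"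
      using yr\<psi>[of b] \<alpha>0 by (simp_all add: m1_def m2_def)
  qed
  also have "integral {a..b} (\<lambda>x. r x * \<psi> x *
    (y1 x * integral {a..x} (\<lambda>x. y2 x * (r x * \<psi> x)) - y2 x * integral {a..x} (\<lambda>x. y1 x * (r x * \<psi> x)))) =
    integral {a..b} (\<lambda>x. \<Sum>i<3. \<Sum>j<3. (\<alpha> i * \<alpha> j) * (\<rho> i x * (y1 x * I2 j x - y2 x * I1 j x)))"
  proof (rule integral_cong)
    fix x assume "x \<in> {a..b}"
    then have xb: "x \<le> b" by simp
    show "r x * \<psi> x * (y1 x * integral {a..x} (\<lambda>x. y2 x * (r x * \<psi> x)) - y2 x * integral {a..x} (\<lambda>x. y1 x * (r x * \<psi> x))) =
      (\<Sum>i<3. \<Sum>j<3. (\<alpha> i * \<alpha> j) * (\<rho> i x * (y1 x * I2 j x - y2 x * I1 j x)))"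
      unfolding yr\<psi>[OF xb] unfolding r\<psi> sum_lessThan_3 by (simp add: algebra_simps)
  qed
  also have "\<dots> = (\<Sum>i<3. \<Sum>j<3. (\<alpha> i * \<alpha> j) * integral {a..b} (\<lambda>x. \<rho> i x * (y1 x * I2 j x - y2 x * I1 j x)))"
  proof -
    have "((\<lambda>x. \<Sum>i<3. \<Sum>j<3. (\<alpha> i * \<alpha> j) * (\<rho> i x * (y1 x * I2 j x - y2 x * I1 j x))) has_integral
        (\<Sum>i<3. \<Sum>j<3. (\<alpha> i * \<alpha> j) * integral {a..b} (\<lambda>x. \<rho> i x * (y1 x * I2 j x - y2 x * I1 j x)))) {a..b}"
      by (intro has_integral_sum has_integral_mult_right integrable_integral int2) auto
    then show ?thesis by (rule integral_unique)
  qed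
  also have "\<dots> = bump_form \<alpha> m1 m2 E"
    unfolding bump_form_def by (intro sum.cong refl arg_cong2[where f = "(*)"] B) auto
  finally show ?thesis
    unfolding \<alpha>_def using M1 E by (intro exI[of _ m1] exI[of _ m2] exI[of _ E]) simp
qed

text \<open>As the bumps shrink, the form, a polynomial in the moments and diagonal terms, tends to
  its value at the exact vectors. With A = \<open>k t3 t2\<close>, B = \<open>k t3 t1\<close>, C =
  \<open>k t2 t1\<close> the limiting coefficients are A, -B, C, and the off-diagonal terms ABC,
  -ABC, ABC leave one product.\<close>

lemma op_ge_imp_three_points:
  assumes ge: "op_ge M pre_min l" and t1_t3: "t1 \<in> J" "t2 \<in> J" "t3 \<in> J" "t1 < t2" "t2 < t3"
  shows "k t2 t1 * k t3 t2 * k t3 t1 \<ge> 0"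
proof -
  define t where "t = (\<lambda>i::nat. if i = 0 then t1 else if i = 1 then t2 else t3)"
  have tJ: "t i \<in> J" for i using t1_t3 by (simp add: t_def)
  have step: "\<exists>m1 m2 E. (\<forall>i<3. \<bar>m1 i - y1 (t i)\<bar> \<le> \<omega> \<and> \<bar>m2 i - y2 (t i)\<bar> \<le> \<omega> \<and> \<bar>E i\<bar> \<le> \<omega>) \<and>
    0 \<le> bump_form (cross m1 m2) m1 m2 E" if "\<omega> > 0" for \<omega>
  proof -
    have "\<exists>\<eta>>0. {t i - \<eta>..t i + \<eta>} \<subseteq> J \<and> (\<forall>x\<in>{t i..t i + \<eta>}. \<bar>y1 x - y1 (t i)\<bar> \<le> \<omega> \<and> \<bar>y2 x - y2 (t i)\<bar> \<le> \<omega> \<and>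
      (\<forall>w\<in>{t i..t i + \<eta>}. \<bar>k x w\<bar> \<le> \<omega>))" for i
    proof -
      let ?K = "\<lambda>v. y1 (snd v) * y2 (fst v) - y2 (snd v) * y1 (fst v)"
      \<comment> \<open>A maximum collects the three smallness conditions, so that a single
        neighbourhood serves them all.\<close>
      define W where "W = (J \<times> J) \<inter> (\<lambda>v. max \<bar>?K v\<bar> (max \<bar>y1 (fst v) - y1 (t i)\<bar> \<bar>y2 (fst v) - y2 (t i)\<bar>)) -` {..<\<omega>}"
      have "open W"
        unfolding W_def
        by (intro continuous_open_preimage continuous_intros continuous_on_compose2[OF real_continuous(1)]
            continuous_on_compose2[OF real_continuous(2)]) (auto intro: open_Times open_J)
      moreover have "(t i, t i) \<in> W" using tJ[of i] \<open>\<omega> > 0\<close> by (simp add: W_def)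
      ultimately obtain A B where AB: "open A" "open B" "(t i, t i) \<in> A \<times> B" "A \<times> B \<subseteq> W"
        using open_prod_elim by metis
      have "open (A \<inter> B)" "t i \<in> A \<inter> B" using AB by auto
      then obtain \<eta> where \<eta>: "\<eta> > 0" "cball (t i) \<eta> \<subseteq> A \<inter> B" by (metis open_contains_cball)
      have sub: "{t i - \<eta>..t i + \<eta>} \<subseteq> A \<inter> B" using \<eta>(2) by (simp add: cball_eq_atLeastAtMost)
      have inW: "(x, w) \<in> W" if "x \<in> {t i - \<eta>..t i + \<eta>}" "w \<in> {t i - \<eta>..t i + \<eta>}" for x w
        using that sub AB(4) by blast
      show ?thesis
      proof (intro exI[of _ \<eta>] conjI ballI)
        show "{t i - \<eta>..t i + \<eta>} \<subseteq> J" using inW by (auto simp: W_def)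
        fix x w assume x: "x \<in> {t i..t i + \<eta>}" and w: "w \<in> {t i..t i + \<eta>}"
        have "(x, w) \<in> W" using inW[of x w] x w \<eta>(1) by auto
        then show "\<bar>k x w\<bar> \<le> \<omega>" by (simp add: W_def k_def)
      next
        fix x assume x: "x \<in> {t i..t i + \<eta>}"
        have "(x, t i) \<in> W" using inW[of x "t i"] x \<eta>(1) by auto
        then show "\<bar>y1 x - y1 (t i)\<bar> \<le> \<omega>" "\<bar>y2 x - y2 (t i)\<bar> \<le> \<omega>" by (simp_all add: W_def)
      qed (rule \<eta>(1))
    qed
    then obtain \<eta> where \<eta>: "\<And>i. \<eta> i > 0" "\<And>i. {t i - \<eta> i..t i + \<eta> i} \<subseteq> J"
      "\<And>i x. x \<in> {t i..t i + \<eta> i} \<Longrightarrow> \<bar>y1 x - y1 (t i)\<bar> \<le> \<omega>"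
      "\<And>i x. x \<in> {t i..t i + \<eta> i} \<Longrightarrow> \<bar>y2 x - y2 (t i)\<bar> \<le> \<omega>"
      "\<And>i x w. x \<in> {t i..t i + \<eta> i} \<Longrightarrow> w \<in> {t i..t i + \<eta> i} \<Longrightarrow> \<bar>k x w\<bar> \<le> \<omega>"
      by metis
    \<comment> \<open>Half the gaps keep neighbouring bumps apart with strict inequality.\<close>
    define e where "e = Min {\<eta> 0, \<eta> 1, \<eta> 2, (t2 - t1) / 2, (t3 - t2) / 2}"
    have "e > 0" using \<eta>(1) t1_t3(4,5) by (simp add: e_def)
    moreover have "e \<le> v" if "v \<in> {\<eta> 0, \<eta> 1, \<eta> 2, (t2 - t1) / 2, (t3 - t2) / 2}" for v
      unfolding e_def using that by (intro Min_le) auto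
    ultimately have e: "e > 0" "e \<le> \<eta> 0" "e \<le> \<eta> 1" "e \<le> \<eta> 2" "e \<le> (t2 - t1) / 2" "e \<le> (t3 - t2) / 2"
      by blast+
    have ei: "e \<le> \<eta> i" if "i < 3" for i
    proof -
      have "i = 0 \<or> i = 1 \<or> i = 2" using that by linarith
      then show ?thesis using e by auto
    qed
    show ?thesis
    proof (rule bump_form_nonneg[OF ge e(1)])
      show "t 0 + e < t 1" "t 1 + e < t 2" using e t1_t3(4,5) by (auto simp: t_def)
      have "t 2 + e \<in> {t 2 - \<eta> 2..t 2 + \<eta> 2}" using e \<eta>(1)[of 2] by auto
      then have "t 2 + e \<in> J" using \<eta>(2)[of 2] by blast
      then show "{t 0..t 2 + e} \<subseteq> J" by (rule interval_subset[OF ivl_J tJ])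
      show "\<bar>y1 x - y1 (t i)\<bar> \<le> \<omega>" "\<bar>y2 x - y2 (t i)\<bar> \<le> \<omega>" if "i < 3" "x \<in> {t i..t i + e}" for i x
        using \<eta>(3)[of x i] \<eta>(4)[of x i] ei[OF that(1)] that(2) by auto
      show "\<bar>k x w\<bar> \<le> \<omega>" if "i < 3" "x \<in> {t i..t i + e}" "w \<in> {t i..t i + e}" for i x w
        using \<eta>(5)[of x i w] ei[OF that(1)] that(2,3) by auto
    qed
  qed
  have "\<forall>n. \<exists>m1 m2 E. (\<forall>i<3. \<bar>m1 i - y1 (t i)\<bar> \<le> inverse (real (Suc n)) \<and> \<bar>m2 i - y2 (t i)\<bar> \<le> inverse (real (Suc n)) \<and>
    \<bar>E i\<bar> \<le> inverse (real (Suc n))) \<and> 0 \<le> bump_form (cross m1 m2) m1 m2 E"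
    by (intro allI step) simp
  then obtain m1 m2 E where m: "\<And>n i. i < 3 \<Longrightarrow> \<bar>m1 n i - y1 (t i)\<bar> \<le> inverse (real (Suc n))"
    "\<And>n i. i < 3 \<Longrightarrow> \<bar>m2 n i - y2 (t i)\<bar> \<le> inverse (real (Suc n))"
    "\<And>n i. i < 3 \<Longrightarrow> \<bar>E n i\<bar> \<le> inverse (real (Suc n))"
    and nn: "\<And>n. 0 \<le> bump_form (cross (m1 n) (m2 n)) (m1 n) (m2 n) (E n)"
    by metis
  have lim: "(\<lambda>n. f n) \<longlonglongrightarrow> c" if "\<And>n. \<bar>f n - c\<bar> \<le> inverse (real (Suc n))" for f :: "nat \<Rightarrow> real" and c
  proof -
    have "(\<lambda>n. f n - c) \<longlonglongrightarrow> 0"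
      by (rule Lim_null_comparison[OF _ LIMSEQ_inverse_real_of_nat]) (use that in simp)
    then show ?thesis by (simp add: LIM_zero_iff)
  qed
  have L: "(\<lambda>n. m1 n i) \<longlonglongrightarrow> y1 (t i)" "(\<lambda>n. m2 n i) \<longlonglongrightarrow> y2 (t i)" "(\<lambda>n. E n i) \<longlonglongrightarrow> 0" if "i < 3" for i
    using m[OF that] by (auto intro!: lim)
  have "(\<lambda>n. bump_form (cross (m1 n) (m2 n)) (m1 n) (m2 n) (E n)) \<longlonglongrightarrow>
      bump_form (cross (\<lambda>i. y1 (t i)) (\<lambda>i. y2 (t i))) (\<lambda>i. y1 (t i)) (\<lambda>i. y2 (t i)) (\<lambda>i. 0)"
  proof -
    have c: "(\<lambda>n. cross (m1 n) (m2 n) i) \<longlonglongrightarrow> cross (\<lambda>i. y1 (t i)) (\<lambda>i. y2 (t i)) i" for i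
      unfolding cross_def by (auto intro!: tendsto_intros L)
    have d: "(\<lambda>n. if i = j then E n i else if j < i then m1 n i * m2 n j - m2 n i * m1 n j else 0) \<longlonglongrightarrow>
        (if i = j then 0 else if j < i then y1 (t i) * y2 (t j) - y2 (t i) * y1 (t j) else 0)" if "i < 3" "j < 3" for i j
      using that by (auto intro!: tendsto_intros L)
    show ?thesis unfolding bump_form_def by (intro tendsto_intros c d) auto
  qed
  then have "0 \<le> bump_form (cross (\<lambda>i. y1 (t i)) (\<lambda>i. y2 (t i))) (\<lambda>i. y1 (t i)) (\<lambda>i. y2 (t i)) (\<lambda>i. 0)"
    by (rule LIMSEQ_le_const) (use nn in blast)
  also have "\<dots> = k t2 t1 * k t3 t2 * k t3 t1"
    unfolding bump_form_def sum_lessThan_3 by (simp add: cross_def t_def k_def algebra_simps)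
  finally show ?thesis .
qed

end

text \<open>The equivalence with the Friedrichs extension is operator theory alone. The others form
  a cycle through the sign of \<open>k\<close>: lower bound, positivity of \<open>k\<close>,
  positive solution, lower bound; disconjugacy is tied directly to positivity of
  \<open>k\<close>.\<close>

theorem theorem1p2:
  fixes a b :: ereal and p q r s :: "real \<Rightarrow> real" and l0 :: real
  defines "J \<equiv> einterval a b"
  defines "M \<equiv> SL_measure J r"
  defines "T_min \<equiv> SL_min J p q r s"
  assumes "a < b"
    and "p \<in> borel_measurable (lebesgue_on J)" "q \<in> borel_measurable (lebesgue_on J)"
        "r \<in> borel_measurable (lebesgue_on J)" "s \<in> borel_measurable (lebesgue_on J)"
    and "AE x in lebesgue_on J. p x > 0" "AE x in lebesgue_on J. r x > 0"
    and "(\<lambda>x. 1 / p x) \<in> L1_loc J" "q \<in> L1_loc J" "r \<in> L1_loc J" "s \<in> L1_loc J"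
  shows "(op_ge M T_min l0 \<longleftrightarrow>
            bounded_from_below M T_min \<and> op_ge M (friedrichs_extension M T_min) l0)
       \<and> (op_ge M T_min l0 \<longleftrightarrow> disconjugate J p q r s l0)
       \<and> (op_ge M T_min l0 \<longleftrightarrow>
            (\<exists>u. SL_solution J p q r s (of_real l0) u \<and> (\<forall>x\<in>J. u x \<in> \<real> \<and> Re (u x) > 0)))"
proof -
  have "open J" unfolding J_def by (rule open_einterval)
  moreover have "is_interval J"
    unfolding is_interval_1
  proof (intro ballI allI impI)
    fix u v x assume "u \<in> J" "v \<in> J" "u \<le> x \<and> x \<le> v"
    then have "a < ereal u" "ereal u \<le> ereal x" "ereal x \<le> ereal v" "ereal v < b"
      by (simp_all add: J_def einterval_def)
    then show "x \<in> J" unfolding J_def einterval_def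
      by (blast intro: less_le_trans le_less_trans)
  qed
  ultimately have J: "open J" "is_interval J" .
  obtain x0 where "a < ereal x0" "ereal x0 < b" using ereal_dense2[OF \<open>a < b\<close>] by blast
  then have "J \<noteq> {}" unfolding J_def einterval_def by blast
  interpret sturm_liouville J p q r s
    by unfold_locales (use J \<open>J \<noteq> {}\<close> assms(7,9-) in auto)
  obtain y1 z1 y2 z2 where "sl_fundamental J p q r s l0 y1 z1 y2 z2" by (rule fundamental_system_exists)
  then interpret sl_fundamental J p q r s l0 y1 z1 y2 z2 .
  interpret Tmin: symmetric_op M T_min
    unfolding M_def T_min_def by (rule symmetric_op_SL_min)
  have ge: "op_ge M T_min l0 \<longleftrightarrow> op_ge M pre_min l0"
    unfolding M_def T_min_def by (rule op_ge_SL_min_iff)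
  let ?pos = "\<forall>t\<in>J. \<forall>x\<in>J. t < x \<longrightarrow> k x t > 0"
  let ?sol = "\<exists>u. SL_solution J p q r s (of_real l0) u \<and> (\<forall>x\<in>J. u x \<in> \<real> \<and> Re (u x) > 0)"
  have 1: ?pos if "op_ge M pre_min l0"
    using k_pos_if_three_points[OF op_ge_imp_three_points[OF that[unfolded M_def]]] by blast
  have 2: "disconjugate J p q r s l0 \<longleftrightarrow> ?pos"
    using disconjugate_imp_k_pos k_pos_imp_disconjugate by blast
  have 3: ?sol if ?pos using k_pos_imp_positive_solution that by blast
  have 4: "op_ge M pre_min l0" if ?sol
    using positive_solution_imp_op_ge that unfolding SL_solution_iff M_def by blast
  show ?thesis
    unfolding ge using Tmin.op_ge_iff_friedrichs_ge[of l0] ge 1 2 3 4 by blast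
qed

end
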